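(* Let $n\ge 3$ and let $\mathcal{S}$, $M$ be the Hopf algebra and the von Neumann algebra associated with $A_o(I_n)$. Then $H^1(\mathcal{S},M)=0$.
   Context: $\mathcal{S}=\mathcal{A}_o(I_n)$ is the unital $*$-algebra generated by $n^2$ self-adjoint elements $u_{ij}$ subject to the relations making the matrix $(u_{ij})$ unitary; it is a Hopf $*$-algebra with coproduct $\delta(u_{ij})=\sum_k u_{ik}\otimes u_{kj}$ and counit $\epsilon(u_{ij})=\delta_{ij}$. It has a unique Haar state $h$; let $\lambda:\mathcal{S}\to B(H)$ be the GNS representation of $h$ and $M=\lambda(\mathcal{S})''$. $H^1(\mathcal{S},M)$ is the first Hochschild cohomology group of $\mathcal{S}$ with coefficients in the bimodule $M$, with left action $x\cdot m=\lambda(x)m$ and right action $m\cdot x=m\,\epsilon(x)$: it is the space of linear maps $c:\mathcal{S}\to M$ with $c(xy)=\lambda(x)c(y)+c(x)\epsilon(y)$ modulo the maps $x\mapsto\lambda(x)m-m\epsilon(x)$, $m\in M$. *)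

theory Defs
  imports
    "HOL-Analysis.Analysis"
    "HOL-Library.Poly_Mapping"
    "HOL-Library.Nonpos_Ints"
    "HOL-Algebra.Elementary_Groups"
begin

section \<open>Complex vector spaces, algebras and Hilbert spaces\<close>

class scaleC =
  fixes scaleC :: "complex \<Rightarrow> 'a \<Rightarrow> 'a"  (infixr \<open>*\<^sub>C\<close> 75)

class complex_vector = ab_group_add + scaleC +
  assumes scaleC_add_right: "c *\<^sub>C (x + y) = c *\<^sub>C x + c *\<^sub>C y"
    and scaleC_add_left: "(c + d) *\<^sub>C x = c *\<^sub>C x + d *\<^sub>C x"
    and scaleC_scaleC: "c *\<^sub>C d *\<^sub>C x = (c * d) *\<^sub>C x"
    and scaleC_one: "1 *\<^sub>C x = x"
begin

lemma scaleC_zero_left [simp]: "0 *\<^sub>C x = 0"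
  using scaleC_add_left[of 0 0 x] by simp

lemma scaleC_zero_right [simp]: "c *\<^sub>C 0 = 0"
  using scaleC_add_right[of c 0 0] by simp

lemma scaleC_minus_right: "c *\<^sub>C (- x) = - (c *\<^sub>C x)"
  using scaleC_add_right[of c x "- x"] by (simp add: eq_neg_iff_add_eq_0 add.commute)

lemma scaleC_diff_right: "c *\<^sub>C (x - y) = c *\<^sub>C x - c *\<^sub>C y"
  using scaleC_add_right[of c x "- y"] by (simp add: scaleC_minus_right)

lemma scaleC_sum_right: "c *\<^sub>C sum f A = (\<Sum>i\<in>A. c *\<^sub>C f i)"
  by (induction A rule: infinite_finite_induct) (simp_all add: scaleC_add_right)

end

class complex_algebra_1 = complex_vector + ring + monoid_mult +
  assumes mult_scaleC_left: "(c *\<^sub>C x) * y = c *\<^sub>C (x * y)"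
    and mult_scaleC_right: "x * (c *\<^sub>C y) = c *\<^sub>C (x * y)"

class star_algebra_1 = complex_algebra_1 +
  fixes star :: "'a \<Rightarrow> 'a"
  assumes star_add: "star (x + y) = star x + star y"
    and star_scaleC: "star (c *\<^sub>C x) = cnj c *\<^sub>C star x"
    and star_mult: "star (x * y) = star y * star x"
    and star_star: "star (star x) = x"

text \<open>The inner product is linear in the second and conjugate-linear in the first variable;
  conjugate-linearity and definiteness follow from the axioms below.\<close>

class complex_hilbert_space = complex_vector + banach +
  fixes cinner :: "'a \<Rightarrow> 'a \<Rightarrow> complex"
  assumes scaleR_scaleC: "r *\<^sub>R x = complex_of_real r *\<^sub>C x"
    and cinner_add_right: "cinner x (y + z) = cinner x y + cinner x z"
    and cinner_scaleC_right: "cinner x (c *\<^sub>C y) = c * cinner x y"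
    and cinner_commute: "cinner y x = cnj (cinner x y)"
    and cinner_self: "cinner x x = complex_of_real ((norm x)\<^sup>2)"
begin

lemma norm_scaleC: "norm (c *\<^sub>C x) = cmod c * norm x"
proof -
  have "cinner (c *\<^sub>C x) (c *\<^sub>C x) = c * cnj c * cinner x x"
    by (metis (no_types, lifting) cinner_commute cinner_scaleC_right complex_cnj_cnj
        complex_cnj_mult mult.assoc)
  also have "\<dots> = complex_of_real ((cmod c * norm x)\<^sup>2)"
    by (simp only: cinner_self complex_norm_square[symmetric] of_real_mult[symmetric]
        power_mult_distrib)
  finally have "(norm (c *\<^sub>C x))\<^sup>2 = (cmod c * norm x)\<^sup>2"
    by (simp only: cinner_self of_real_eq_iff)
  then show ?thesis
    by (simp add: power2_eq_iff_nonneg)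
qed

end

instantiation complex :: star_algebra_1
begin

definition "scaleC_complex (c :: complex) (x :: complex) = c * x"
definition "star_complex (x :: complex) = cnj x"

instance
  by standard (simp_all add: scaleC_complex_def star_complex_def algebra_simps)

end

definition complex_linear :: "('a::complex_vector \<Rightarrow> 'b::complex_vector) \<Rightarrow> bool" where
  "complex_linear f \<longleftrightarrow> (\<forall>x y. f (x + y) = f x + f y) \<and> (\<forall>c x. f (c *\<^sub>C x) = c *\<^sub>C f x)"

definition unital_algebra_hom :: "('a::complex_algebra_1 \<Rightarrow> 'b::complex_algebra_1) \<Rightarrow> bool" where
  "unital_algebra_hom f \<longleftrightarrow> complex_linear f \<and> (\<forall>x y. f (x * y) = f x * f y) \<and> f 1 = 1"


section \<open>Quotients of monoid algebras\<close>

text \<open>The type \<open>'k \<Rightarrow>\<^sub>0 complex\<close> with \<open>'k :: monoid_add\<close> is the complex monoid algebra of \<open>'k\<close>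
  (the product is convolution); \<open>Poly_Mapping.single 0 c\<close> is the scalar \<open>c\<close>.\<close>

inductive_set ideal_gen :: "'r::ring_1 set \<Rightarrow> 'r set" for R :: "'r set" where
  ideal_gen_zero: "0 \<in> ideal_gen R"
| ideal_gen_step: "x \<in> ideal_gen R \<Longrightarrow> r \<in> R \<Longrightarrow> x + a * r * b \<in> ideal_gen R"

lemma ideal_gen_base: "r \<in> R \<Longrightarrow> r \<in> ideal_gen R"
  using ideal_gen_step[OF ideal_gen_zero, of r R 1 1] by simp

lemma ideal_gen_add: "x \<in> ideal_gen R \<Longrightarrow> y \<in> ideal_gen R \<Longrightarrow> x + y \<in> ideal_gen R"
  by (rotate_tac, induction rule: ideal_gen.induct)
     (simp_all add: ideal_gen_step add.assoc[symmetric])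

lemma ideal_gen_mult: "x \<in> ideal_gen R \<Longrightarrow> c * x * d \<in> ideal_gen R"
proof (induction rule: ideal_gen.induct)
  case (ideal_gen_step x r a b)
  then have "c * x * d + (c * a) * r * (b * d) \<in> ideal_gen R"
    by (intro ideal_gen.intros)
  then show ?case
    by (simp add: algebra_simps)
qed (simp add: ideal_gen_zero)

lemma ideal_gen_mult_left: "x \<in> ideal_gen R \<Longrightarrow> c * x \<in> ideal_gen R"
  using ideal_gen_mult[of x R c 1] by simp

lemma ideal_gen_mult_right: "x \<in> ideal_gen R \<Longrightarrow> x * d \<in> ideal_gen R"
  using ideal_gen_mult[of x R 1 d] by simp

lemma ideal_gen_minus: "x \<in> ideal_gen R \<Longrightarrow> - x \<in> ideal_gen R"
  using ideal_gen_mult_left[of x R "-1"] by simp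

definition ideal_cong :: "'r::ring_1 set \<Rightarrow> 'r \<Rightarrow> 'r \<Rightarrow> bool" where
  "ideal_cong R x y \<longleftrightarrow> x - y \<in> ideal_gen R"

lemma ideal_cong_refl: "x = y \<Longrightarrow> ideal_cong R x y"
  by (simp add: ideal_cong_def ideal_gen_zero)

lemma equivp_ideal_cong: "equivp (ideal_cong R)"
proof (rule equivpI)
  show "reflp (ideal_cong R)"
    by (simp add: reflp_def ideal_cong_def ideal_gen_zero)
  show "symp (ideal_cong R)"
    unfolding symp_def ideal_cong_def by (metis ideal_gen_minus minus_diff_eq)
  show "transp (ideal_cong R)"
    unfolding transp_def ideal_cong_def
    by (metis ideal_gen_add add_diff_eq diff_add_cancel)
qed

lemma ideal_cong_add: "ideal_cong R x y \<Longrightarrow> ideal_cong R x' y' \<Longrightarrow> ideal_cong R (x + x') (y + y')"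
  unfolding ideal_cong_def using ideal_gen_add[of "x - y" R "x' - y'"]
  by (simp add: algebra_simps)

lemma ideal_cong_minus: "ideal_cong R x y \<Longrightarrow> ideal_cong R (- x) (- y)"
  unfolding ideal_cong_def using ideal_gen_minus[of "x - y" R] by simp

lemma ideal_cong_diff: "ideal_cong R x y \<Longrightarrow> ideal_cong R x' y' \<Longrightarrow> ideal_cong R (x - x') (y - y')"
  using ideal_cong_add[OF _ ideal_cong_minus] by fastforce

lemma ideal_cong_mult:
  assumes "ideal_cong R x y" "ideal_cong R x' y'"
  shows "ideal_cong R (x * x') (y * y')"
proof -
  have "(x - y) * x' + y * (x' - y') \<in> ideal_gen R"
    using assms unfolding ideal_cong_def
    by (intro ideal_gen_add ideal_gen_mult_left ideal_gen_mult_right)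
  then show ?thesis
    by (simp add: ideal_cong_def algebra_simps)
qed

lemma ideal_cong_base: "x - y \<in> R \<Longrightarrow> ideal_cong R x y"
  by (simp add: ideal_cong_def ideal_gen_base)

lemma pm_induct [case_names single add]:
  assumes "\<And>k c. P (Poly_Mapping.single k c)" and "\<And>p q. P p \<Longrightarrow> P q \<Longrightarrow> P (p + q)"
  shows "P (p :: 'k \<Rightarrow>\<^sub>0 'b::comm_monoid_add)"
proof (induction p rule: update_induct)
  case const
  show ?case using assms(1)[of undefined 0] by simp
next
  case (update p a b)
  have "Poly_Mapping.update a b p = p + Poly_Mapping.single a b"
    using update(1)
    by (intro poly_mapping_eqI)
       (auto simp: lookup_update lookup_add lookup_single in_keys_iff when_def)
  then show ?case using assms update by simp
qed

lemma single_zero_central: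
  "Poly_Mapping.single (0::'k::monoid_add) (c::complex) * p = p * Poly_Mapping.single 0 c"
  by (induction p rule: pm_induct) (simp_all add: mult_single algebra_simps)

definition linear_extension :: "('k \<Rightarrow> 'a::complex_vector) \<Rightarrow> ('k \<Rightarrow>\<^sub>0 complex) \<Rightarrow> 'a" where
  "linear_extension f p = (\<Sum>k\<in>Poly_Mapping.keys p. poly_mapping.lookup p k *\<^sub>C f k)"

lemma linear_extension_add:
  "linear_extension f (p + q) = linear_extension f p + linear_extension f q"
  unfolding linear_extension_def
  by (rule setsum_keys_plus_distrib) (simp_all add: scaleC_add_left)

lemma linear_extension_single: "linear_extension f (Poly_Mapping.single k c) = c *\<^sub>C f k"
  by (simp add: linear_extension_def)


section \<open>Tensor product of algebras\<close>

text \<open>The basis of the free vector space on \<open>'a \<times> 'b\<close>; its elements multiply componentwise.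
  The operation is written additively because this is what the product on
  \<open>\<Rightarrow>\<^sub>0\<close> (convolution) refers to.\<close>

datatype ('a, 'b) pure_tensor = Pure_Tensor 'a 'b

instantiation pure_tensor :: (monoid_mult, monoid_mult) monoid_add
begin

definition "0 = Pure_Tensor 1 1"

fun plus_pure_tensor where
  "Pure_Tensor a b + Pure_Tensor a' b' = Pure_Tensor (a * a') (b * b')"

instance
proof
  fix x y z :: "('a, 'b) pure_tensor"
  show "x + y + z = x + (y + z)"
    by (cases x; cases y; cases z) (simp add: mult.assoc)
  show "0 + x = x" "x + 0 = x"
    by (cases x; simp add: zero_pure_tensor_def)+
qed

end

abbreviation pt :: "'a \<Rightarrow> 'b \<Rightarrow> ('a, 'b) pure_tensor \<Rightarrow>\<^sub>0 complex" where
  "pt a b \<equiv> Poly_Mapping.single (Pure_Tensor a b) 1"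

text \<open>The linear span of these elements is already a two-sided ideal.\<close>

definition tensor_relators ::
    "(('a::complex_algebra_1, 'b::complex_algebra_1) pure_tensor \<Rightarrow>\<^sub>0 complex) set" where
  "tensor_relators =
     {pt (a + a') b - pt a b - pt a' b | a a' b. True} \<union>
     {pt a (b + b') - pt a b - pt a b' | a b b'. True} \<union>
     {pt (c *\<^sub>C a) b - Poly_Mapping.single (Pure_Tensor a b) c | c a b. True} \<union>
     {pt a (c *\<^sub>C b) - Poly_Mapping.single (Pure_Tensor a b) c | c a b. True}"

quotient_type (overloaded) ('a, 'b) tensor =
    "('a::complex_algebra_1, 'b::complex_algebra_1) pure_tensor \<Rightarrow>\<^sub>0 complex"
    / "ideal_cong tensor_relators"
  by (rule equivp_ideal_cong)

lift_definition tensor :: "'a::complex_algebra_1 \<Rightarrow> 'b::complex_algebra_1 \<Rightarrow> ('a, 'b) tensor"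
  is "\<lambda>a b. pt a b" .

instantiation tensor :: (complex_algebra_1, complex_algebra_1) complex_algebra_1
begin

lift_definition zero_tensor :: "('a, 'b) tensor" is 0 .
lift_definition one_tensor :: "('a, 'b) tensor" is 1 .
lift_definition plus_tensor :: "('a, 'b) tensor \<Rightarrow> ('a, 'b) tensor \<Rightarrow> ('a, 'b) tensor"
  is "(+)" by (rule ideal_cong_add)
lift_definition minus_tensor :: "('a, 'b) tensor \<Rightarrow> ('a, 'b) tensor \<Rightarrow> ('a, 'b) tensor"
  is "(-)" by (rule ideal_cong_diff)
lift_definition uminus_tensor :: "('a, 'b) tensor \<Rightarrow> ('a, 'b) tensor"
  is "uminus" by (rule ideal_cong_minus)
lift_definition times_tensor :: "('a, 'b) tensor \<Rightarrow> ('a, 'b) tensor \<Rightarrow> ('a, 'b) tensor"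
  is "(*)" by (rule ideal_cong_mult)
lift_definition scaleC_tensor :: "complex \<Rightarrow> ('a, 'b) tensor \<Rightarrow> ('a, 'b) tensor"
  is "\<lambda>c p. Poly_Mapping.single 0 c * p"
  by (simp add: ideal_cong_def right_diff_distrib[symmetric] ideal_gen_mult_left)

instance
proof
  fix x y z :: "('a, 'b) tensor" and c d :: complex
  show "x + y + z = x + (y + z)" "x + y = y + x" "0 + x = x" "- x + x = 0" "x - y = x + - y"
    by (transfer, rule ideal_cong_refl, simp)+
  show "x * y * z = x * (y * z)" "(x + y) * z = x * z + y * z" "x * (y + z) = x * y + x * z"
    "1 * x = x" "x * 1 = x"
    by (transfer, rule ideal_cong_refl, simp add: algebra_simps)+
  show "c *\<^sub>C (x + y) = c *\<^sub>C x + c *\<^sub>C y" "(c + d) *\<^sub>C x = c *\<^sub>C x + d *\<^sub>C x"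
    "c *\<^sub>C d *\<^sub>C x = (c * d) *\<^sub>C x" "1 *\<^sub>C x = x" "(c *\<^sub>C x) * y = c *\<^sub>C (x * y)"
    by (transfer, rule ideal_cong_refl,
        simp add: distrib_left distrib_right single_add mult_single flip: mult.assoc)+
  show "x * (c *\<^sub>C y) = c *\<^sub>C (x * y)"
    by (transfer, rule ideal_cong_refl) (metis mult.assoc single_zero_central)
qed

end

lemma tensor_relators_intros:
  "pt (a + a') b - pt a b - pt a' b \<in> tensor_relators"
  "pt a (b + b') - pt a b - pt a b' \<in> tensor_relators"
  "pt (c *\<^sub>C a) b - Poly_Mapping.single (Pure_Tensor a b) c \<in> tensor_relators"
  "pt a (c *\<^sub>C b) - Poly_Mapping.single (Pure_Tensor a b) c \<in> tensor_relators"
  unfolding tensor_relators_def by blast+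

lemma tensor_mult: "tensor a b * tensor a' b' = tensor (a * a') (b * b')"
  by transfer (simp add: mult_single ideal_cong_refl)

lemma tensor_one: "tensor 1 1 = 1"
  by transfer (simp add: zero_pure_tensor_def[symmetric] ideal_cong_refl)

lemma tensor_add_left: "tensor (a + a') b = tensor a b + tensor a' b"
  by transfer (rule ideal_cong_base, simp add: tensor_relators_intros diff_diff_eq[symmetric])

lemma tensor_add_right: "tensor a (b + b') = tensor a b + tensor a b'"
  by transfer (rule ideal_cong_base, simp add: tensor_relators_intros diff_diff_eq[symmetric])

lemma tensor_scaleC_left: "tensor (c *\<^sub>C a) b = c *\<^sub>C tensor a b"
  by transfer (rule ideal_cong_base, simp add: tensor_relators_intros mult_single)

lemma tensor_scaleC_right: "tensor a (c *\<^sub>C b) = c *\<^sub>C tensor a b"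
  by transfer (rule ideal_cong_base, simp add: tensor_relators_intros mult_single)

text \<open>The linear map \<open>a \<otimes> b \<mapsto> f a b\<close>, for bilinear \<open>f\<close>.\<close>

definition tensor_lift ::
    "('a \<Rightarrow> 'b \<Rightarrow> 'c::complex_vector) \<Rightarrow> ('a::complex_algebra_1, 'b::complex_algebra_1) tensor \<Rightarrow> 'c"
  where
  "tensor_lift f t = linear_extension (case_pure_tensor f) (rep_tensor t)"


definition bilinear_map ::
    "('a::complex_vector \<Rightarrow> 'b::complex_vector \<Rightarrow> 'c::complex_vector) \<Rightarrow> bool" where
  "bilinear_map f \<longleftrightarrow> (\<forall>a. complex_linear (f a)) \<and> (\<forall>b. complex_linear (\<lambda>a. f a b))"

lemma linear_extension_minus: "linear_extension f (- p) = - linear_extension f p"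
  using linear_extension_add[of f p "- p"]
  by (simp add: linear_extension_def[of f 0] eq_neg_iff_add_eq_0 add.commute)

lemma linear_extension_diff:
  "linear_extension f (p - q) = linear_extension f p - linear_extension f q"
  using linear_extension_add[of f p "- q"] by (simp add: linear_extension_minus)

lemma linear_extension_scalar:
  "linear_extension f (Poly_Mapping.single 0 c * p) = c *\<^sub>C linear_extension f p"
  by (induction p rule: pm_induct)
     (simp_all add: mult_single linear_extension_single linear_extension_add scaleC_scaleC
        scaleC_add_right distrib_left)

lemma linear_extension_tensor_relators:
  assumes f: "bilinear_map f" and r: "r \<in> tensor_relators"
  shows "linear_extension (case_pure_tensor f) (p * r * q) = 0"
proof (induction p rule: pm_induct)
  case (single v c)
  show ?case
  proof (induction q rule: pm_induct)
    case (single w d)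
    show ?case
      using f r unfolding bilinear_map_def complex_linear_def tensor_relators_def
      by (cases v; cases w)
         (auto simp: mult_single right_diff_distrib left_diff_distrib distrib_left distrib_right
            linear_extension_single linear_extension_diff mult_scaleC_left mult_scaleC_right
            scaleC_scaleC scaleC_add_right ac_simps)
  qed (simp add: distrib_left linear_extension_add)
qed (simp add: distrib_right linear_extension_add)

lemma linear_extension_tensor_cong:
  assumes f: "bilinear_map f" and "ideal_cong tensor_relators p q"
  shows "linear_extension (case_pure_tensor f) p = linear_extension (case_pure_tensor f) q"
proof -
  have "linear_extension (case_pure_tensor f) x = 0" if "x \<in> ideal_gen tensor_relators" for x
    using that
    by induction (simp_all add: linear_extension_add linear_extension_tensor_relators[OF f],
        simp add: linear_extension_def)
  from this[of "p - q"] show ?thesis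
    using assms(2) by (simp add: ideal_cong_def linear_extension_diff)
qed

lemma tensor_lift_abs:
  "bilinear_map f \<Longrightarrow> tensor_lift f (abs_tensor p) = linear_extension (case_pure_tensor f) p"
  unfolding tensor_lift_def
  by (rule linear_extension_tensor_cong)
     (assumption, simp only: tensor.abs_eq_iff[symmetric] Quotient3_abs_rep[OF Quotient3_tensor])

lemma tensor_lift_tensor: "bilinear_map f \<Longrightarrow> tensor_lift f (tensor a b) = f a b"
  by (simp add: tensor.abs_eq tensor_lift_abs linear_extension_single scaleC_one)

lemma complex_linear_tensor_lift:
  assumes "bilinear_map f"
  shows "complex_linear (tensor_lift f)"
proof -
  have "tensor_lift f (s + t) = tensor_lift f s + tensor_lift f t" for s t
    by (induct s rule: tensor.abs_induct, induct t rule: tensor.abs_induct)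
       (simp add: plus_tensor.abs_eq tensor_lift_abs[OF assms] linear_extension_add)
  moreover have "tensor_lift f (c *\<^sub>C t) = c *\<^sub>C tensor_lift f t" for c t
    by (induct t rule: tensor.abs_induct)
       (simp add: scaleC_tensor.abs_eq tensor_lift_abs[OF assms] linear_extension_scalar)
  ultimately show ?thesis
    by (simp add: complex_linear_def)
qed


section \<open>The algebra \<open>A\<^sub>o(I\<^sub>n)\<close>\<close>

datatype 'g free_word = Free_Word "'g list"

instantiation free_word :: (type) monoid_add
begin

definition "0 = Free_Word []"

fun plus_free_word where
  "Free_Word v + Free_Word w = Free_Word (v @ w)"

instance
proof
  fix x y z :: "'a free_word"
  show "x + y + z = x + (y + z)"
    by (cases x; cases y; cases z) simp
  show "0 + x = x" "x + 0 = x"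
    by (cases x; simp add: zero_free_word_def)+
qed

end

fun rev_word :: "'g free_word \<Rightarrow> 'g free_word" where
  "rev_word (Free_Word w) = Free_Word (rev w)"

text \<open>The free unital \<open>*\<close>-algebra on self-adjoint generators is the free algebra, with the
  antilinear involution reversing words.\<close>

definition free_star :: "('g free_word \<Rightarrow>\<^sub>0 complex) \<Rightarrow> ('g free_word \<Rightarrow>\<^sub>0 complex)" where
  "free_star p = (\<Sum>w\<in>Poly_Mapping.keys p.
     Poly_Mapping.single (rev_word w) (cnj (poly_mapping.lookup p w)))"

definition free_gen :: "'n \<Rightarrow> 'n \<Rightarrow> (('n \<times> 'n) free_word \<Rightarrow>\<^sub>0 complex)" where
  "free_gen i j = Poly_Mapping.single (Free_Word [(i, j)]) 1"

text \<open>The entries of \<open>u u\<^sup>* - 1\<close> and \<open>u\<^sup>* u - 1\<close>.\<close>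

definition ao_relators :: "(('n::finite \<times> 'n) free_word \<Rightarrow>\<^sub>0 complex) set" where
  "ao_relators =
     {(\<Sum>k\<in>UNIV. free_gen i k * free_star (free_gen j k)) - of_bool (i = j) | i j. True} \<union>
     {(\<Sum>k\<in>UNIV. free_star (free_gen k i) * free_gen k j) - of_bool (i = j) | i j. True}"

text \<open>\<open>'n ao\<close> is \<open>A\<^sub>o(I\<^sub>n)\<close> for \<open>n = CARD('n)\<close>, the rows and columns of \<open>u\<close> being indexed by \<open>'n\<close>.\<close>

quotient_type 'n ao = "('n::finite \<times> 'n) free_word \<Rightarrow>\<^sub>0 complex" / "ideal_cong ao_relators"
  by (rule equivp_ideal_cong)

lemma free_star_single: "free_star (Poly_Mapping.single w c) = Poly_Mapping.single (rev_word w) (cnj c)"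
  by (simp add: free_star_def)

lemma free_star_add: "free_star (p + q) = free_star p + free_star q"
  unfolding free_star_def
  by (rule setsum_keys_plus_distrib) (simp_all add: single_add)

lemma free_star_zero: "free_star 0 = 0"
  by (simp add: free_star_def)

lemma free_star_minus: "free_star (- p) = - free_star p"
  using free_star_add[of p "- p"] by (simp add: free_star_zero eq_neg_iff_add_eq_0 add.commute)

lemma free_star_diff: "free_star (p - q) = free_star p - free_star q"
  using free_star_add[of p "- q"] by (simp add: free_star_minus)

lemma free_star_sum: "free_star (sum f A) = (\<Sum>i\<in>A. free_star (f i))"
  by (induction A rule: infinite_finite_induct) (simp_all add: free_star_zero free_star_add)

lemma rev_word_zero: "rev_word 0 = 0"
  by (simp add: zero_free_word_def)

lemma free_star_one: "free_star 1 = 1"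
  using free_star_single[of 0 1] by (simp add: rev_word_zero)

lemma rev_word_add: "rev_word (v + w) = rev_word w + rev_word v"
  by (cases v; cases w) simp

lemma rev_word_rev_word: "rev_word (rev_word w) = w"
  by (cases w) simp

lemma free_star_mult: "free_star (p * q) = free_star q * free_star p"
proof (induction p rule: pm_induct)
  case (single v c)
  show ?case
    by (induction q rule: pm_induct)
       (simp_all add: free_star_single mult_single rev_word_add free_star_add algebra_simps)
qed (simp add: free_star_add algebra_simps)

lemma free_star_free_star: "free_star (free_star p) = p"
  by (induction p rule: pm_induct) (simp_all add: free_star_single free_star_add rev_word_rev_word)

lemma free_star_gen: "free_star (free_gen i j) = free_gen i j"
  by (simp add: free_gen_def free_star_single)

lemma free_star_relators: "r \<in> ao_relators \<Longrightarrow> free_star r \<in> ao_relators"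
proof -
  have *: "free_star (of_bool b) = of_bool b" for b
    by (simp add: free_star_one free_star_zero)
  have 1: "free_star ((\<Sum>k\<in>UNIV. free_gen i k * free_star (free_gen j k)) - of_bool (i = j))
      = (\<Sum>k\<in>UNIV. free_gen j k * free_star (free_gen i k)) - of_bool (j = i)" for i j :: 'b
    by (simp only: free_star_diff free_star_sum free_star_mult free_star_free_star * eq_commute)
  have 2: "free_star ((\<Sum>k\<in>UNIV. free_star (free_gen k i) * free_gen k j) - of_bool (i = j))
      = (\<Sum>k\<in>UNIV. free_star (free_gen k j) * free_gen k i) - of_bool (j = i)" for i j :: 'b
    by (simp only: free_star_diff free_star_sum free_star_mult free_star_free_star * eq_commute)
  assume "r \<in> ao_relators"
  then obtain i j where
    "r = (\<Sum>k\<in>UNIV. free_gen i k * free_star (free_gen j k)) - of_bool (i = j) \<or>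
     r = (\<Sum>k\<in>UNIV. free_star (free_gen k i) * free_gen k j) - of_bool (i = j)"
    unfolding ao_relators_def by blast
  then have
    "free_star r = (\<Sum>k\<in>UNIV. free_gen j k * free_star (free_gen i k)) - of_bool (j = i) \<or>
     free_star r = (\<Sum>k\<in>UNIV. free_star (free_gen k j) * free_gen k i) - of_bool (j = i)"
    by (auto simp only: 1 2)
  then show ?thesis
    unfolding ao_relators_def by blast
qed

lemma free_star_ideal: "x \<in> ideal_gen ao_relators \<Longrightarrow> free_star x \<in> ideal_gen ao_relators"
proof (induction rule: ideal_gen.induct)
  case (ideal_gen_step x r a b)
  then show ?case
    using ideal_gen.ideal_gen_step[OF ideal_gen_step.IH free_star_relators[OF ideal_gen_step.hyps(2)],
        of "free_star b" "free_star a"]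
    by (simp add: free_star_add free_star_mult mult.assoc)
qed (simp add: free_star_zero ideal_gen_zero)

instantiation ao :: (finite) star_algebra_1
begin

lift_definition zero_ao :: "'a ao" is 0 .
lift_definition one_ao :: "'a ao" is 1 .
lift_definition plus_ao :: "'a ao \<Rightarrow> 'a ao \<Rightarrow> 'a ao" is "(+)" by (rule ideal_cong_add)
lift_definition minus_ao :: "'a ao \<Rightarrow> 'a ao \<Rightarrow> 'a ao" is "(-)" by (rule ideal_cong_diff)
lift_definition uminus_ao :: "'a ao \<Rightarrow> 'a ao" is "uminus" by (rule ideal_cong_minus)
lift_definition times_ao :: "'a ao \<Rightarrow> 'a ao \<Rightarrow> 'a ao" is "(*)" by (rule ideal_cong_mult)
lift_definition scaleC_ao :: "complex \<Rightarrow> 'a ao \<Rightarrow> 'a ao"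
  is "\<lambda>c p. Poly_Mapping.single 0 c * p"
  by (simp add: ideal_cong_def right_diff_distrib[symmetric] ideal_gen_mult_left)
lift_definition star_ao :: "'a ao \<Rightarrow> 'a ao" is free_star
  by (simp add: ideal_cong_def free_star_diff[symmetric] free_star_ideal)

instance
proof
  fix x y z :: "'a ao" and c d :: complex
  show "x + y + z = x + (y + z)" "x + y = y + x" "0 + x = x" "- x + x = 0" "x - y = x + - y"
    by (transfer, rule ideal_cong_refl, simp)+
  show "x * y * z = x * (y * z)" "(x + y) * z = x * z + y * z" "x * (y + z) = x * y + x * z"
    "1 * x = x" "x * 1 = x"
    by (transfer, rule ideal_cong_refl, simp add: algebra_simps)+
  show "c *\<^sub>C (x + y) = c *\<^sub>C x + c *\<^sub>C y" "(c + d) *\<^sub>C x = c *\<^sub>C x + d *\<^sub>C x"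
    "c *\<^sub>C d *\<^sub>C x = (c * d) *\<^sub>C x" "1 *\<^sub>C x = x" "(c *\<^sub>C x) * y = c *\<^sub>C (x * y)"
    by (transfer, rule ideal_cong_refl,
        simp add: distrib_left distrib_right single_add mult_single flip: mult.assoc)+
  show "x * (c *\<^sub>C y) = c *\<^sub>C (x * y)"
    by (transfer, rule ideal_cong_refl) (metis mult.assoc single_zero_central)
  show "star (x + y) = star x + star y" "star (x * y) = star y * star x" "star (star x) = x"
    by (transfer, rule ideal_cong_refl,
        simp add: free_star_add free_star_mult free_star_free_star)+
  show "star (c *\<^sub>C x) = cnj c *\<^sub>C star x"
  proof (transfer, rule ideal_cong_refl)
    fix c and p :: "('a \<times> 'a) free_word \<Rightarrow>\<^sub>0 complex"
    show "free_star (Poly_Mapping.single 0 c * p) = Poly_Mapping.single 0 (cnj c) * free_star p"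
      by (simp only: free_star_mult free_star_single rev_word_zero single_zero_central)
  qed
qed

end

lift_definition u :: "'n::finite \<Rightarrow> 'n \<Rightarrow> 'n ao" is free_gen .

lemma star_u: "star (u i j) = u i j"
  by transfer (simp add: free_star_gen ideal_cong_refl)

text \<open>The unital algebra homomorphism sending \<open>u i j\<close> to \<open>f i j\<close>, for \<open>f\<close> satisfying the
  defining relations.\<close>

fun word_value :: "('n \<Rightarrow> 'n \<Rightarrow> 'a::monoid_mult) \<Rightarrow> ('n \<times> 'n) free_word \<Rightarrow> 'a" where
  "word_value f (Free_Word w) = prod_list (map (\<lambda>(i, j). f i j) w)"

definition ao_lift :: "('n::finite \<Rightarrow> 'n \<Rightarrow> 'a::complex_algebra_1) \<Rightarrow> 'n ao \<Rightarrow> 'a" where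
  "ao_lift f x = linear_extension (word_value f) (rep_ao x)"

definition ao_relations :: "('n::finite \<Rightarrow> 'n \<Rightarrow> 'a::complex_algebra_1) \<Rightarrow> bool" where
  "ao_relations f \<longleftrightarrow>
     (\<forall>i j. (\<Sum>k\<in>UNIV. f i k * f j k) = (if i = j then 1 else 0)) \<and>
     (\<forall>i j. (\<Sum>k\<in>UNIV. f k i * f k j) = (if i = j then 1 else 0))"

lemma word_value_add: "word_value f (v + w) = word_value f v * word_value f w"
  by (cases v; cases w) simp

lemma word_value_zero: "word_value f 0 = 1"
  by (simp add: zero_free_word_def)

lemma linear_extension_word_value_mult:
  fixes f :: "'n \<Rightarrow> 'n \<Rightarrow> 'a::complex_algebra_1"
  shows "linear_extension (word_value f) (p * q)
     = linear_extension (word_value f) p * linear_extension (word_value f) q"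
proof (induction p rule: pm_induct)
  case (single v c)
  show ?case
    by (induction q rule: pm_induct)
       (simp_all add: mult_single linear_extension_single linear_extension_add word_value_add
          mult_scaleC_left mult_scaleC_right scaleC_scaleC distrib_left
          mult.commute[where 'a = complex])
qed (simp add: linear_extension_add distrib_right)

lemma linear_extension_zero: "linear_extension f 0 = 0"
  by (simp add: linear_extension_def)

lemma linear_extension_sum: "linear_extension f (sum g A) = (\<Sum>i\<in>A. linear_extension f (g i))"
  by (induction A rule: infinite_finite_induct)
     (simp_all add: linear_extension_zero linear_extension_add)

lemma linear_extension_word_value_one:
  fixes f :: "'n \<Rightarrow> 'n \<Rightarrow> 'a::complex_algebra_1"
  shows "linear_extension (word_value f) 1 = 1"
  using linear_extension_single[of "word_value f" 0 1]
  by (simp add: word_value_zero scaleC_one)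

lemma linear_extension_ao_relators:
  assumes "ao_relations f" "r \<in> ao_relators"
  shows "linear_extension (word_value f) r = 0"
proof -
  have "linear_extension (word_value f) (free_gen i j) = f i j" for i j
    by (simp add: free_gen_def linear_extension_single scaleC_one)
  then show ?thesis
    using assms unfolding ao_relators_def ao_relations_def
    by (auto simp: linear_extension_diff linear_extension_sum linear_extension_word_value_mult
          free_star_gen linear_extension_word_value_one linear_extension_zero)
qed

lemma ao_lift_abs:
  assumes "ao_relations f"
  shows "ao_lift f (abs_ao p) = linear_extension (word_value f) p"
proof -
  have "linear_extension (word_value f) x = 0" if "x \<in> ideal_gen ao_relators" for x
    using that
    by induction (simp_all add: linear_extension_zero linear_extension_add
        linear_extension_word_value_mult linear_extension_ao_relators[OF assms])
  moreover have "ideal_cong ao_relators (rep_ao (abs_ao p)) p"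
    by (simp only: ao.abs_eq_iff[symmetric] Quotient3_abs_rep[OF Quotient3_ao])
  ultimately show ?thesis
    unfolding ao_lift_def ideal_cong_def
    by (metis linear_extension_diff right_minus_eq)
qed

lemma ao_lift_u: "ao_relations f \<Longrightarrow> ao_lift f (u i j) = f i j"
  by (simp add: u.abs_eq ao_lift_abs free_gen_def linear_extension_single scaleC_one)

lemma unital_algebra_hom_ao_lift:
  assumes "ao_relations f"
  shows "unital_algebra_hom (ao_lift f)"
proof -
  have "ao_lift f (x + y) = ao_lift f x + ao_lift f y" for x y
    by (induct x rule: ao.abs_induct, induct y rule: ao.abs_induct)
       (simp add: plus_ao.abs_eq ao_lift_abs[OF assms] linear_extension_add)
  moreover have "ao_lift f (x * y) = ao_lift f x * ao_lift f y" for x y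
    by (induct x rule: ao.abs_induct, induct y rule: ao.abs_induct)
       (simp add: times_ao.abs_eq ao_lift_abs[OF assms] linear_extension_word_value_mult)
  moreover have "ao_lift f (c *\<^sub>C x) = c *\<^sub>C ao_lift f x" for c x
    by (induct x rule: ao.abs_induct)
       (simp add: scaleC_ao.abs_eq ao_lift_abs[OF assms] linear_extension_scalar)
  moreover have "ao_lift f 1 = 1"
    by (simp add: one_ao.abs_eq ao_lift_abs[OF assms] linear_extension_word_value_one)
  ultimately show ?thesis
    by (simp add: unital_algebra_hom_def complex_linear_def)
qed

lemma ao_relations_u: "ao_relations (u :: 'n::finite \<Rightarrow> 'n \<Rightarrow> 'n ao)"
proof -
  have abs_sum: "abs_ao (sum g A) = (\<Sum>i\<in>A. abs_ao (g i))"
    for g :: "'n \<Rightarrow> ('n \<times> 'n) free_word \<Rightarrow>\<^sub>0 complex" and A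
    by (induction A rule: infinite_finite_induct) (simp_all flip: zero_ao.abs_eq plus_ao.abs_eq)
  have "abs_ao (\<Sum>k\<in>UNIV. free_gen i k * free_gen j k) = abs_ao (of_bool (i = j))" for i j :: 'n
    unfolding ao.abs_eq_iff
    by (rule ideal_cong_base) (auto simp: ao_relators_def free_star_gen)
  moreover have "abs_ao (\<Sum>k\<in>UNIV. free_gen k i * free_gen k j) = abs_ao (of_bool (i = j))" for i j :: 'n
    unfolding ao.abs_eq_iff
    by (rule ideal_cong_base) (auto simp: ao_relators_def free_star_gen)
  ultimately show ?thesis
    by (auto simp: ao_relations_def u.abs_eq times_ao.abs_eq one_ao.abs_eq zero_ao.abs_eq
        simp flip: abs_sum)
qed

definition coproduct :: "'n::finite ao \<Rightarrow> ('n ao, 'n ao) tensor" where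
  "coproduct = ao_lift (\<lambda>i j. \<Sum>k\<in>UNIV. tensor (u i k) (u k j))"

definition counit :: "'n::finite ao \<Rightarrow> complex" where
  "counit = ao_lift (\<lambda>i j. of_bool (i = j))"


lemma tensor_sum_left: "tensor (sum f A) b = (\<Sum>i\<in>A. tensor (f i) b)"
  using tensor_scaleC_left[of 0 0 b]
  by (induction A rule: infinite_finite_induct) (simp_all add: tensor_add_left)

lemma tensor_sum_right: "tensor a (sum f A) = (\<Sum>i\<in>A. tensor a (f i))"
  using tensor_scaleC_right[of a 0 0]
  by (induction A rule: infinite_finite_induct) (simp_all add: tensor_add_right)

lemma tensor_zero: "tensor 0 b = 0" "tensor a 0 = 0"
  using tensor_sum_left[of _ "{}"] tensor_sum_right[of _ _ "{}"] by simp_all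

lemma ao_relations_coproduct:
  "ao_relations (\<lambda>i j. \<Sum>k\<in>UNIV. tensor (u i k) (u k j) :: ('n::finite ao, 'n ao) tensor)"
proof -
  have u: "(\<Sum>k\<in>UNIV. u i k * u j k) = (if i = j then 1 else 0)"
    "(\<Sum>k\<in>UNIV. u k i * u k j) = (if i = j then 1 else 0)" for i j :: 'n
    using ao_relations_u[where 'n = 'n] by (simp_all add: ao_relations_def)
  have "(\<Sum>k\<in>UNIV. (\<Sum>a\<in>UNIV. tensor (u i a) (u a k)) * (\<Sum>b\<in>UNIV. tensor (u j b) (u b k)))
      = (if i = j then 1 else 0)" for i j :: 'n
  proof -
    have "(\<Sum>k\<in>UNIV. (\<Sum>a\<in>UNIV. tensor (u i a) (u a k)) * (\<Sum>b\<in>UNIV. tensor (u j b) (u b k)))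
        = (\<Sum>k\<in>UNIV. \<Sum>a\<in>UNIV. \<Sum>b\<in>UNIV. tensor (u i a * u j b) (u a k * u b k))"
      by (simp add: sum_product tensor_mult)
    also have "\<dots> = (\<Sum>a\<in>UNIV. \<Sum>b\<in>UNIV. \<Sum>k\<in>UNIV. tensor (u i a * u j b) (u a k * u b k))"
      by (subst sum.swap) (rule sum.cong[OF refl], rule sum.swap)
    also have "\<dots> = (\<Sum>a\<in>UNIV. \<Sum>b\<in>UNIV. if a = b then tensor (u i a * u j b) 1 else 0)"
      by (simp add: u tensor_zero if_distrib[of "tensor _"] cong: if_cong flip: tensor_sum_right)
    also have "\<dots> = (if i = j then 1 else 0)"
      by (simp add: u tensor_zero tensor_one flip: tensor_sum_left)
    finally show ?thesis .
  qed
  moreover have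
    "(\<Sum>k\<in>UNIV. (\<Sum>a\<in>UNIV. tensor (u k a) (u a i)) * (\<Sum>b\<in>UNIV. tensor (u k b) (u b j)))
      = (if i = j then 1 else 0)" for i j :: 'n
  proof -
    have "(\<Sum>k\<in>UNIV. (\<Sum>a\<in>UNIV. tensor (u k a) (u a i)) * (\<Sum>b\<in>UNIV. tensor (u k b) (u b j)))
        = (\<Sum>k\<in>UNIV. \<Sum>a\<in>UNIV. \<Sum>b\<in>UNIV. tensor (u k a * u k b) (u a i * u b j))"
      by (simp add: sum_product tensor_mult)
    also have "\<dots> = (\<Sum>a\<in>UNIV. \<Sum>b\<in>UNIV. \<Sum>k\<in>UNIV. tensor (u k a * u k b) (u a i * u b j))"
      by (subst sum.swap) (rule sum.cong[OF refl], rule sum.swap)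
    also have "\<dots> = (\<Sum>a\<in>UNIV. \<Sum>b\<in>UNIV. if a = b then tensor 1 (u a i * u b j) else 0)"
      by (simp add: u tensor_zero if_distrib[of "\<lambda>x. tensor x _"] cong: if_cong flip: tensor_sum_left)
    also have "\<dots> = (if i = j then 1 else 0)"
      by (simp add: u tensor_zero tensor_one flip: tensor_sum_right)
    finally show ?thesis .
  qed
  ultimately show ?thesis
    by (simp add: ao_relations_def)
qed

lemma unital_algebra_hom_coproduct: "unital_algebra_hom coproduct"
  unfolding coproduct_def by (rule unital_algebra_hom_ao_lift[OF ao_relations_coproduct])

lemma coproduct_u: "coproduct (u i j) = (\<Sum>k\<in>UNIV. tensor (u i k) (u k j))"
  unfolding coproduct_def by (rule ao_lift_u[OF ao_relations_coproduct])

lemma ao_relations_counit: "ao_relations (\<lambda>i j. of_bool (i = j) :: complex)"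
  by (auto simp: ao_relations_def of_bool_def if_distrib[of "\<lambda>x. x * _"] cong: if_cong)

lemma unital_algebra_hom_counit: "unital_algebra_hom counit"
  unfolding counit_def by (rule unital_algebra_hom_ao_lift[OF ao_relations_counit])

lemma counit_u: "counit (u i j) = of_bool (i = j)"
  unfolding counit_def by (rule ao_lift_u[OF ao_relations_counit])


section \<open>Haar state and GNS representation\<close>

definition is_state :: "('a::star_algebra_1 \<Rightarrow> complex) \<Rightarrow> bool" where
  "is_state h \<longleftrightarrow> complex_linear h \<and> (\<forall>x. h (star x * x) \<in> \<real>\<^sub>\<ge>\<^sub>0) \<and> h 1 = 1"

text \<open>The invariance conditions are \<open>(h \<otimes> id) \<delta>(x) = h(x) 1 = (id \<otimes> h) \<delta>(x)\<close>.\<close>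

definition haar_state :: "('n::finite ao \<Rightarrow> complex) \<Rightarrow> bool" where
  "haar_state h \<longleftrightarrow> is_state h \<and>
     (\<forall>x. tensor_lift (\<lambda>a b. h a *\<^sub>C b) (coproduct x) = h x *\<^sub>C 1) \<and>
     (\<forall>x. tensor_lift (\<lambda>a b. h b *\<^sub>C a) (coproduct x) = h x *\<^sub>C 1)"

text \<open>Elements of \<open>'h \<Rightarrow>\<^sub>L 'h\<close> are only real-linear; \<open>B(H)\<close> consists of the complex-linear ones.\<close>

instantiation blinfun :: (real_normed_vector, complex_hilbert_space) complex_vector
begin

lift_definition scaleC_blinfun :: "complex \<Rightarrow> ('a \<Rightarrow>\<^sub>L 'b) \<Rightarrow> 'a \<Rightarrow>\<^sub>L 'b"
  is "\<lambda>c f x. c *\<^sub>C f x"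
proof -
  fix c :: complex and f :: "'a \<Rightarrow> 'b"
  assume "bounded_linear f"
  moreover have "bounded_linear ((*\<^sub>C) c :: 'b \<Rightarrow> 'b)"
    by (rule bounded_linear_intro[of _ "cmod c"])
       (simp_all add: scaleC_add_right scaleR_scaleC scaleC_scaleC norm_scaleC mult.commute)
  ultimately show "bounded_linear (\<lambda>x. c *\<^sub>C f x)"
    by (rule bounded_linear_compose[rotated])
qed

instance
  by standard
     (transfer, simp add: fun_eq_iff scaleC_add_right scaleC_add_left scaleC_scaleC scaleC_one)+

end

definition bounded_operators :: "('h::complex_hilbert_space \<Rightarrow>\<^sub>L 'h) set" where
  "bounded_operators = {T. complex_linear (blinfun_apply T)}"

definition commutant :: "('h::complex_hilbert_space \<Rightarrow>\<^sub>L 'h) set \<Rightarrow> ('h \<Rightarrow>\<^sub>L 'h) set" where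
  "commutant A = {T \<in> bounded_operators. \<forall>a\<in>A. T o\<^sub>L a = a o\<^sub>L T}"

definition star_representation ::
    "('a::star_algebra_1 \<Rightarrow> 'h::complex_hilbert_space \<Rightarrow>\<^sub>L 'h) \<Rightarrow> bool" where
  "star_representation \<pi> \<longleftrightarrow>
     range \<pi> \<subseteq> bounded_operators \<and> complex_linear \<pi> \<and>
     (\<forall>x y. \<pi> (x * y) = \<pi> x o\<^sub>L \<pi> y) \<and> \<pi> 1 = id_blinfun \<and>
     (\<forall>x \<xi> \<eta>. cinner (\<pi> (star x) \<xi>) \<eta> = cinner \<xi> (\<pi> x \<eta>))"

text \<open>The GNS representation, characterised up to unitary equivalence by its cyclic vector.\<close>

definition gns_representation ::
    "('a::star_algebra_1 \<Rightarrow> complex) \<Rightarrow> ('a \<Rightarrow> 'h::complex_hilbert_space \<Rightarrow>\<^sub>L 'h) \<Rightarrow> 'h \<Rightarrow> bool" where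
  "gns_representation h \<pi> \<Omega> \<longleftrightarrow> star_representation \<pi> \<and>
     (\<forall>x. cinner \<Omega> (\<pi> x \<Omega>) = h x) \<and> closure (range (\<lambda>x. \<pi> x \<Omega>)) = UNIV"


section \<open>First Hochschild cohomology\<close>

text \<open>For an algebra \<open>'a\<close> and a bimodule \<open>M\<close>, a linear subspace of \<open>'m\<close>, with left and
  right actions \<open>l\<close> and \<open>r\<close>.\<close>

definition hochschild_Z1 ::
    "('a::complex_algebra_1 \<Rightarrow> 'm::complex_vector \<Rightarrow> 'm) \<Rightarrow> ('m \<Rightarrow> 'a \<Rightarrow> 'm) \<Rightarrow> 'm set \<Rightarrow>
     ('a \<Rightarrow> 'm) monoid" where
  "hochschild_Z1 l r M =
     \<lparr>carrier = {c. range c \<subseteq> M \<and> complex_linear c \<and> (\<forall>x y. c (x * y) = l x (c y) + r (c x) y)},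
      monoid.mult = (\<lambda>c d x. c x + d x), one = (\<lambda>x. 0)\<rparr>"

definition hochschild_B1 ::
    "('a::complex_algebra_1 \<Rightarrow> 'm::complex_vector \<Rightarrow> 'm) \<Rightarrow> ('m \<Rightarrow> 'a \<Rightarrow> 'm) \<Rightarrow> 'm set \<Rightarrow>
     ('a \<Rightarrow> 'm) set" where
  "hochschild_B1 l r M = {\<lambda>x. l x m - r m x | m. m \<in> M}"

definition hochschild_H1 ::
    "('a::complex_algebra_1 \<Rightarrow> 'm::complex_vector \<Rightarrow> 'm) \<Rightarrow> ('m \<Rightarrow> 'a \<Rightarrow> 'm) \<Rightarrow> 'm set \<Rightarrow>
     ('a \<Rightarrow> 'm) set monoid" where
  "hochschild_H1 l r M = hochschild_Z1 l r M Mod hochschild_B1 l r M"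

end

theory Submission
  imports Defs
begin

text \<open>Write \<open>\<chi> = \<Sum>\<^sub>i u\<^sub>i\<^sub>i\<close>. Since \<open>\<parallel>\<lambda>(\<chi>)\<parallel> \<le> 2 < n = \<epsilon>(\<chi>)\<close>, the operator \<open>\<lambda>(\<chi>) - n\<close> is invertible in \<open>M\<close>, so
  modulo inner cocycles one may assume \<open>c(\<chi>) = 0\<close>. For a vector \<open>\<zeta>\<close>, the array
  \<open>X\<^sub>i\<^sub>j = c(u\<^sub>i\<^sub>j)\<zeta>\<close> then has trace \<open>0\<close> and satisfies \<open>\<rho>X = -X\<close> for the unitary
  \<open>(\<rho>X)\<^sub>i\<^sub>j = \<Sum>\<^sub>k u\<^sub>i\<^sub>k X\<^sub>j\<^sub>k\<close>, and it is orthogonal to the arrays \<open>(u\<^sub>i\<^sub>j - \<delta>\<^sub>i\<^sub>j)\<xi>\<close>. The latter form a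
  subspace of von Neumann dimension \<open>1\<close> of the eigenspace of \<open>\<rho>\<close> for \<open>-1\<close>. That eigenspace has dimension at
  most \<open>1\<close>, hence \<open>X = 0\<close>: its dimension is the Cesaro limit of the traces of \<open>(-\<rho>)\<^sup>m\<close>, and the
  trace of \<open>\<rho>\<^sup>m\<close> is the number of noncrossing pairings of \<open>m\<close> points on a circle which are
  invariant under rotation by two steps, that is \<open>0\<close> for odd \<open>m\<close> and at most \<open>2\<close> for even \<open>m > 0\<close>.\<close>

text \<open>The eigenvalue equation is what a cocycle makes of the relation
  \<open>\<Sum>k. u k i * u k j = \<delta>\<close>, and inner cocycles solve it too; so everything
  rests on a count of dimensions, 1 against at most 1. The second 1 is the Cesaro mean of the bounds
  2 (even powers) and 0 (odd powers). The count needs the values of the Haar state on all words in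
  the generators: they are the entries of the orthogonal projection \<open>kern\<close> onto the
  span of the noncrossing pairings. The trace of this projection composed with a rotation counts
  invariant pairings because the pairings are linearly independent. Rotation invariance of
  \<open>kern\<close> makes \<open>h\<close> a trace, which the count and the bounds for right
  multiplications rely on. The norm bound 2 comes from there being at most \<open>2 ^ m\<close> Dyck
  words of length \<open>m\<close>. No von Neumann dimension is formed. Both projections are
  replaced by finite expressions in the algebra, an average of powers of the rotation and a partial
  sum of a Neumann series, and the size of their difference, measured by \<open>h\<close>, tends to
  0.\<close>

section \<open>Reproducing kernels\<close>

text \<open>Gram-Schmidt, one vector at a time: the kernel projects onto the span of the
  \<open>T d\<close>, which may be linearly dependent. Giving its rows by coefficients
  \<open>C\<close> keeps their membership in the span visible.\<close>

lemma reproducing_kernel_exists: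
  fixes T :: "'i \<Rightarrow> 'a \<Rightarrow> real"
  assumes "finite I" "finite D"
  shows "\<exists>C. \<forall>x\<in>I. \<forall>d\<in>D. (\<Sum>y\<in>I. (\<Sum>e\<in>D. C e x * T e y) * T d y) = T d x"
  using assms(2)
proof induction
  case empty
  then show ?case by simp
next
  case (insert e0 D)
  then obtain C where C: "(\<Sum>y\<in>I. (\<Sum>e\<in>D. C e x * T e y) * T d y) = T d x" if "x \<in> I" "d \<in> D" for x d
    by blast
  \<comment> \<open>\<open>b\<close> applies the transpose of the old kernel to \<open>T e0\<close>,
    so that \<open>r\<close> is orthogonal to the old vectors without any symmetry of the kernel.
    The correction below is the rank-one kernel \<open>g x * r y\<close>.\<close>
  define b where "b e = - (\<Sum>y\<in>I. C e y * T e0 y)" for e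
  define r where "r x = T e0 x + (\<Sum>e\<in>D. b e * T e x)" for x
  define s where "s = (\<Sum>x\<in>I. r x * r x)"
  have orth: "(\<Sum>x\<in>I. r x * T d x) = 0" if d: "d \<in> D" for d
  proof -
    have "(\<Sum>x\<in>I. (\<Sum>e\<in>D. b e * T e x) * T d x) = (\<Sum>e\<in>D. b e * (\<Sum>x\<in>I. T e x * T d x))"
      by (simp add: sum_distrib_left sum_distrib_right mult.assoc sum.swap[of _ D])
    also have "\<dots> = - (\<Sum>e\<in>D. \<Sum>y\<in>I. T e0 y * (C e y * (\<Sum>x\<in>I. T e x * T d x)))"
      by (simp add: b_def sum_distrib_right sum_negf mult_ac)
    also have "\<dots> = - (\<Sum>y\<in>I. T e0 y * (\<Sum>x\<in>I. (\<Sum>e\<in>D. C e y * T e x) * T d x))"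
      by (subst sum.swap) (simp add: sum_distrib_left sum_distrib_right mult.assoc sum.swap[of _ D])
    also have "\<dots> = - (\<Sum>y\<in>I. T e0 y * T d y)"
      using C d by simp
    finally show ?thesis
      by (simp add: r_def distrib_right sum.distrib)
  qed
  have swap: "(\<Sum>y\<in>I. k y * (\<Sum>d\<in>D. b d * T d y)) = (\<Sum>d\<in>D. b d * (\<Sum>y\<in>I. k y * T d y))" for k
    by (simp add: sum_distrib_left sum.swap[of _ D] mult_ac)
  define g where "g x = (T e0 x - (\<Sum>y\<in>I. (\<Sum>e\<in>D. C e x * T e y) * T e0 y)) / s" for x
  define C' where "C' e x = (if e = e0 then g x else C e x + g x * b e)" for e x
  have K': "(\<Sum>e\<in>insert e0 D. C' e x * T e y) = (\<Sum>e\<in>D. C e x * T e y) + g x * r y" for x y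
  proof -
    have "(\<Sum>e\<in>D. C' e x * T e y) = (\<Sum>e\<in>D. C e x * T e y + g x * (b e * T e y))"
      using insert(2) by (intro sum.cong) (auto simp: C'_def algebra_simps)
    then show ?thesis
      using insert by (simp add: C'_def r_def sum.distrib sum_distrib_left distrib_left)
  qed
  have rs: "(\<Sum>y\<in>I. r y * T e0 y) = s"
  proof -
    have "s = (\<Sum>y\<in>I. r y * T e0 y) + (\<Sum>y\<in>I. r y * (\<Sum>e\<in>D. b e * T e y))"
      unfolding s_def by (subst (2) r_def) (simp add: distrib_left sum.distrib)
    also note swap
    finally show ?thesis by (simp add: orth)
  qed
  have "(\<Sum>y\<in>I. (\<Sum>e\<in>insert e0 D. C' e x * T e y) * T d y) = T d x"
    if x: "x \<in> I" and d: "d \<in> insert e0 D" for x d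
  proof -
    have eq: "(\<Sum>y\<in>I. (\<Sum>e\<in>insert e0 D. C' e x * T e y) * T d y) =
        (\<Sum>y\<in>I. (\<Sum>e\<in>D. C e x * T e y) * T d y) + g x * (\<Sum>y\<in>I. r y * T d y)"
      unfolding K' by (simp add: distrib_right sum.distrib sum_distrib_left mult.assoc)
    show ?thesis
    proof (cases "d = e0")
      case False
      with d x C orth eq show ?thesis by simp
    next
      case True
      show ?thesis
      \<comment> \<open>If \<open>s = 0\<close>, then \<open>r\<close> vanishes on \<open>I\<close>:
        \<open>T e0\<close> already lies in the old span and the old kernel still works.\<close>
      proof (cases "s = 0")
        case False
        with eq show ?thesis unfolding True rs by (simp add: g_def)
      next
        case s0: True
        have r0: "r y = 0" if "y \<in> I" for y
          using s0 that assms(1) by (auto simp: s_def sum_nonneg_eq_0_iff)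
        have T0: "T e0 y = - (\<Sum>e\<in>D. b e * T e y)" if "y \<in> I" for y
          using r0[OF that] by (simp add: r_def)
        have "(\<Sum>y\<in>I. (\<Sum>e\<in>D. C e x * T e y) * T e0 y)
            = - (\<Sum>y\<in>I. (\<Sum>e\<in>D. C e x * T e y) * (\<Sum>d\<in>D. b d * T d y))"
          by (simp add: T0 sum_negf)
        also have "\<dots> = - (\<Sum>d\<in>D. b d * (\<Sum>y\<in>I. (\<Sum>e\<in>D. C e x * T e y) * T d y))"
          by (simp only: swap)
        also have "\<dots> = T e0 x"
          using C[OF x] by (simp add: T0[OF x])
        finally show ?thesis
          using eq unfolding True rs by (simp add: s0)
      qed
    qed
  qed
  then show ?case by blast
qed

section \<open>Words\<close>

definition words :: "nat \<Rightarrow> 'a list set" where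
  "words m = {w. length w = m}"

lemma length_words: "w \<in> words m \<Longrightarrow> length w = m"
  by (simp add: words_def)

lemma finite_words [simp]: "finite (words m :: 'a::finite list set)"
  using finite_lists_length_eq[of "UNIV :: 'a set" m] by (simp add: words_def)

lemma words_0: "words 0 = {[]}"
  by (auto simp: words_def)

lemma sum_words_append:
  "(\<Sum>w\<in>words (r + s). F w) = (\<Sum>v\<in>words r. \<Sum>w\<in>words s. F (v @ w))"
  for F :: "'a::finite list \<Rightarrow> 'b::comm_monoid_add"
proof -
  have "(\<Sum>v\<in>words r. \<Sum>w\<in>words s. F (v @ w)) = (\<Sum>(v, w)\<in>words r \<times> words s. F (v @ w))"
    by (simp add: sum.cartesian_product)
  also have "\<dots> = (\<Sum>w\<in>words (r + s). F w)"
    by (rule sum.reindex_bij_witness[of _ "\<lambda>w. (take r w, drop r w)" "\<lambda>(v, w). v @ w"])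
       (auto simp: words_def)
  finally show ?thesis by simp
qed

lemma sum_words_Suc:
  "(\<Sum>w\<in>words (Suc m). F w) = (\<Sum>a\<in>UNIV. \<Sum>w\<in>words m. F (a # w))"
  for F :: "'a::finite list \<Rightarrow> 'b::comm_monoid_add"
proof -
  have "(\<Sum>a\<in>UNIV. \<Sum>w\<in>words m. F (a # w)) = (\<Sum>(a, w)\<in>UNIV \<times> words m. F (a # w))"
    by (simp add: sum.cartesian_product)
  also have "\<dots> = (\<Sum>w\<in>words (Suc m). F w)"
    by (rule sum.reindex_bij_witness[of _ "\<lambda>w. (hd w, tl w)" "\<lambda>(a, w). a # w"])
       (auto simp: words_def length_Suc_conv)
  finally show ?thesis by simp
qed

lemma sum_words_rotate:
  "(\<Sum>w\<in>words m. F (rotate k w)) = (\<Sum>w\<in>words m. F w)"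
  for F :: "'a::finite list \<Rightarrow> 'b::comm_monoid_add"
proof -
  have 1: "(\<Sum>w\<in>words m. F (rotate1 w)) = (\<Sum>w\<in>words m. F w)" for F :: "'a list \<Rightarrow> 'b"
  proof (rule sum.reindex_bij_betw)
    have "inj_on (rotate1 :: 'a list \<Rightarrow> 'a list) (words m)"
      by (rule inj_on_subset[OF inj_rotate1]) simp
    moreover have "rotate1 ` (words m :: 'a list set) \<subseteq> words m"
      by (auto simp: words_def)
    ultimately show "bij_betw rotate1 (words m :: 'a list set) (words m)"
      by (simp add: bij_betw_def endo_inj_surj)
  qed
  show ?thesis
  proof (induction k arbitrary: F)
    case (Suc k)
    then show ?case using 1 Suc[of "\<lambda>w. F (rotate1 w)"] by simp
  qed simp
qed

section \<open>Noncrossing pairings\<close>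

text \<open>A noncrossing pairing is encoded by a Dyck word, each closing letter being paired with the
  opening letter on top of the stack; \<open>ncp d w\<close> indicates whether \<open>w\<close> is constant on the pairs
  of \<open>d\<close>.\<close>

inductive dyck :: "bool list \<Rightarrow> bool" where
  dyck_Nil: "dyck []"
| dyck_cup: "dyck (d1 @ d2) \<Longrightarrow> dyck (d1 @ [True, False] @ d2)"

fun run :: "bool list \<Rightarrow> 'a list \<Rightarrow> 'a list \<Rightarrow> 'a list option" where
  "run [] [] s = Some s"
| "run (True # d) (a # w) s = run d w (a # s)"
| "run (False # d) (a # w) (b # s) = (if a = b then run d w s else None)"
| "run _ _ _ = None"

definition ncp :: "bool list \<Rightarrow> 'a list \<Rightarrow> real" where
  "ncp d w = of_bool (run d w [] = Some [])"

definition dycks :: "nat \<Rightarrow> bool list set" where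
  "dycks m = {d. dyck d \<and> length d = m}"

lemma finite_dycks [simp]: "finite (dycks m)"
  by (rule finite_subset[OF _ finite_words[of m]]) (auto simp: dycks_def words_def)

lemma card_dycks: "card (dycks m) \<le> 2 ^ m"
proof -
  have "card (dycks m) \<le> card (words m :: bool list set)"
    by (rule card_mono[OF finite_words]) (auto simp: dycks_def words_def)
  also have "\<dots> = 2 ^ m"
    using card_lists_length_eq[of "UNIV :: bool set" m] by (simp add: words_def card_UNIV_bool)
  finally show ?thesis .
qed

lemma run_append:
  "length d1 = length w1 \<Longrightarrow>
    run (d1 @ d2) (w1 @ w2) s = Option.bind (run d1 w1 s) (run d2 w2)"
  by (induction d1 w1 s rule: run.induct) auto

lemma run_cup:
  assumes "length d1 = length w1"
  shows "run (d1 @ [True, False] @ d2) (w1 @ [a, b] @ w2) s =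
    (if a = b then run (d1 @ d2) (w1 @ w2) s else None)"
proof -
  have "run (True # False # d2) (a # b # w2) = (\<lambda>s. if a = b then run d2 w2 s else None)"
    by auto
  then show ?thesis
    using assms by (cases "run d1 w1 s") (simp_all add: run_append)
qed

text \<open>Inserting a pair of neighbours amounts to a Kronecker delta at their places. Since
  \<open>dyck\<close> builds every pairing in this way, this identity drives the inductions about
  \<open>ncp\<close>.\<close>

lemma ncp_cup:
  "length d1 = length w1 \<Longrightarrow>
    ncp (d1 @ [True, False] @ d2) (w1 @ [a, b] @ w2) = of_bool (a = b) * ncp (d1 @ d2) (w1 @ w2)"
  unfolding ncp_def run_cup by simp

lemma even_length_dyck: "dyck d \<Longrightarrow> even (length d)"
  by (induction rule: dyck.induct) auto

lemma dycks_odd: "odd m \<Longrightarrow> dycks m = {}"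
  using even_length_dyck by (auto simp: dycks_def)

lemma split_at_pair:
  assumes "length w = r + 2 + s"
  obtains w1 a b w2 where "w = w1 @ [a, b] @ w2" "length w1 = r" "length w2 = s"
proof -
  have "w = take r w @ [w ! r, w ! Suc r] @ drop (Suc (Suc r)) w"
    using assms by (simp add: Cons_nth_drop_Suc id_take_nth_drop[symmetric])
  moreover have "length (take r w) = r" "length (drop (Suc (Suc r)) w) = s"
    using assms by simp_all
  ultimately show ?thesis by (rule that)
qed

text \<open>A balanced word never reaches below its initial stack, so one truth value decides the
  run from every stack. This allows a pair to be wrapped around \<open>d\<close>.\<close>

lemma run_dyck: "dyck d \<Longrightarrow> length w = length d \<Longrightarrow> run d w s = (if ncp d w = 0 then None else Some s)"
proof (induction arbitrary: w s rule: dyck.induct)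
  case dyck_Nil
  then show ?case by (simp add: ncp_def)
next
  case (dyck_cup d1 d2)
  from dyck_cup.prems obtain w1 a b w2
    where w: "w = w1 @ [a, b] @ w2" "length w1 = length d1" "length w2 = length d2"
    by (auto intro: split_at_pair[of w "length d1" "length d2"])
  show ?case
    unfolding w(1) using dyck_cup.IH[of "w1 @ w2" s] w
    by (subst run_cup, simp, subst ncp_cup) auto
qed

lemma dyck_outer: "dyck d \<Longrightarrow> dyck (True # d @ [False])"
proof (induction rule: dyck.induct)
  case dyck_Nil
  show ?case using dyck_cup[of "[]" "[]"] dyck.dyck_Nil by simp
next
  case (dyck_cup d1 d2)
  then show ?case using dyck.dyck_cup[of "True # d1" "d2 @ [False]"] by simp
qed

lemma ncp_outer:
  assumes "dyck d" "length w = length d"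
  shows "ncp (True # d @ [False]) (a # w @ [b]) = of_bool (a = b) * ncp d w"
  using assms run_dyck[OF assms, of "[a]"]
  by (simp add: ncp_def[of "True # _"] run_append) (auto simp: ncp_def)

text \<open>Noncrossing pairings live on a circle, so a cyclic shift yields another one. In the
  induction, a pair of neighbours at the end becomes an outer pair, and any other moves by one
  place.\<close>

lemma ncp_rotate1:
  assumes "dyck d"
  shows "\<exists>d'. dyck d' \<and> length d' = length d \<and>
    (\<forall>w. length w = length d \<longrightarrow> ncp d (rotate1 w) = ncp d' w)"
  using assms
proof (induction rule: dyck.induct)
  case dyck_Nil
  then show ?case by (auto intro!: exI[of _ "[]"] dyck.dyck_Nil)
next
  case (dyck_cup d1 d2)
  show ?case
  proof (cases "d2 = []")
    case True
    have "ncp (d1 @ [True, False] @ d2) (rotate1 w) = ncp (True # d1 @ [False]) w"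
      if w_len: "length w = length d1 + 2" for w :: "'a list"
    proof -
      obtain a v p where w: "w = a # v @ [p]" "length v = length d1"
      proof -
        obtain a u where u: "w = a # u" using w_len by (cases w) auto
        then obtain v p where "u = v @ [p]" using w_len by (cases u rule: rev_cases) auto
        with u that w_len show thesis by simp
      qed
      have "rotate1 w = v @ [p, a] @ []" by (simp add: w)
      then show ?thesis
        unfolding True using ncp_cup[of d1 v "[]" p a "[]"] ncp_outer[of d1 v a p] w dyck_cup(1) True
        by (auto simp: w)
    qed
    then show ?thesis
      using dyck_outer dyck_cup(1) True by (intro exI[of _ "True # d1 @ [False]"]) auto
  next
    case False
    from dyck_cup.IH obtain e where e: "dyck e" "length e = length d1 + length d2"
      "\<And>w::'a list. length w = length d1 + length d2 \<Longrightarrow> ncp (d1 @ d2) (rotate1 w) = ncp e w"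
      by auto
    \<comment> \<open>With \<open>t = length d1\<close>, the pair at places \<open>t\<close>,
      \<open>t + 1\<close> of \<open>rotate1 w\<close> sits at places \<open>t + 1\<close>,
      \<open>t + 2\<close> of \<open>w\<close>; hence \<open>e\<close> is cut one place later than
      \<open>d1 @ d2\<close>.\<close>
    define e1 e2 where "e1 = take (Suc (length d1)) e" "e2 = drop (Suc (length d1)) e"
    then have ee: "e = e1 @ e2" "length e1 = Suc (length d1)" "length e2 = length d2 - 1"
      using e(2) False by (cases d2; auto)+
    have "ncp (d1 @ [True, False] @ d2) (rotate1 w) = ncp (e1 @ [True, False] @ e2) w"
      if w_len: "length w = length d1 + 2 + length d2" for w :: "'a list"
    proof -
      obtain w1 p q w2 where w: "w = w1 @ [p, q] @ w2" "length w1 = length e1" "length w2 = length e2"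
        using w_len ee False by (cases d2) (auto intro: split_at_pair[of w "length e1" "length e2"])
      then obtain a v where av: "w1 = a # v" "length v = length d1" using ee by (cases w1) auto
      have "rotate1 w = v @ [p, q] @ (w2 @ [a])" by (simp add: w av)
      then have "ncp (d1 @ [True, False] @ d2) (rotate1 w) = of_bool (p = q) * ncp (d1 @ d2) (v @ w2 @ [a])"
        using ncp_cup[of d1 v d2 p q "w2 @ [a]"] av by simp
      also have "ncp (d1 @ d2) (v @ w2 @ [a]) = ncp e (a # v @ w2)"
        using e(3)[of "a # v @ w2"] av w ee False by (cases d2) auto
      finally show ?thesis
        using ncp_cup[of e1 w1 e2 p q w2] w ee av by simp
    qed
    moreover have "dyck (e1 @ [True, False] @ e2)" using e(1) ee dyck.dyck_cup by simp
    ultimately show ?thesis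
      using ee False by (intro exI[of _ "e1 @ [True, False] @ e2"]) auto
  qed
qed

lemma ncp_rotate:
  assumes "dyck d"
  shows "\<exists>d'. dyck d' \<and> length d' = length d \<and>
    (\<forall>w::'a list. length w = length d \<longrightarrow> ncp d (rotate k w) = ncp d' w)"
proof (induction k)
  case 0
  then show ?case using assms by auto
next
  case (Suc k)
  then obtain d' where d': "dyck d'" "length d' = length d"
      "\<And>w::'a list. length w = length d \<Longrightarrow> ncp d (rotate k w) = ncp d' w" by blast
  from ncp_rotate1[OF d'(1), where 'a = 'a] obtain d'' where d'': "dyck d''" "length d'' = length d'"
     "\<And>w::'a list. length w = length d' \<Longrightarrow> ncp d' (rotate1 w) = ncp d'' w" by blast
  have "ncp d (rotate (Suc k) w) = ncp d'' w" if "length w = length d" for w :: "'a list"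
    using d'(3)[of "rotate1 w"] d''(3)[of w] d'(2) that by (simp add: rotate1_rotate_swap)
  then show ?case using d' d'' by auto
qed

text \<open>Joining two neighbouring points by a cap: if they form a pair, a loop closes and gives
  the factor \<open>CARD('a)\<close>; otherwise their partners become paired and the factor is 1.
  The cases locate the cap relative to the cup removed by the induction.\<close>

lemma ncp_cap:
  assumes "dyck d" "length d = r + 2 + s"
  shows "\<exists>c d'. dyck d' \<and> length d' = r + s \<and> (\<forall>v1 v2. length v1 = r \<longrightarrow> length v2 = s \<longrightarrow>
    (\<Sum>p\<in>UNIV. ncp d (v1 @ [p, p] @ v2)) = c * ncp d' (v1 @ v2 :: 'a::finite list))"
  using assms
proof (induction arbitrary: r s rule: dyck.induct)
  case dyck_Nil
  then show ?case by simp
next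
  case (dyck_cup d1 d2)
  define t where "t = length d1"
  have len: "length d1 + length d2 = r + s" using dyck_cup.prems by simp
  consider "t = r" | "t = Suc r" | "Suc t = r" | "t \<ge> r + 2" | "t + 2 \<le> r" by linarith
  then show ?case
  proof cases
    case 1
    have "(\<Sum>p\<in>UNIV. ncp (d1 @ [True, False] @ d2) (v1 @ [p, p] @ v2)) =
        real CARD('a) * ncp (d1 @ d2) (v1 @ v2)"
      if "length v1 = r" "length v2 = s" for v1 v2 :: "'a list"
      using that 1 by (simp add: t_def ncp_cup[simplified])
    then show ?thesis using dyck_cup(1) len 
      by (intro exI[of _ "real CARD('a)"] exI[of _ "d1 @ d2"]) auto
  next
    case 2
    have "(\<Sum>p\<in>UNIV. ncp (d1 @ [True, False] @ d2) (v1 @ [p, p] @ v2)) = 1 * ncp (d1 @ d2) (v1 @ v2)"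
      if v: "length v1 = r" "length v2 = s" for v1 v2 :: "'a list"
    proof -
      obtain q v where q: "v2 = q # v" using v 2 len by (cases v2) (auto simp: t_def)
      have "ncp (d1 @ [True, False] @ d2) (v1 @ [p, p] @ v2) =
          (if p = q then ncp (d1 @ d2) (v1 @ [p] @ v) else 0)" for p
        using ncp_cup[of d1 "v1 @ [p]" d2 p q v] 2 v by (simp add: t_def q)
      then show ?thesis by (simp add: q)
    qed
    then show ?thesis using dyck_cup(1) len
      by (intro exI[of _ 1] exI[of _ "d1 @ d2"]) auto
  next
    case 3
    have "(\<Sum>p\<in>UNIV. ncp (d1 @ [True, False] @ d2) (v1 @ [p, p] @ v2)) = 1 * ncp (d1 @ d2) (v1 @ v2)"
      if v: "length v1 = r" "length v2 = s" for v1 v2 :: "'a list"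
    proof -
      obtain q v where q: "v1 = v @ [q]" using v 3 by (cases v1 rule: rev_cases) auto
      have "ncp (d1 @ [True, False] @ d2) (v1 @ [p, p] @ v2) =
          (if q = p then ncp (d1 @ d2) (v @ [p] @ v2) else 0)" for p
        using ncp_cup[of d1 v d2 q p "p # v2"] 3 v by (simp add: t_def q)
      then show ?thesis by (simp add: q)
    qed
    then show ?thesis using dyck_cup(1) len
      by (intro exI[of _ 1] exI[of _ "d1 @ d2"]) auto
  next
    \<comment> \<open>The cup lies to the right of the cap and does not meet it: cap the smaller
      pairing, then reinsert the cup two places further left.\<close>
    case 4
    have "length (d1 @ d2) = r + 2 + (s - 2)" using 4 len by (simp add: t_def)
    from dyck_cup.IH[OF this] obtain c e where e: "dyck e" "length e = r + (s - 2)"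
      "\<And>v1 v2. length v1 = r \<Longrightarrow> length v2 = s - 2 \<Longrightarrow>
        (\<Sum>p\<in>UNIV. ncp (d1 @ d2) (v1 @ [p, p] @ v2)) = c * ncp e (v1 @ v2 :: 'a list)" by blast
    define e1 e2 where "e1 = take (t - 2) e" "e2 = drop (t - 2) e"
    then have ee: "e = e1 @ e2" "length e1 = t - 2" "length e2 = length d2"
      using e(2) 4 len by (auto simp: t_def)
    have "(\<Sum>p\<in>UNIV. ncp (d1 @ [True, False] @ d2) (v1 @ [p, p] @ v2)) =
         c * ncp (e1 @ [True, False] @ e2) (v1 @ v2)"
      if v: "length v1 = r" "length v2 = s" for v1 v2 :: "'a list"
    proof -
      obtain x a b y where x: "v2 = x @ [a, b] @ y" "length x = t - 2 - r" "length y = length d2"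
        by (rule split_at_pair[of v2 "t - 2 - r" "length d2"]) (use v 4 len in \<open>auto simp: t_def\<close>)
      have "ncp (d1 @ [True, False] @ d2) (v1 @ [p, p] @ v2) =
          of_bool (a = b) * ncp (d1 @ d2) (v1 @ [p, p] @ (x @ y))" for p
        using ncp_cup[of d1 "v1 @ [p, p] @ x" d2 a b y] 4 v x by (simp add: t_def)
      then have "(\<Sum>p\<in>UNIV. ncp (d1 @ [True, False] @ d2) (v1 @ [p, p] @ v2)) =
          of_bool (a = b) * (c * ncp e (v1 @ (x @ y)))"
        using e(3)[of v1 "x @ y"] 4 len v x by (simp add: t_def flip: sum_distrib_left)
      then show ?thesis
        using ncp_cup[of e1 "v1 @ x" e2 a b y] v x ee 4 by simp
    qed
    then show ?thesis using e(1) ee dyck.dyck_cup[of e1 e2] 4 len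
      by (intro exI[of _ c] exI[of _ "e1 @ [True, False] @ e2"]) (auto simp: t_def)
  next
    case 5
    have "length (d1 @ d2) = (r - 2) + 2 + s" using 5 len by simp
    from dyck_cup.IH[OF this] obtain c e where e: "dyck e" "length e = (r - 2) + s"
      "\<And>v1 v2. length v1 = r - 2 \<Longrightarrow> length v2 = s \<Longrightarrow>
        (\<Sum>p\<in>UNIV. ncp (d1 @ d2) (v1 @ [p, p] @ v2)) = c * ncp e (v1 @ v2 :: 'a list)" by blast
    define e1 e2 where "e1 = take t e" "e2 = drop t e"
    then have ee: "e = e1 @ e2" "length e1 = t" "length e2 + 2 = length d2"
      using e(2) 5 len by (auto simp: t_def)
    have "(\<Sum>p\<in>UNIV. ncp (d1 @ [True, False] @ d2) (v1 @ [p, p] @ v2)) =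
         c * ncp (e1 @ [True, False] @ e2) (v1 @ v2)"
      if v: "length v1 = r" "length v2 = s" for v1 v2 :: "'a list"
    proof -
      obtain x a b y where x: "v1 = x @ [a, b] @ y" "length x = t" "length y = r - 2 - t"
        by (rule split_at_pair[of v1 t "r - 2 - t"]) (use v 5 len in \<open>auto simp: t_def\<close>)
      have "ncp (d1 @ [True, False] @ d2) (v1 @ [p, p] @ v2) =
          of_bool (a = b) * ncp (d1 @ d2) ((x @ y) @ [p, p] @ v2)" for p
        using ncp_cup[of d1 x d2 a b "y @ [p, p] @ v2"] 5 v x by (simp add: t_def)
      then have "(\<Sum>p\<in>UNIV. ncp (d1 @ [True, False] @ d2) (v1 @ [p, p] @ v2)) =
          of_bool (a = b) * (c * ncp e ((x @ y) @ v2))"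
        using e(3)[of "x @ y" v2] 5 len v x by (simp add: t_def flip: sum_distrib_left)
      then show ?thesis
        using ncp_cup[of e1 x e2 a b "y @ v2"] v x ee 5 by simp
    qed
    then show ?thesis using e(1) ee dyck.dyck_cup[of e1 e2] 5 len
      by (intro exI[of _ c] exI[of _ "e1 @ [True, False] @ e2"]) (auto simp: t_def)
  qed
qed

section \<open>Linear independence of noncrossing pairings\<close>

definition alt :: "'a \<Rightarrow> 'a \<Rightarrow> nat \<Rightarrow> 'a" where
  "alt x y h = (if even h then x else y)"

fun altstack :: "'a \<Rightarrow> 'a \<Rightarrow> nat \<Rightarrow> 'a list" where
  "altstack x y 0 = []"
| "altstack x y (Suc h) = alt x y h # altstack x y h"

text \<open>A noncrossing pairing can only be constant on pairs along \<open>zigzag x y d 0\<close> if its Dyck path lies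
  above that of \<open>d\<close>; this triangularity gives linear independence.\<close>

fun zigzag :: "'a \<Rightarrow> 'a \<Rightarrow> bool list \<Rightarrow> nat \<Rightarrow> 'a list" where
  "zigzag x y [] h = []"
| "zigzag x y (True # d) h = alt x y h # zigzag x y d (Suc h)"
| "zigzag x y (False # d) h = alt x y (h - 1) # zigzag x y d (h - 1)"

fun path_from :: "bool list \<Rightarrow> nat \<Rightarrow> bool" where
  "path_from [] h \<longleftrightarrow> h = 0"
| "path_from (True # d) h \<longleftrightarrow> path_from d (Suc h)"
| "path_from (False # d) h \<longleftrightarrow> h > 0 \<and> path_from d (h - 1)"

text \<open>Heights summed along the path: a number that strictly grows when a path is replaced by a
  higher one of the same length.\<close>

fun area :: "bool list \<Rightarrow> nat \<Rightarrow> nat" where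
  "area [] h = 0"
| "area (True # d) h = Suc h + area d (Suc h)"
| "area (False # d) h = (h - 1) + area d (h - 1)"

text \<open>Stacks are words in the free product of copies of \<open>\<int>/2\<close>, and \<open>red\<close> computes the reduced
  form. Pushing and popping a letter are both multiplication by it, so the reduced form of the
  stack only depends on the word read so far and bounds the height of the stack from below.\<close>

fun cancel :: "'a \<Rightarrow> 'a list \<Rightarrow> 'a list" where
  "cancel a [] = [a]"
| "cancel a (b # s) = (if a = b then s else a # b # s)"

definition red :: "'a list \<Rightarrow> 'a list" where
  "red s = foldr cancel s []"

lemma red_Cons: "red (a # s) = cancel a (red s)"
  by (simp add: red_def)

lemma length_red: "length (red s) \<le> length s"
proof (induction s)
  case (Cons a s)
  then show ?case by (cases "red s") (auto simp: red_Cons)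
qed (simp add: red_def)

lemma distinct_adj_cancel: "distinct_adj s \<Longrightarrow> distinct_adj (cancel a s)"
  by (cases s) (auto simp: distinct_adj_Cons)

lemma distinct_adj_red: "distinct_adj (red s)"
  by (induction s) (simp_all add: red_Cons distinct_adj_cancel, simp add: red_def)

lemma cancel_cancel: "distinct_adj s \<Longrightarrow> cancel a (cancel a s) = s"
  by (cases s rule: remdups_adj.cases) auto

lemma cancel_altstack:
  assumes "x \<noteq> y"
  shows "cancel (alt x y h) (altstack x y h) = altstack x y (Suc h)"
  using assms by (cases h) (auto simp: alt_def)

lemma path_from_cup: "path_from (d1 @ d2) h \<Longrightarrow> path_from (d1 @ [True, False] @ d2) h"
proof (induction d1 arbitrary: h)
  case (Cons b d1)
  then show ?case by (cases b) auto
qed simp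

lemma path_from_dyck: "dyck d \<Longrightarrow> path_from d 0"
  by (induction rule: dyck.induct) (simp, rule path_from_cup)

lemma length_zigzag: "length (zigzag x y d h) = length d"
  by (induction x y d h rule: zigzag.induct) auto

lemma run_zigzag: "path_from d h \<Longrightarrow> run d (zigzag x y d h) (altstack x y h) = Some []"
proof (induction d arbitrary: h)
  case (Cons b d)
  show ?case
  proof (cases b)
    case True
    then show ?thesis using Cons.prems Cons.IH[of "Suc h"] by simp
  next
    case False
    then show ?thesis using Cons.prems Cons.IH[of "h - 1"] by (cases h) auto
  qed
qed simp

text \<open>Along a zigzag of \<open>d\<close> the reduced stack is alternating and as long as the
  path of \<open>d\<close> is high, so every successful run keeps at least that many letters on its
  stack. Equal areas force equal heights at every time, hence equal words.\<close>

lemma run_zigzag_area: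
  assumes "x \<noteq> y" "path_from d h" "run d' (zigzag x y d h) s = Some []" "red s = altstack x y h"
  shows "h \<le> length s \<and> area d h \<le> area d' (length s) \<and>
    (h = length s \<longrightarrow> area d h = area d' (length s) \<longrightarrow> d = d')"
  using assms(2-)
proof (induction d arbitrary: h d' s)
  case Nil
  then have "d' = []" by (cases d' rule: list.exhaust) (auto elim: run.elims)
  with Nil show ?case by auto
next
  case (Cons b d)
  have len: "length (altstack x y h) = h" for h by (induction h) auto
  have hs: "h \<le> length s" using length_red[of s] Cons.prems(3) len by simp
  define h' where "h' = (if b then Suc h else h - 1)"
  define a where "a = (if b then alt x y h else alt x y (h - 1))"
  have w: "zigzag x y (b # d) h = a # zigzag x y d h'" by (cases b) (auto simp: a_def h'_def)
  have p: "path_from d h'" using Cons.prems(1) by (cases b) (auto simp: h'_def)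
  have ca: "cancel a (altstack x y h) = altstack x y h'"
    using Cons.prems(1) cancel_altstack[OF assms(1), of h] by (cases b; cases h) (auto simp: a_def h'_def)
  from Cons.prems(2) obtain b' e' where d': "d' = b' # e'"
    unfolding w by (cases d') auto
  obtain t where t: "run e' (zigzag x y d h') t = Some []" "red t = altstack x y h'"
    "length t = (if b' then Suc (length s) else length s - 1)"
  proof (cases b')
    case True
    then show ?thesis using that[of "a # s"] Cons.prems ca unfolding w d' by (simp add: red_Cons)
  next
    case False
    with Cons.prems(2) obtain t where t: "s = a # t" "run e' (zigzag x y d h') t = Some []"
      unfolding w d' by (cases s) (auto split: if_splits)
    have "red t = altstack x y h'"
      using Cons.prems(3) ca cancel_cancel[OF distinct_adj_red, of a t] unfolding t(1) red_Cons by simp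
    then show ?thesis using that[of t] t False by simp
  qed
  note IH = Cons.IH[OF p t(1,2)]
  have area: "area (b # d) h = h' + area d h'" "area d' (length s) = length t + area e' (length t)"
    by (cases b; simp add: h'_def) (cases b'; simp add: d' t(3))
  have "b # d = d'" if "h = length s" "area (b # d) h = area d' (length s)"
  proof -
    have "h' = length t" "area d h' = area e' (length t)" using that(2) IH unfolding area by linarith+
    moreover have "b = b'"
      using \<open>h' = length t\<close> that(1) Cons.prems(1) by (auto simp: h'_def t(3) split: if_splits)
    ultimately show ?thesis using IH d' by simp
  qed
  then show ?case using hs IH unfolding area by auto
qed

text \<open>In the support of \<open>c\<close> take \<open>e\<close> of maximal area: at the zigzag
  of \<open>e\<close> every other pairing of the support vanishes, and the relation reduces to
  \<open>c e = 0\<close>. Two letters suffice for a zigzag.\<close>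

lemma ncp_independent:
  fixes c :: "bool list \<Rightarrow> real"
  assumes card: "CARD('a::finite) \<ge> 2"
    and c: "\<And>w::'a list. w \<in> words m \<Longrightarrow> (\<Sum>d\<in>dycks m. c d * ncp d w) = 0"
    and d: "d \<in> dycks m"
  shows "c d = 0"
proof (rule ccontr)
  assume "c d \<noteq> 0"
  define S where "S = {d \<in> dycks m. c d \<noteq> 0}"
  have S: "finite S" "S \<noteq> {}" using d \<open>c d \<noteq> 0\<close> by (auto simp: S_def)
  then have "Max ((\<lambda>d. area d 0) ` S) \<in> (\<lambda>d. area d 0) ` S" by (intro Max_in) auto
  then obtain e where e: "e \<in> S" "area e 0 = Max ((\<lambda>d. area d 0) ` S)" by auto
  have max: "area d' 0 \<le> area e 0" if "d' \<in> S" for d'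
    unfolding e(2) using that S by (intro Max_ge) auto
  from card obtain x y :: 'a where xy: "x \<noteq> y"
    by (metis card_2_iff' ex_card[of 2 "UNIV :: 'a set"] insertI1 subset_UNIV)
  define w where "w = zigzag x y e 0"
  have p: "path_from e 0" using e by (auto simp: S_def dycks_def path_from_dyck)
  have w: "w \<in> words m" using e by (auto simp: S_def dycks_def words_def w_def length_zigzag)
  have "c d' * ncp d' w = (if d' = e then c e else 0)" if "d' \<in> dycks m" for d'
  proof (cases "c d' = 0 \<or> ncp d' w = 0")
    case True
    then show ?thesis using e run_zigzag[OF p, of x y] by (auto simp: S_def ncp_def w_def)
  next
    case False
    then have "d' \<in> S" "run d' w [] = Some []" using that by (auto simp: S_def ncp_def)
    then have "e = d'"
      using run_zigzag_area[OF xy p, of d' "[]"] max[of d'] by (auto simp: w_def red_def)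
    then show ?thesis using \<open>run d' w [] = Some []\<close> by (simp add: ncp_def)
  qed
  then have "(\<Sum>d'\<in>dycks m. c d' * ncp d' w) = c e"
    using e by (simp add: S_def)
  then show False using c[OF w] e by (simp add: S_def)
qed

lemma ncp_inject:
  assumes card: "CARD('a::finite) \<ge> 2" and d: "d \<in> dycks m" "e \<in> dycks m"
    and eq: "\<And>w::'a list. w \<in> words m \<Longrightarrow> ncp d w = ncp e w"
  shows "d = e"
proof (rule ccontr)
  assume ne: "d \<noteq> e"
  define c :: "bool list \<Rightarrow> real" where "c f = (if f = d then 1 else if f = e then -1 else 0)" for f
  have "(\<Sum>f\<in>dycks m. c f * ncp f w) = 0" if "w \<in> words m" for w :: "'a list"
  proof -
    have "(\<Sum>f\<in>dycks m. c f * ncp f w) = (\<Sum>f\<in>{d, e}. c f * ncp f w)"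
      by (rule sum.mono_neutral_right) (use d in \<open>auto simp: c_def\<close>)
    then show ?thesis using ne eq[OF that] by (simp add: c_def)
  qed
  from ncp_independent[OF card this d(1)] show False by (simp add: c_def)
qed

section \<open>The projection onto the span of noncrossing pairings\<close>

text \<open>Weingarten coefficients: for independent pairings this is the inverse Gram matrix
  applied to the values \<open>ncp d x\<close>. Choosing a solution avoids inverting that
  matrix.\<close>

definition kern_coeff :: "nat \<Rightarrow> bool list \<Rightarrow> 'a::finite list \<Rightarrow> real" where
  "kern_coeff m = (SOME C. \<forall>x\<in>words m. \<forall>d\<in>dycks m.
     (\<Sum>y\<in>words m. (\<Sum>e\<in>dycks m. C e x * ncp e y) * ncp d (y :: 'a list)) = ncp d (x :: 'a list))"

text \<open>The matrix of the orthogonal projection, in the space of functions on words, onto the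
  span of the noncrossing pairings.\<close>

definition kern :: "'a::finite list \<Rightarrow> 'a list \<Rightarrow> real" where
  "kern x y = (\<Sum>e\<in>dycks (length x). kern_coeff (length x) e x * ncp e y)"

lemma kern_ncp:
  assumes "x \<in> words m" "d \<in> dycks m"
  shows "(\<Sum>y\<in>words m. kern x y * ncp d y) = ncp d x"
proof -
  have "\<forall>x\<in>words m. \<forall>d\<in>dycks m.
     (\<Sum>y\<in>words m. (\<Sum>e\<in>dycks m. kern_coeff m e x * ncp e y) * ncp d (y :: 'a list)) = ncp d (x :: 'a list)"
    unfolding kern_coeff_def by (rule someI_ex[OF reproducing_kernel_exists]) simp_all
  then show ?thesis using assms by (auto simp: kern_def words_def)
qed

text \<open>The rows of \<open>kern\<close> lie in the span that it fixes, so
  \<open>kern y x\<close> is the inner product of the rows of \<open>x\<close> and \<open>y\<close>,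
  a symmetric expression.\<close>

lemma kern_sym:
  assumes "length x = length y"
  shows "kern x y = kern y x"
proof -
  have *: "(\<Sum>z\<in>words (length x). kern x z * kern y z) = kern y x" if "length x = length y" for x y :: "'a list"
  proof -
    have "(\<Sum>z\<in>words (length x). kern x z * kern y z) = (\<Sum>e\<in>dycks (length y).
        kern_coeff (length y) e y * (\<Sum>z\<in>words (length x). kern x z * ncp e z))"
      unfolding kern_def[of y] by (simp add: sum_distrib_left sum.swap[of _ "dycks _"] mult_ac)
    also have "\<dots> = (\<Sum>e\<in>dycks (length y). kern_coeff (length y) e y * ncp e x)"
      using that kern_ncp[of x "length y"] by (intro sum.cong refl) (simp add: words_def)
    finally show ?thesis by (simp add: kern_def)
  qed
  show ?thesis using *[of x y] *[of y x] assms by (simp add: mult.commute)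
qed

definition ncp_span :: "nat \<Rightarrow> ('a list \<Rightarrow> real) \<Rightarrow> bool" where
  "ncp_span m f \<longleftrightarrow> (\<exists>c. \<forall>w\<in>words m. f w = (\<Sum>d\<in>dycks m. c d * ncp d w))"

lemma ncp_span_kern: "x \<in> words m \<Longrightarrow> ncp_span m (kern x)"
  unfolding ncp_span_def kern_def by (auto simp: words_def)

lemma ncp_span_ncp: "d \<in> dycks m \<Longrightarrow> ncp_span m (ncp d)"
  unfolding ncp_span_def
  by (rule exI[of _ "\<lambda>e. if e = d then 1 else 0"]) (simp add: if_distrib[of "\<lambda>x. x * _"] cong: if_cong)

lemma ncp_span_diff: "ncp_span m f \<Longrightarrow> ncp_span m g \<Longrightarrow> ncp_span m (\<lambda>w. f w - g w)"
  unfolding ncp_span_def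
proof (elim exE)
  fix c d assume "\<forall>w\<in>words m. f w = (\<Sum>e\<in>dycks m. c e * ncp e w)" "\<forall>w\<in>words m. g w = (\<Sum>e\<in>dycks m. d e * ncp e w)"
  then show "\<exists>c. \<forall>w\<in>words m. f w - g w = (\<Sum>d\<in>dycks m. c d * ncp d w)"
    by (intro exI[of _ "\<lambda>e. c e - d e"]) (simp add: left_diff_distrib sum_subtractf)
qed

lemma ncp_span_cong: "(\<And>w. w \<in> words m \<Longrightarrow> f w = g w) \<Longrightarrow> ncp_span m f \<longleftrightarrow> ncp_span m g"
  unfolding ncp_span_def by simp

lemma ncp_span_sum:
  assumes "finite A" "\<And>i. i \<in> A \<Longrightarrow> ncp_span m (f i)"
  shows "ncp_span m (\<lambda>w. \<Sum>i\<in>A. a i * f i w)"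
proof -
  from assms(2) have "\<forall>i\<in>A. \<exists>c. \<forall>w\<in>words m. f i w = (\<Sum>d\<in>dycks m. c d * ncp d w)"
    unfolding ncp_span_def by blast
  then obtain c where c: "\<forall>i\<in>A. \<forall>w\<in>words m. f i w = (\<Sum>d\<in>dycks m. c i d * ncp d w)" by metis
  have "(\<Sum>i\<in>A. a i * f i w) = (\<Sum>d\<in>dycks m. (\<Sum>i\<in>A. a i * c i d) * ncp d w)" if "w \<in> words m" for w
    using c that by (simp add: sum_distrib_left sum_distrib_right sum.swap[of _ A] mult.assoc)
  then show ?thesis unfolding ncp_span_def by (intro exI[of _ "\<lambda>d. \<Sum>i\<in>A. a i * c i d"]) simp
qed

text \<open>Identities for \<open>kern\<close> are proved through this: the difference of the two
  sides lies in the span and is orthogonal to it.\<close>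

lemma ncp_span_orthogonal:
  fixes f :: "'a::finite list \<Rightarrow> real"
  assumes "ncp_span m f" "\<And>d. d \<in> dycks m \<Longrightarrow> (\<Sum>w\<in>words m. f w * ncp d w) = 0" "w \<in> words m"
  shows "f w = 0"
proof -
  from assms(1) obtain c where c: "\<And>w. w \<in> words m \<Longrightarrow> f w = (\<Sum>d\<in>dycks m. c d * ncp d w)"
    unfolding ncp_span_def by blast
  have "(\<Sum>w\<in>words m. f w * f w) = (\<Sum>w\<in>words m. f w * (\<Sum>d\<in>dycks m. c d * ncp d w))"
    using c by simp
  also have "\<dots> = (\<Sum>d\<in>dycks m. c d * (\<Sum>w\<in>words m. f w * ncp d w))"
    by (simp add: sum_distrib_left sum.swap[of _ "dycks _"] mult_ac)
  also have "\<dots> = 0" using assms(2) by simp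
  finally show ?thesis
    using assms(3) by (simp add: sum_nonneg_eq_0_iff)
qed

lemma ncp_span_rotate:
  fixes f :: "'a::finite list \<Rightarrow> real"
  assumes "ncp_span m f"
  shows "ncp_span m (\<lambda>w. f (rotate k w))"
proof -
  from assms obtain c where c: "\<And>w. w \<in> words m \<Longrightarrow> f w = (\<Sum>d\<in>dycks m. c d * ncp d w)"
    unfolding ncp_span_def by blast
  have "ncp_span m (\<lambda>w. \<Sum>d\<in>dycks m. c d * ncp d (rotate k w :: 'a list))"
  proof (rule ncp_span_sum)
    fix d assume "d \<in> dycks m"
    then obtain d' where "dyck d'" "length d' = m"
      "\<And>w::'a list. length w = m \<Longrightarrow> ncp d (rotate k w) = ncp d' w"
      using ncp_rotate[of d k, where 'a = 'a] by (auto simp: dycks_def)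
    then show "ncp_span m (\<lambda>w::'a list. ncp d (rotate k w))"
      using ncp_span_ncp[of d' m, where 'a = 'a] ncp_span_cong[of m "\<lambda>w::'a list. ncp d (rotate k w)" "ncp d'"]
      by (auto simp: dycks_def words_def)
  qed simp
  then show ?thesis
    by (subst ncp_span_cong[of m _ "\<lambda>w. \<Sum>d\<in>dycks m. c d * ncp d (rotate k w :: 'a list)"])
      (simp_all add: c words_def)
qed

text \<open>A rotation of words is orthogonal and permutes the noncrossing pairings, so it commutes
  with the projection onto their span.\<close>

lemma kern_rotate:
  assumes "length x = length y"
  shows "kern (rotate k x) (rotate k y) = kern x (y :: 'a::finite list)"
proof -
  define m where "m = length x"
  have xy: "x \<in> words m" "rotate k x \<in> words m" "y \<in> words m" using assms by (auto simp: m_def words_def)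
  have "ncp_span m (\<lambda>w. kern (rotate k x) (rotate k w) - kern x w)"
    using xy by (intro ncp_span_diff ncp_span_rotate ncp_span_kern)
  moreover have "(\<Sum>w\<in>words m. (kern (rotate k x) (rotate k w) - kern x w) * ncp d w) = 0"
    if d: "d \<in> dycks m" for d
  proof -
    \<comment> \<open>Rotating by \<open>k\<close> another \<open>m - 1\<close> times undoes the
      rotation by \<open>k\<close>, as \<open>m * k\<close> steps are full turns.\<close>
    have rotate_back: "rotate ((m - 1) * k) (rotate k w) = w" if "w \<in> words m" for w :: "'a list"
    proof -
      have "(m - 1) * k + k = m * k \<or> m = 0" by (cases m) auto
      then show ?thesis
        using that rotate_conv_mod[of "m * k" w] by (auto simp: rotate_rotate words_def)
    qed
    obtain d' where d': "d' \<in> dycks m"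
      "\<And>w::'a list. w \<in> words m \<Longrightarrow> ncp d (rotate ((m - 1) * k) w) = ncp d' w"
      using ncp_rotate[of d "(m - 1) * k", where 'a = 'a] d by (auto simp: dycks_def words_def)
    have "(\<Sum>w\<in>words m. kern (rotate k x) (rotate k w) * ncp d w) =
        (\<Sum>w\<in>words m. kern (rotate k x) (rotate k w) * ncp d' (rotate k w))"
    proof (rule sum.cong)
      fix w :: "'a list" assume w: "w \<in> words m"
      then have "rotate k w \<in> words m" by (simp add: words_def)
      from d'(2)[OF this] rotate_back[OF w] show
        "kern (rotate k x) (rotate k w) * ncp d w = kern (rotate k x) (rotate k w) * ncp d' (rotate k w)" by simp
    qed simp
    also have "\<dots> = (\<Sum>w\<in>words m. kern (rotate k x) w * ncp d' w)"
      by (rule sum_words_rotate)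
    also have "\<dots> = ncp d x"
      using kern_ncp[OF xy(2) d'(1)] d'(2)[OF xy(2)] rotate_back[OF xy(1)] by simp
    finally show ?thesis
      using kern_ncp[OF xy(1) d] by (simp add: left_diff_distrib sum_subtractf)
  qed
  ultimately show ?thesis
    using ncp_span_orthogonal[of m "\<lambda>w. kern (rotate k x) (rotate k w) - kern x w" y] xy by simp
qed

text \<open>Contracting two neighbouring points is adjoint to inserting a pair, and both operations
  preserve the spans of noncrossing pairings (\<open>ncp_cap\<close>, \<open>ncp_cup\<close>); so
  they are compatible with the projections. This is the orthogonality relation of \<open>u\<close>,
  expressed for \<open>kern\<close>.\<close>

lemma kern_cup:
  fixes x1 :: "'a::finite list"
  assumes x: "length x1 = length y1" "length x2 = length y2"
  shows "(\<Sum>p\<in>UNIV. kern (y1 @ [p, p] @ y2) (x1 @ [i, j] @ x2)) = of_bool (i = j) * kern (y1 @ y2) (x1 @ x2)"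
proof -
  define r s where "r = length y1" "s = length y2"
  \<comment> \<open>\<open>g\<close> is the right-hand side as a function of the second argument, in
    a form that visibly lies in the span: a pair is inserted at place \<open>r\<close> of each
    pairing.\<close>
  define g :: "'a list \<Rightarrow> real" where "g w = (\<Sum>e\<in>dycks (r + s). kern_coeff (r + s) e (y1 @ y2) *
      ncp (take r e @ [True, False] @ drop r e) w)" for w
  have g: "g (v1 @ [p, q] @ v2) = of_bool (p = q) * kern (y1 @ y2) (v1 @ v2)"
    if "length v1 = r" for v1 p q v2
  proof -
    have "ncp (take r e @ [True, False] @ drop r e) (v1 @ [p, q] @ v2) =
        of_bool (p = q) * ncp e (v1 @ v2)" if "e \<in> dycks (r + s)" for e
      using ncp_cup[of "take r e" v1 "drop r e" p q v2] that \<open>length v1 = r\<close>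
      by (simp add: dycks_def)
    then show ?thesis by (simp add: g_def kern_def r_s_def sum_distrib_left mult_ac)
  qed
  have y: "y1 @ y2 \<in> words (r + s)" "\<And>p. y1 @ [p, p] @ y2 \<in> words (r + 2 + s)"
    by (auto simp: words_def r_s_def)
  have split: "(\<Sum>w\<in>words (r + 2 + s). F w) =
      (\<Sum>v1\<in>words r. \<Sum>v2\<in>words s. \<Sum>p\<in>UNIV. \<Sum>q\<in>UNIV. F (v1 @ [p, q] @ v2))" for F :: "'a list \<Rightarrow> real"
  proof -
    have "(\<Sum>w\<in>words (r + 2 + s). F w) =
        (\<Sum>v1\<in>words r. \<Sum>p\<in>UNIV. \<Sum>q\<in>UNIV. \<Sum>v2\<in>words s. F (v1 @ [p, q] @ v2))"
    proof -
      have "r + 2 + s = r + Suc (Suc s)" by simp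
      then show ?thesis by (simp only: sum_words_append sum_words_Suc append_Cons append_Nil)
    qed
    also have "\<dots> = (\<Sum>v1\<in>words r. \<Sum>p\<in>UNIV. \<Sum>v2\<in>words s. \<Sum>q\<in>UNIV. F (v1 @ [p, q] @ v2))"
      by (intro sum.cong refl sum.swap)
    also have "\<dots> = (\<Sum>v1\<in>words r. \<Sum>v2\<in>words s. \<Sum>p\<in>UNIV. \<Sum>q\<in>UNIV. F (v1 @ [p, q] @ v2))"
      by (intro sum.cong refl sum.swap)
    finally show ?thesis .
  qed
  define f where "f w = (\<Sum>p\<in>UNIV. 1 * kern (y1 @ [p, p] @ y2) w) - g w" for w
  have "ncp_span (r + 2 + s) f"
    unfolding f_def g_def
  proof (intro ncp_span_diff ncp_span_sum ncp_span_kern y ncp_span_ncp)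
    fix e assume "e \<in> dycks (r + s)"
    then show "take r e @ [True, False] @ drop r e \<in> dycks (r + 2 + s)"
      by (auto simp: dycks_def intro!: dyck_cup[simplified])
  qed simp_all
  moreover have "(\<Sum>w\<in>words (r + 2 + s). f w * ncp d w) = 0" if d: "d \<in> dycks (r + 2 + s)" for d
  proof -
    from d obtain c d' where d': "d' \<in> dycks (r + s)"
       "\<And>v1 v2. length v1 = r \<Longrightarrow> length v2 = s \<Longrightarrow>
       (\<Sum>p\<in>UNIV. ncp d (v1 @ [p, p] @ v2)) = c * ncp d' (v1 @ v2 :: 'a list)"
      using ncp_cap[of d r s, where 'a = 'a] by (auto simp: dycks_def)
    have "(\<Sum>w\<in>words (r + 2 + s). (\<Sum>p\<in>UNIV. kern (y1 @ [p, p] @ y2) w) * ncp d w) =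
        (\<Sum>p\<in>UNIV. \<Sum>w\<in>words (r + 2 + s). kern (y1 @ [p, p] @ y2) w * ncp d w)"
      by (simp add: sum_distrib_right sum.swap[of _ UNIV])
    also have "\<dots> = c * ncp d' (y1 @ y2)"
      using kern_ncp[OF y(2) d] d'(2)[of y1 y2] by (simp add: r_s_def)
    finally have 1: "(\<Sum>w\<in>words (r + 2 + s). (\<Sum>p\<in>UNIV. kern (y1 @ [p, p] @ y2) w) * ncp d w) = c * ncp d' (y1 @ y2)" .
    have "(\<Sum>w\<in>words (r + 2 + s). g w * ncp d w) = (\<Sum>v1\<in>words r. \<Sum>v2\<in>words s. \<Sum>p\<in>UNIV. \<Sum>q\<in>UNIV.
         of_bool (p = q) * kern (y1 @ y2) (v1 @ v2) * ncp d (v1 @ [p, q] @ v2))"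
      unfolding split by (intro sum.cong refl) (simp only: g length_words)
    also have "\<dots> = (\<Sum>v1\<in>words r. \<Sum>v2\<in>words s. kern (y1 @ y2) (v1 @ v2) * (\<Sum>p\<in>UNIV. ncp d (v1 @ [p, p] @ v2)))"
    proof (intro sum.cong refl)
      fix v1 v2 :: "'a list"
      have "of_bool (p = q) * kern (y1 @ y2) (v1 @ v2) * ncp d (v1 @ [p, q] @ v2) =
         (if p = q then kern (y1 @ y2) (v1 @ v2) * ncp d (v1 @ [p, p] @ v2) else 0)" for p q by auto
      then show "(\<Sum>p\<in>UNIV. \<Sum>q\<in>UNIV. of_bool (p = q) * kern (y1 @ y2) (v1 @ v2) * ncp d (v1 @ [p, q] @ v2)) =
         kern (y1 @ y2) (v1 @ v2) * (\<Sum>p\<in>UNIV. ncp d (v1 @ [p, p] @ v2))"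
        by (simp only: sum_distrib_left) simp
    qed
    also have "\<dots> = (\<Sum>v1\<in>words r. \<Sum>v2\<in>words s. kern (y1 @ y2) (v1 @ v2) * (c * ncp d' (v1 @ v2)))"
      by (intro sum.cong refl) (simp only: d'(2) length_words)
    also have "\<dots> = c * (\<Sum>w\<in>words (r + s). kern (y1 @ y2) w * ncp d' w)"
      by (simp add: sum_words_append sum_distrib_left mult_ac)
    also have "\<dots> = c * ncp d' (y1 @ y2)" using kern_ncp[OF y(1) d'(1)] by simp
    finally show ?thesis using 1 by (simp add: f_def left_diff_distrib sum_subtractf)
  qed
  ultimately have "f (x1 @ [i, j] @ x2) = 0"
    by (rule ncp_span_orthogonal) (use x in \<open>auto simp: words_def r_s_def\<close>)
  then show ?thesis using g[of x1 i j x2] x by (simp add: f_def r_s_def)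
qed

section \<open>Traces of rotations\<close>

text \<open>The trace of the projection composed with a rotation is the trace of the rotation on the
  span. There it permutes a basis, so the trace is the number of fixed basis elements.\<close>

lemma trace_rotate:
  assumes card: "CARD('a::finite) \<ge> 2"
  shows "(\<Sum>w\<in>(words m :: 'a list set). kern w (rotate k w)) =
    real (card {d \<in> dycks m. \<forall>w\<in>(words m :: 'a list set). ncp d (rotate k w) = ncp d w})"
proof -
  define D :: "bool list \<Rightarrow> 'a list \<Rightarrow> real" where "D = kern_coeff m"
  have kern: "kern w v = (\<Sum>e\<in>dycks m. D e w * ncp e v)" if "w \<in> words m" for w v
    using that by (simp add: kern_def words_def D_def)
  \<comment> \<open>By linear independence the coefficients of \<open>kern\<close> are dual to the
    pairings.\<close>
  have biorth: "(\<Sum>w\<in>words m. D e w * ncp d w) = (if e = d then 1 else 0)"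
    if d: "d \<in> dycks m" and e: "e \<in> dycks m" for d e
  proof -
    define c where "c e = (\<Sum>w\<in>words m. D e w * ncp d w) - (if e = d then 1 else 0)" for e
    have "(\<Sum>e\<in>dycks m. c e * ncp e v) = 0" if v: "v \<in> words m" for v :: "'a list"
    proof -
      have "(\<Sum>e\<in>dycks m. (\<Sum>w\<in>words m. D e w * ncp d w) * ncp e v) =
          (\<Sum>w\<in>words m. kern w v * ncp d w)"
        by (simp add: kern sum_distrib_left sum_distrib_right sum.swap[of _ "dycks m"] mult_ac)
      also have "\<dots> = (\<Sum>w\<in>words m. kern v w * ncp d w)"
        using v by (intro sum.cong refl) (simp add: kern_sym words_def)
      also have "\<dots> = ncp d v" by (rule kern_ncp[OF v d])
      finally show ?thesis
        using d by (simp add: c_def left_diff_distrib sum_subtractf if_distrib[of "\<lambda>x. x * _"] cong: if_cong)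
    qed
    from ncp_independent[OF card this e] show ?thesis by (simp add: c_def)
  qed
  define fix' where "fix' d \<longleftrightarrow> (\<forall>w\<in>(words m :: 'a list set). ncp d (rotate k w) = ncp d w)" for d
  have "(\<Sum>w\<in>(words m :: 'a list set). kern w (rotate k w)) = (\<Sum>e\<in>dycks m. \<Sum>w\<in>words m. D e w * ncp e (rotate k w))"
    by (simp add: kern sum.swap[of _ "dycks m"])
  also have "\<dots> = (\<Sum>e\<in>dycks m. if fix' e then 1 else 0)"
  proof (intro sum.cong refl)
    fix e assume e: "e \<in> dycks m"
    then obtain d where d: "d \<in> dycks m" "\<And>w::'a list. w \<in> words m \<Longrightarrow> ncp e (rotate k w) = ncp d w"
      using ncp_rotate[of e k, where 'a = 'a] by (auto simp: dycks_def words_def)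
    have "fix' e \<longleftrightarrow> e = d"
      using d ncp_inject[OF card e d(1)] by (auto simp: fix'_def)
    then show "(\<Sum>w\<in>words m. D e w * ncp e (rotate k w)) = (if fix' e then 1 else 0)"
      using biorth[OF d(1) e] d(2) by simp
  qed
  also have "\<dots> = real (card {d \<in> dycks m. fix' d})"
    by (simp add: sum.If_cases Int_def)
  finally show ?thesis by (simp add: fix'_def)
qed

lemma trace_kern:
  assumes "CARD('a::finite) \<ge> 2"
  shows "(\<Sum>w\<in>(words m :: 'a list set). kern w w) \<le> 2 ^ m"
proof -
  have "(\<Sum>w\<in>(words m :: 'a list set). kern w w) \<le> real (card (dycks m))"
    using trace_rotate[OF assms, where m = m and k = 0] by (simp add: card_mono)
  also have "\<dots> \<le> 2 ^ m"
    using card_dycks[of m] by (metis of_nat_le_iff of_nat_numeral of_nat_power)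
  finally show ?thesis .
qed

lemma kern_odd: "odd (length x) \<Longrightarrow> kern x y = 0"
  by (simp add: kern_def dycks_odd)

section \<open>Pairings invariant under rotation by two steps\<close>

lemma sum_ncp:
  assumes "dyck d"
  shows "(\<Sum>w\<in>(words (length d) :: 'a::finite list set). ncp d w) = real CARD('a) ^ (length d div 2)"
  using assms
proof (induction rule: dyck.induct)
  case dyck_Nil
  show ?case by (simp add: words_0 ncp_def)
next
  case (dyck_cup d1 d2)
  have len: "length (d1 @ [True, False] @ d2) = length d1 + Suc (Suc (length d2))" by simp
  have "(\<Sum>w\<in>(words (length (d1 @ [True, False] @ d2)) :: 'a list set). ncp (d1 @ [True, False] @ d2) w) =
     (\<Sum>v1\<in>(words (length d1) :: 'a list set). \<Sum>p\<in>UNIV. \<Sum>q\<in>UNIV. \<Sum>v2\<in>words (length d2).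
        ncp (d1 @ [True, False] @ d2) (v1 @ [p, q] @ v2))"
    unfolding len by (simp only: sum_words_append sum_words_Suc append_Cons append_Nil)
  also have "\<dots> = (\<Sum>v1\<in>(words (length d1) :: 'a list set). \<Sum>p\<in>UNIV. \<Sum>q\<in>UNIV. \<Sum>v2\<in>words (length d2).
        of_bool (p = (q :: 'a)) * ncp (d1 @ d2) (v1 @ v2))"
    by (intro sum.cong refl ncp_cup) (simp add: words_def)
  also have "\<dots> = (\<Sum>v1\<in>(words (length d1) :: 'a list set). \<Sum>p\<in>UNIV. \<Sum>q\<in>UNIV.
        if (p :: 'a) = q then \<Sum>v2\<in>words (length d2). ncp (d1 @ d2) (v1 @ v2) else 0)"
  proof -
    have "(\<Sum>v2\<in>words (length d2). of_bool (p = q) * ncp (d1 @ d2) (v1 @ v2)) =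
        (if p = q then \<Sum>v2\<in>words (length d2). ncp (d1 @ d2) (v1 @ v2) else 0)" for v1 :: "'a list" and p q :: 'a
      by (cases "p = q") simp_all
    then show ?thesis by (simp only:)
  qed
  also have "\<dots> = real CARD('a) * (\<Sum>w\<in>(words (length (d1 @ d2)) :: 'a list set). ncp (d1 @ d2) w)"
    by (simp add: sum_words_append sum_distrib_left)
  finally show ?case using dyck_cup.IH by simp
qed

fun adjacent_pairs :: "nat \<Rightarrow> bool list" where
  "adjacent_pairs 0 = []"
| "adjacent_pairs (Suc l) = True # False # adjacent_pairs l"

lemma dyck_adjacent_pairs: "dyck (adjacent_pairs l)"
proof (induction l)
  case (Suc l)
  then show ?case using dyck_cup[of "[]" "adjacent_pairs l"] by simp
qed (simp add: dyck_Nil)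

lemma length_adjacent_pairs: "length (adjacent_pairs l) = 2 * l"
  by (induction l) auto

lemma ncp_adjacent_pairs:
  "length w = 2 * l \<Longrightarrow> (\<And>i. i < l \<Longrightarrow> w ! (2 * i) = w ! (2 * i + 1)) \<Longrightarrow> ncp (adjacent_pairs l) w = 1"
proof (induction l arbitrary: w)
  case 0
  then show ?case by (simp add: ncp_def)
next
  case (Suc l)
  then obtain a b v where w: "w = a # b # v" "length v = 2 * l"
    by (auto simp: length_Suc_conv)
  have "a = b" using Suc.prems(2)[of 0] by (simp add: w)
  moreover have "ncp (adjacent_pairs l) v = 1"
    using Suc.prems(2)[of "Suc i" for i] by (intro Suc.IH) (auto simp: w)
  ultimately show ?case
    using ncp_cup[of "[]" "[]" "adjacent_pairs l" a b v] by (simp add: w)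
qed

lemma ncp_nonneg: "0 \<le> ncp d w" "ncp d w \<le> 1"
  by (simp_all add: ncp_def)

text \<open>The support of \<open>ncp d\<close> is contained in that of
  \<open>ncp (adjacent_pairs l)\<close>, and by \<open>sum_ncp\<close> both consist of
  \<open>CARD('a) ^ l\<close> words.\<close>

lemma ncp_eq_adjacent_pairs:
  assumes "d \<in> dycks (2 * l)"
    and "\<And>w::'a::finite list. w \<in> words (2 * l) \<Longrightarrow> ncp d w \<noteq> 0 \<Longrightarrow> (\<forall>i<l. w ! (2 * i) = w ! (2 * i + 1))"
    and w: "w \<in> words (2 * l)"
  shows "ncp d w = ncp (adjacent_pairs l) (w :: 'a list)"
proof -
  have le: "ncp d v \<le> ncp (adjacent_pairs l) v" if "v \<in> words (2 * l)" for v :: "'a list"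
    using assms(2)[OF that] ncp_adjacent_pairs[of v l] that ncp_nonneg[of d v]
      ncp_nonneg[of "adjacent_pairs l" v] by (cases "ncp d v = 0") (auto simp: words_def)
  have "(\<Sum>v\<in>(words (2 * l) :: 'a list set). ncp (adjacent_pairs l) v - ncp d v) = 0"
    using sum_ncp[of d, where 'a = 'a] sum_ncp[OF dyck_adjacent_pairs[of l], where 'a = 'a] assms(1)
    by (simp add: sum_subtractf length_adjacent_pairs dycks_def)
  then have "ncp (adjacent_pairs l) w - ncp d w = 0"
    using le w by (subst (asm) sum_nonneg_eq_0_iff) auto
  then show ?thesis by simp
qed

text \<open>A noncrossing pairing contains a pair of neighbours, so if it is invariant under rotation by
  two steps it is one of the two pairings consisting of neighbours only.\<close>

lemma ncp_rotate2_fixed: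
  assumes d: "d \<in> dycks (2 * l)" and l: "l > 0"
    and fixed: "\<And>w::'a::finite list. w \<in> words (2 * l) \<Longrightarrow> ncp d (rotate 2 w) = ncp d w"
  shows "(\<forall>w\<in>(words (2 * l) :: 'a list set). ncp d w = ncp (adjacent_pairs l) w) \<or>
    (\<forall>w\<in>(words (2 * l) :: 'a list set). ncp d w = ncp (adjacent_pairs l) (rotate1 w))"
proof -
  from d l have "dyck d" "d \<noteq> []" by (auto simp: dycks_def)
  then obtain d1 d2 where d12: "d = d1 @ [True, False] @ d2"
    by (cases rule: dyck.cases) auto
  define s where "s = length d1"
  have s: "s + 1 < 2 * l" using d d12 by (simp add: s_def dycks_def)
  have cup: "w ! s = w ! (s + 1)" if "w \<in> words (2 * l)" "ncp d w \<noteq> 0" for w :: "'a list"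
  proof -
    have "length w = length d1 + 2 + length d2" using that d d12 by (simp add: words_def dycks_def)
    then obtain w1 a b w2 where w: "w = w1 @ [a, b] @ w2" "length w1 = length d1"
      by (rule split_at_pair)
    then show ?thesis
      using that(2) ncp_cup[of d1 w1 d2 a b w2] by (auto simp: d12 s_def nth_append split: if_splits)
  qed
  have fixed': "ncp d (rotate (2 * j) w) = ncp d w" if "w \<in> words (2 * l)" for w :: "'a list" and j
  proof (induction j)
    case (Suc j)
    have "ncp d (rotate (2 * Suc j) w) = ncp d (rotate 2 (rotate (2 * j) w))"
      by (simp add: rotate_rotate)
    also have "\<dots> = ncp d (rotate (2 * j) w)"
      using that by (intro fixed) (simp add: words_def)
    finally show ?case using Suc by simp
  qed simp
  \<comment> \<open>By invariance every translate of this pair by an even number of places is again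
    a pair; the parity of \<open>s\<close> decides which of the two pairings occurs.\<close>
  have cups: "w ! ((2 * j + s) mod (2 * l)) = w ! ((2 * j + s + 1) mod (2 * l))"
    if "w \<in> words (2 * l)" "ncp d w \<noteq> 0" for w :: "'a list" and j
    using cup[of "rotate (2 * j) w"] fixed'[of w j] that s by (simp add: words_def nth_rotate)
  show ?thesis
  proof (cases "even s")
    case True
    then obtain t where t: "s = 2 * t" by blast
    have "\<forall>i<l. w ! (2 * i) = w ! (2 * i + 1)" if "w \<in> words (2 * l)" "ncp d w \<noteq> 0" for w :: "'a list"
    proof (intro allI impI)
      fix i assume "i < l"
      \<comment> \<open>The summand \<open>l\<close> keeps the difference of natural numbers from
        being truncated; it amounts to one full turn.\<close>
      have eq: "2 * (i + l - t) + s = 2 * i + 2 * l" using s t by simp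
      have "2 * (i + l - t) + s + 1 = 2 * i + 1 + 2 * l" unfolding eq by simp
      then have "(2 * (i + l - t) + s + 1) mod (2 * l) = 2 * i + 1" "(2 * (i + l - t) + s) mod (2 * l) = 2 * i"
        using \<open>i < l\<close> unfolding eq by (simp_all only: mod_add_self2) simp_all
      then show "w ! (2 * i) = w ! (2 * i + 1)" using cups[OF that, of "i + l - t"] by simp
    qed
    then show ?thesis using ncp_eq_adjacent_pairs[OF d] by blast
  next
    case False
    then obtain t where t: "s = 2 * t + 1" by (elim oddE)
    \<comment> \<open>Rotation by \<open>2 * l - 1\<close> is one step backwards and reduces the odd
      case to pairs starting at even places.\<close>
    obtain d' where d': "d' \<in> dycks (2 * l)"
      "\<And>w::'a list. w \<in> words (2 * l) \<Longrightarrow> ncp d (rotate (2 * l - 1) w) = ncp d' w"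
      using ncp_rotate[of d "2 * l - 1", where 'a = 'a] d by (auto simp: dycks_def words_def)
    have "\<forall>i<l. v ! (2 * i) = v ! (2 * i + 1)" if v: "v \<in> words (2 * l)" "ncp d' v \<noteq> 0" for v :: "'a list"
    proof (intro allI impI)
      fix i assume i: "i < l"
      define w where "w = rotate (2 * l - 1) v"
      have w: "w \<in> words (2 * l)" "ncp d w \<noteq> 0" using v d'(2)[OF v(1)] by (simp_all add: w_def words_def)
      have nth: "w ! p = v ! ((2 * l - 1 + p) mod (2 * l))" if "p < 2 * l" for p
        using v that by (simp add: w_def nth_rotate words_def)
      have eq: "2 * (i + l - t) + s = 2 * i + 1 + 2 * l" using s t by simp
      have "2 * (i + l - t) + s + 1 = 2 * i + 2 + 2 * l" unfolding eq by simp
      then have "(2 * (i + l - t) + s + 1) mod (2 * l) = (2 * i + 2) mod (2 * l)"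
        "(2 * (i + l - t) + s) mod (2 * l) = 2 * i + 1"
        using i unfolding eq by (simp_all only: mod_add_self2) simp_all
      then have *: "w ! (2 * i + 1) = w ! ((2 * i + 2) mod (2 * l))"
        using cups[OF w, of "i + l - t"] by simp
      have 1: "w ! (2 * i + 1) = v ! (2 * i)"
      proof -
        have "2 * l - 1 + (2 * i + 1) = 2 * i + 2 * l" using i by simp
        then show ?thesis using nth[of "2 * i + 1"] i by simp
      qed
      have 2: "w ! ((2 * i + 2) mod (2 * l)) = v ! (2 * i + 1)"
      proof -
        have "(2 * l - 1 + (2 * i + 2) mod (2 * l)) mod (2 * l) = (2 * l - 1 + (2 * i + 2)) mod (2 * l)"
          by (rule mod_add_right_eq)
        also have "2 * l - 1 + (2 * i + 2) = (2 * i + 1) + 2 * l" using i by simp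
        also have "((2 * i + 1) + 2 * l) mod (2 * l) = 2 * i + 1"
          using i by (simp only: mod_add_self2) simp
        finally show ?thesis using nth[of "(2 * i + 2) mod (2 * l)"] i l by simp
      qed
      show "v ! (2 * i) = v ! (2 * i + 1)" using * 1 2 by simp
    qed
    then have eq: "ncp d' v = ncp (adjacent_pairs l) v" if "v \<in> words (2 * l)" for v :: "'a list"
      using ncp_eq_adjacent_pairs[OF d'(1)] that by blast
    have "ncp d w = ncp (adjacent_pairs l) (rotate1 w)" if "w \<in> words (2 * l)" for w :: "'a list"
    proof -
      have "rotate (2 * l - 1) (rotate1 w) = rotate (2 * l) w"
        using l by (cases l) (simp_all add: rotate1_rotate_swap)
      also have "\<dots> = w" using that by (simp add: words_def rotate_id)
      finally show ?thesis using d'(2)[of "rotate1 w"] eq[of "rotate1 w"] that by (simp add: words_def)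
    qed
    then show ?thesis by blast
  qed
qed

lemma trace_rotate2:
  assumes card: "CARD('a::finite) \<ge> 2" and "m > 0"
  shows "(\<Sum>w\<in>(words m :: 'a list set). kern w (rotate 2 w)) \<le> (if even m then 2 else 0)"
proof (cases "even m")
  case False
  then show ?thesis by (simp add: kern_odd length_words)
next
  case True
  then obtain l where l: "m = 2 * l" "l > 0" using assms(2) by (auto elim: evenE)
  define F where "F f = {d \<in> dycks m. \<forall>w\<in>(words m :: 'a list set). ncp d w = f w}" for f
  have F: "card (F f) \<le> 1" "finite (F f)" for f
  proof -
    show "finite (F f)" by (simp add: F_def)
    then show "card (F f) \<le> 1"
      using ncp_inject[OF card] by (auto simp: card_le_Suc0_iff_eq F_def)
  qed
  have "{d \<in> dycks m. \<forall>w\<in>(words m :: 'a list set). ncp d (rotate 2 w) = ncp d w} \<subseteq>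
     F (ncp (adjacent_pairs l)) \<union> F (\<lambda>w. ncp (adjacent_pairs l) (rotate1 w))"
  proof
    fix d assume "d \<in> {d \<in> dycks m. \<forall>w\<in>(words m :: 'a list set). ncp d (rotate 2 w) = ncp d w}"
    then show "d \<in> F (ncp (adjacent_pairs l)) \<union> F (\<lambda>w. ncp (adjacent_pairs l) (rotate1 w))"
      using ncp_rotate2_fixed[of d l, where 'a = 'a] l by (auto simp: F_def)
  qed
  then have "card {d \<in> dycks m. \<forall>w\<in>(words m :: 'a list set). ncp d (rotate 2 w) = ncp d w} \<le>
      card (F (ncp (adjacent_pairs l)) \<union> F (\<lambda>w. ncp (adjacent_pairs l) (rotate1 w)))"
    by (intro card_mono finite_UnI F)
  also have "\<dots> \<le> 2"
    using card_Un_le[of "F (ncp (adjacent_pairs l))" "F (\<lambda>w. ncp (adjacent_pairs l) (rotate1 w))"]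
      F(1)[of "ncp (adjacent_pairs l)"] F(1)[of "\<lambda>w. ncp (adjacent_pairs l) (rotate1 w)"] by linarith
  finally show ?thesis using trace_rotate[OF card, where m = m and k = 2] True by simp
qed

section \<open>The Haar state\<close>

lemma complex_linear_add: "complex_linear f \<Longrightarrow> f (x + y) = f x + f y"
  and complex_linear_scaleC: "complex_linear f \<Longrightarrow> f (c *\<^sub>C x) = c *\<^sub>C f x"
  by (simp_all add: complex_linear_def)

lemma complex_linear_0: "complex_linear f \<Longrightarrow> f 0 = 0"
  using complex_linear_scaleC[of f 0 0] by simp

lemma complex_linear_minus: "complex_linear f \<Longrightarrow> f (- x) = - f x"
  using complex_linear_add[of f x "- x"] by (simp add: complex_linear_0 eq_neg_iff_add_eq_0 add.commute)

lemma complex_linear_diff: "complex_linear f \<Longrightarrow> f (x - y) = f x - f y"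
  using complex_linear_add[of f x "- y"] by (simp add: complex_linear_minus)

lemma complex_linear_sum: "complex_linear f \<Longrightarrow> f (sum g A) = (\<Sum>i\<in>A. f (g i))"
  by (induction A rule: infinite_finite_induct) (simp_all add: complex_linear_0 complex_linear_add)

lemma scaleC_sum_left: "sum f A *\<^sub>C x = (\<Sum>i\<in>A. f i *\<^sub>C (x :: 'a::complex_vector))"
  by (induction A rule: infinite_finite_induct) (simp_all add: scaleC_add_left)

section \<open>Words in the generators and the functional given by \<open>kern\<close>\<close>

definition uword :: "'n list \<Rightarrow> 'n list \<Rightarrow> 'n::finite ao" where
  "uword i j = prod_list (map2 u i j)"

lemma uword_Nil [simp]: "uword [] [] = 1"
  by (simp add: uword_def)

lemma uword_Cons [simp]: "uword (i # is) (j # js) = u i j * uword is js"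
  by (simp add: uword_def)

lemma uword_append:
  "length i = length j \<Longrightarrow> uword (i @ i') (j @ j') = uword i j * uword i' j'"
  by (simp add: uword_def)

lemma abs_ao_single:
  fixes l :: "('n::finite \<times> 'n) list"
  shows "abs_ao (Poly_Mapping.single (Free_Word l) c) = c *\<^sub>C uword (map fst l) (map snd l)"
proof (induction l)
  case Nil
  have "c *\<^sub>C (1 :: 'n ao) = abs_ao (Poly_Mapping.single 0 c * 1)"
    unfolding one_ao.abs_eq scaleC_ao.abs_eq ..
  then show ?case by (simp add: zero_free_word_def)
next
  case (Cons p l)
  have "Poly_Mapping.single (Free_Word (p # l)) c =
      free_gen (fst p) (snd p) * Poly_Mapping.single (Free_Word l) c"
    by (simp add: free_gen_def mult_single)
  then have "abs_ao (Poly_Mapping.single (Free_Word (p # l)) c) =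
      u (fst p) (snd p) * abs_ao (Poly_Mapping.single (Free_Word l) c)"
    by (simp add: times_ao.abs_eq u.abs_eq)
  then show ?case by (simp add: Cons mult_scaleC_right)
qed

lemma ao_induct [case_names uword add]:
  assumes "\<And>c i j. length i = length j \<Longrightarrow> P (c *\<^sub>C uword i j)"
    and "\<And>x y. P x \<Longrightarrow> P y \<Longrightarrow> P (x + y)"
  shows "P (x :: 'n::finite ao)"
proof (induct x rule: ao.abs_induct)
  case (1 p)
  show ?case
  proof (induction p rule: pm_induct)
    case (single w c)
    then show ?case by (cases w) (simp add: abs_ao_single assms(1))
  next
    case (add p q)
    then show ?case using assms(2) by (simp flip: plus_ao.abs_eq)
  qed
qed

lemma u_orthogonal:
  "(\<Sum>k\<in>UNIV. u i k * u j k) = (if i = j then 1 else 0 :: 'n::finite ao)"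
  "(\<Sum>k\<in>UNIV. u k i * u k j) = (if i = j then 1 else 0 :: 'n::finite ao)"
  using ao_relations_u[where 'n = 'n] by (simp_all add: ao_relations_def)

definition kern_functional :: "'n::finite ao \<Rightarrow> complex" where
  "kern_functional x = linear_extension
     (\<lambda>w. case w of Free_Word l \<Rightarrow> complex_of_real (kern (map fst l) (map snd l))) (rep_ao x)"

text \<open>The defining relations are respected because of \<open>kern_cup\<close>; transposition
  by \<open>kern_sym\<close> exchanges their two families. This gives a functional on the algebra
  with the values \<open>kern\<close> before anything is known about \<open>h\<close>.\<close>

lemma kern_functional_abs:
  "kern_functional (abs_ao p :: 'n::finite ao) = linear_extension
     (\<lambda>w. case w of Free_Word l \<Rightarrow> complex_of_real (kern (map fst l) (map snd l))) p"
proof -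
  define f :: "('n \<times> 'n) free_word \<Rightarrow> complex"
    where "f w = (case w of Free_Word l \<Rightarrow> complex_of_real (kern (map fst l) (map snd l)))" for w
  have 1: "linear_extension f (p * r * q) = 0" if r: "r \<in> ao_relators" for p r q
  proof (induction p rule: pm_induct)
    case (single v c)
    show ?case
    proof (induction q rule: pm_induct)
      case (single w d)
      obtain v' w' where vw: "v = Free_Word v'" "w = Free_Word w'" by (cases v; cases w)
      define e where "e = c * d"
      have ge: "Poly_Mapping.single v c * (free_gen i k * free_gen j l) * Poly_Mapping.single w d =
          Poly_Mapping.single (Free_Word (v' @ [(i, k), (j, l)] @ w')) e" for i j k l
        by (simp add: free_gen_def mult_single vw e_def)
      have bo: "Poly_Mapping.single v c * of_bool b * Poly_Mapping.single w d =
          of_bool b * Poly_Mapping.single (Free_Word (v' @ w')) e" for b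
        by (simp add: mult_single vw e_def)
      have fe: "linear_extension f (Poly_Mapping.single (Free_Word (v' @ [(i, k), (j, l)] @ w')) e) =
          e * complex_of_real (kern (map fst v' @ [i, j] @ map fst w') (map snd v' @ [k, l] @ map snd w'))" for i j k l
        by (simp add: linear_extension_single f_def scaleC_complex_def)
      have fb: "linear_extension f (of_bool b * Poly_Mapping.single (Free_Word (v' @ w')) e) =
          of_bool b * e * complex_of_real (kern (map fst v' @ map fst w') (map snd v' @ map snd w'))" for b
        by (cases b) (simp_all add: linear_extension_single f_def scaleC_complex_def linear_extension_zero)
      have kc: "(\<Sum>k\<in>UNIV. e * complex_of_real (kern (map snd v' @ [i, j] @ map snd w') (map fst v' @ [k, k] @ map fst w')))
          = of_bool (i = j) * e * complex_of_real (kern (map snd v' @ map snd w') (map fst v' @ map fst w'))"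
        "(\<Sum>k\<in>UNIV. e * complex_of_real (kern (map fst v' @ [i, j] @ map fst w') (map snd v' @ [k, k] @ map snd w')))
          = of_bool (i = j) * e * complex_of_real (kern (map fst v' @ map fst w') (map snd v' @ map snd w'))"
        for i j
      proof -
        have *: "(\<Sum>k\<in>UNIV. e * complex_of_real (kern (x1 @ [i, j] @ x2) (y1 @ [k, k] @ y2)))
          = of_bool (i = j) * e * complex_of_real (kern (x1 @ x2) (y1 @ y2))"
          if len: "length x1 = length y1" "length x2 = length y2" for x1 x2 y1 y2 :: "'n list"
        proof -
          have "(\<Sum>k\<in>UNIV. kern (x1 @ [i, j] @ x2) (y1 @ [k, k] @ y2)) =
             (\<Sum>k\<in>UNIV. kern (y1 @ [k, k] @ y2) (x1 @ [i, j] @ x2))"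
            using len by (intro sum.cong refl kern_sym) simp
          also have "\<dots> = of_bool (i = j) * kern (x1 @ x2) (y1 @ y2)"
            using len kern_sym[of "y1 @ y2" "x1 @ x2"] by (simp only: kern_cup length_append)
          finally show ?thesis
            by (simp flip: sum_distrib_left of_real_sum del: append_Cons append_Nil)
        qed
        show "(\<Sum>k\<in>UNIV. e * complex_of_real (kern (map snd v' @ [i, j] @ map snd w') (map fst v' @ [k, k] @ map fst w')))
          = of_bool (i = j) * e * complex_of_real (kern (map snd v' @ map snd w') (map fst v' @ map fst w'))"
          "(\<Sum>k\<in>UNIV. e * complex_of_real (kern (map fst v' @ [i, j] @ map fst w') (map snd v' @ [k, k] @ map snd w')))
          = of_bool (i = j) * e * complex_of_real (kern (map fst v' @ map fst w') (map snd v' @ map snd w'))"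
          by (rule *; simp)+
      qed
      have sym: "kern (map fst v' @ [k, k] @ map fst w') (map snd v' @ [i, j] @ map snd w') =
          kern (map snd v' @ [i, j] @ map snd w') (map fst v' @ [k, k] @ map fst w')"
        "kern (map fst v' @ map fst w') (map snd v' @ map snd w') =
          kern (map snd v' @ map snd w') (map fst v' @ map fst w')" for i j k
        by (rule kern_sym; simp)+
      have "linear_extension f (Poly_Mapping.single v c *
          ((\<Sum>k\<in>UNIV. free_gen i k * free_gen j k) - of_bool (i = j)) * Poly_Mapping.single w d) = 0" for i j
        unfolding right_diff_distrib left_diff_distrib sum_distrib_left sum_distrib_right
          linear_extension_diff linear_extension_sum ge bo fe fb kc by simp
      moreover have "linear_extension f (Poly_Mapping.single v c *
          ((\<Sum>k\<in>UNIV. free_gen k i * free_gen k j) - of_bool (i = j)) * Poly_Mapping.single w d) = 0" for i j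
        unfolding right_diff_distrib left_diff_distrib sum_distrib_left sum_distrib_right
          linear_extension_diff linear_extension_sum ge bo fe fb sym kc by simp
      moreover have "(\<exists>i j. r = (\<Sum>k\<in>UNIV. free_gen i k * free_gen j k) - of_bool (i = j)) \<or>
          (\<exists>i j. r = (\<Sum>k\<in>UNIV. free_gen k i * free_gen k j) - of_bool (i = j))"
        using r unfolding ao_relators_def free_star_gen by blast
      ultimately show ?case by (elim disjE exE) (simp_all only:)
    qed (simp add: distrib_left linear_extension_add)
  qed (simp add: distrib_right linear_extension_add)
  have "linear_extension f x = 0" if "x \<in> ideal_gen ao_relators" for x
    using that by induction (simp_all add: linear_extension_zero linear_extension_add 1)
  moreover have "ideal_cong ao_relators (rep_ao (abs_ao p)) p"
    by (simp only: ao.abs_eq_iff[symmetric] Quotient3_abs_rep[OF Quotient3_ao])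
  ultimately have "linear_extension f (rep_ao (abs_ao p) - p) = 0"
    unfolding ideal_cong_def by blast
  then have "linear_extension f (rep_ao (abs_ao p)) = linear_extension f p"
    by (simp add: linear_extension_diff)
  then show ?thesis
    by (simp only: kern_functional_def f_def[abs_def])
qed

lemma complex_linear_kern_functional: "complex_linear (kern_functional :: 'n::finite ao \<Rightarrow> complex)"
proof -
  have "kern_functional (x + y) = kern_functional x + kern_functional y" for x y :: "'n ao"
    by (induct x rule: ao.abs_induct, induct y rule: ao.abs_induct)
       (simp add: plus_ao.abs_eq kern_functional_abs linear_extension_add)
  moreover have "kern_functional (c *\<^sub>C x) = c *\<^sub>C kern_functional x" for c and x :: "'n ao"
    by (induct x rule: ao.abs_induct)
       (simp add: scaleC_ao.abs_eq kern_functional_abs linear_extension_scalar)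
  ultimately show ?thesis by (simp add: complex_linear_def)
qed

lemma kern_functional_uword:
  assumes "length i = length j"
  shows "kern_functional (uword i j) = complex_of_real (kern i j)"
proof -
  have "abs_ao (Poly_Mapping.single (Free_Word (zip i j)) 1) = uword i j"
    using assms by (simp add: abs_ao_single scaleC_one)
  then show ?thesis
    using kern_functional_abs[of "Poly_Mapping.single (Free_Word (zip i j)) 1"] assms
    by (simp add: linear_extension_single scaleC_one)
qed

text \<open>Noncrossing pairings are fixed vectors of the tensor powers of \<open>u\<close>:
  contracting a pair of neighbours uses one orthogonality relation of \<open>u\<close>.\<close>

lemma uword_ncp:
  fixes i :: "'n::finite list"
  assumes "dyck d" "length i = length d"
  shows "(\<Sum>k\<in>words (length d). complex_of_real (ncp d k) *\<^sub>C uword i k) = complex_of_real (ncp d i) *\<^sub>C 1"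
  using assms
proof (induction arbitrary: i rule: dyck.induct)
  case dyck_Nil
  then show ?case by (simp add: words_0)
next
  case (dyck_cup d1 d2)
  from dyck_cup.prems have "length i = length d1 + 2 + length d2" by simp
  then obtain i1 a b i2 where i: "i = i1 @ [a, b] @ i2" "length i1 = length d1" "length i2 = length d2"
    by (rule split_at_pair)
  have len: "length (d1 @ [True, False] @ d2) = length d1 + Suc (Suc (length d2))" by simp
  have "(\<Sum>k\<in>words (length (d1 @ [True, False] @ d2)).
        complex_of_real (ncp (d1 @ [True, False] @ d2) k) *\<^sub>C uword i k) =
     (\<Sum>v1\<in>words (length d1). \<Sum>p\<in>UNIV. \<Sum>q\<in>UNIV. \<Sum>v2\<in>words (length d2).
        complex_of_real (ncp (d1 @ [True, False] @ d2) (v1 @ [p, q] @ v2)) *\<^sub>C uword i (v1 @ [p, q] @ v2))"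
    unfolding len by (simp only: sum_words_append sum_words_Suc append_Cons append_Nil)
  also have "\<dots> = (\<Sum>v1\<in>words (length d1). \<Sum>p\<in>UNIV. \<Sum>q\<in>UNIV.
        if p = q then \<Sum>v2\<in>words (length d2). complex_of_real (ncp (d1 @ d2) (v1 @ v2)) *\<^sub>C
          (uword i1 v1 * (u a p * u b p) * uword i2 v2) else 0)"
  proof (intro sum.cong refl)
    fix v1 :: "'n list" and p q :: 'n
    assume "v1 \<in> words (length d1)"
    then have v1: "length d1 = length v1" "length i1 = length v1" using i(2) by (simp_all add: length_words)
    have A: "ncp (d1 @ [True, False] @ d2) (v1 @ [p, q] @ v2) = of_bool (p = q) * ncp (d1 @ d2) (v1 @ v2)" for v2
      by (rule ncp_cup) (rule v1)
    have "uword (i1 @ [a, b] @ i2) (v1 @ [p, q] @ v2) = uword i1 v1 * uword ([a, b] @ i2) ([p, q] @ v2)" for v2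
      by (rule uword_append) (rule v1)
    then have B: "uword i (v1 @ [p, q] @ v2) = uword i1 v1 * (u a p * u b q) * uword i2 v2" for v2
      unfolding i(1) by (simp add: mult.assoc)
    show "(\<Sum>v2\<in>words (length d2).
        complex_of_real (ncp (d1 @ [True, False] @ d2) (v1 @ [p, q] @ v2)) *\<^sub>C uword i (v1 @ [p, q] @ v2)) =
        (if p = q then \<Sum>v2\<in>words (length d2). complex_of_real (ncp (d1 @ d2) (v1 @ v2)) *\<^sub>C
          (uword i1 v1 * (u a p * u b p) * uword i2 v2) else 0)"
      unfolding A B by (cases "p = q") simp_all
  qed
  also have "\<dots> = (\<Sum>v1\<in>words (length d1). \<Sum>p\<in>UNIV. \<Sum>v2\<in>words (length d2).
        complex_of_real (ncp (d1 @ d2) (v1 @ v2)) *\<^sub>C (uword i1 v1 * (u a p * u b p) * uword i2 v2))"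
    by simp
  also have "\<dots> = (\<Sum>v1\<in>words (length d1). \<Sum>v2\<in>words (length d2). \<Sum>p\<in>UNIV.
        complex_of_real (ncp (d1 @ d2) (v1 @ v2)) *\<^sub>C (uword i1 v1 * (u a p * u b p) * uword i2 v2))"
    by (intro sum.cong refl sum.swap)
  also have "\<dots> = (\<Sum>v1\<in>words (length d1). \<Sum>v2\<in>words (length d2).
        complex_of_real (ncp (d1 @ d2) (v1 @ v2)) *\<^sub>C
          (uword i1 v1 * (\<Sum>p\<in>UNIV. u a p * u b p) * uword i2 v2))"
    by (simp only: sum_distrib_left sum_distrib_right scaleC_sum_right)
  also have "\<dots> = (if a = b then 1 else 0) *\<^sub>C (\<Sum>v1\<in>words (length d1). \<Sum>v2\<in>words (length d2).
        complex_of_real (ncp (d1 @ d2) (v1 @ v2)) *\<^sub>C (uword (i1 @ i2) (v1 @ v2)))"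
    using i by (simp add: u_orthogonal uword_append length_words scaleC_one)
  also have "(\<Sum>v1\<in>words (length d1). \<Sum>v2\<in>words (length d2).
        complex_of_real (ncp (d1 @ d2) (v1 @ v2)) *\<^sub>C (uword (i1 @ i2) (v1 @ v2))) =
        (\<Sum>v\<in>words (length (d1 @ d2)). complex_of_real (ncp (d1 @ d2) v) *\<^sub>C (uword (i1 @ i2) v))"
    by (simp add: sum_words_append)
  also have "\<dots> = complex_of_real (ncp (d1 @ d2) (i1 @ i2)) *\<^sub>C 1"
    by (rule dyck_cup.IH) (use i in simp)
  finally show ?case
    using ncp_cup[of d1 i1 d2 a b i2] i by (simp add: scaleC_scaleC scaleC_one)
qed

lemma coproduct_uword:
  fixes i j :: "'n::finite list"
  shows "length i = length j \<Longrightarrow> coproduct (uword i j) = (\<Sum>k\<in>words (length i). tensor (uword i k) (uword k j))"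
proof (induction i j rule: list_induct2)
  case Nil
  then show ?case
    using unital_algebra_hom_coproduct[where 'a = 'n] by (simp add: words_0 unital_algebra_hom_def tensor_one)
next
  case (Cons a i b j)
  have "coproduct (uword (a # i) (b # j)) = coproduct (u a b) * coproduct (uword i j)"
    using unital_algebra_hom_coproduct[where 'a = 'n] by (simp add: unital_algebra_hom_def)
  also have "\<dots> = (\<Sum>c\<in>UNIV. \<Sum>k\<in>words (length i). tensor (uword (a # i) (c # k)) (uword (c # k) (b # j)))"
    by (simp add: coproduct_u Cons.IH sum_product tensor_mult)
  also have "\<dots> = (\<Sum>k\<in>words (length (a # i)). tensor (uword (a # i) k) (uword k (b # j)))"
    by (simp only: sum_words_Suc list.size add_0_right add_Suc_right)
  finally show ?case .
qed

lemma haar_state_linear: "haar_state h \<Longrightarrow> complex_linear h"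
  by (simp add: haar_state_def is_state_def)

lemma haar_state_1: "haar_state h \<Longrightarrow> h 1 = 1"
  by (simp add: haar_state_def is_state_def)

text \<open>The matrices of \<open>h\<close> and of the projection \<open>kern\<close> on words of length \<open>m\<close> agree: since \<open>h\<close> is
  invariant and \<open>kern\<close> comes from a functional on the algebra, \<open>h = h \<circ> kern\<close>; since the
  noncrossing pairings are fixed vectors, \<open>h \<circ> kern = kern\<close>.\<close>

lemma haar_state_uword:
  fixes h :: "'n::finite ao \<Rightarrow> complex"
  assumes h: "haar_state h" and len: "length i = length j"
  shows "h (uword i j) = complex_of_real (kern i j)"
proof -
  note lin = haar_state_linear[OF h]
  have bil: "bilinear_map (\<lambda>a (b :: 'n ao). h a *\<^sub>C b)"
    using lin by (simp add: bilinear_map_def complex_linear_def scaleC_add_left scaleC_add_right scaleC_scaleC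
        scaleC_complex_def mult.commute)
  have "(\<Sum>k\<in>words (length i). h (uword i k) *\<^sub>C uword k j) =
      tensor_lift (\<lambda>a b. h a *\<^sub>C b) (coproduct (uword i j))"
    using coproduct_uword[OF len]
    by (simp add: complex_linear_sum[OF complex_linear_tensor_lift[OF bil]] tensor_lift_tensor[OF bil])
  also have "\<dots> = h (uword i j) *\<^sub>C 1"
    using h by (simp add: haar_state_def)
  finally have "kern_functional (\<Sum>k\<in>words (length i). h (uword i k) *\<^sub>C uword k j) =
      kern_functional (h (uword i j) *\<^sub>C 1 :: 'n ao)" by simp
  moreover have "kern_functional (1 :: 'n ao) = 1"
    using kern_functional_uword[of "[] :: 'n list" "[]"] kern_ncp[of "[] :: 'n list" 0 "[]"] dyck_Nil
    by (simp add: words_0 dycks_def words_def ncp_def)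
  ultimately have "(\<Sum>k\<in>words (length i). h (uword i k) * kern k j) = h (uword i j)"
    using len by (simp add: complex_linear_sum complex_linear_scaleC complex_linear_kern_functional
        kern_functional_uword scaleC_complex_def length_words)
  moreover have "(\<Sum>k\<in>words (length i). h (uword i k) * kern k j) = kern j i"
  proof -
    have "(\<Sum>k\<in>words (length i). complex_of_real (kern k j) *\<^sub>C uword i k) =
        (\<Sum>k\<in>words (length i). complex_of_real (kern j k) *\<^sub>C uword i k)"
      using len by (intro sum.cong refl) (simp add: kern_sym length_words)
    also have "\<dots> = (\<Sum>e\<in>dycks (length i). complex_of_real (kern_coeff (length i) e j) *\<^sub>C
        (\<Sum>k\<in>words (length i). complex_of_real (ncp e k) *\<^sub>C uword i k))"
      using len by (simp add: kern_def scaleC_sum_left scaleC_sum_right scaleC_scaleC sum.swap[of _ "dycks _"])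
    also have "\<dots> = (\<Sum>e\<in>dycks (length i). complex_of_real (kern_coeff (length i) e j) *\<^sub>C
        (complex_of_real (ncp e i) *\<^sub>C 1))"
      by (intro sum.cong refl) (auto simp: dycks_def simp flip: uword_ncp)
    also have "\<dots> = complex_of_real (kern j i) *\<^sub>C 1"
      using len by (simp add: kern_def scaleC_scaleC scaleC_sum_left)
    finally have "h (\<Sum>k\<in>words (length i). complex_of_real (kern k j) *\<^sub>C uword i k) = kern j i"
      by (simp add: complex_linear_scaleC[OF lin] haar_state_1[OF h] scaleC_complex_def)
    then show ?thesis
      by (simp add: complex_linear_sum[OF lin] complex_linear_scaleC[OF lin] scaleC_complex_def mult.commute)
  qed
  ultimately show ?thesis using len by (simp add: kern_sym)
qed

text \<open>Passing from \<open>x * y\<close> to \<open>y * x\<close> rotates the row word and the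
  column word simultaneously, which does not change \<open>kern\<close>.\<close>

lemma haar_state_trace:
  fixes h :: "'n::finite ao \<Rightarrow> complex"
  assumes h: "haar_state h"
  shows "h (x * y) = h (y * x)"
proof -
  note lin = haar_state_linear[OF h]
  have words: "h (uword i j * uword i' j') = h (uword i' j' * uword i j)"
    if len: "length i = length j" "length i' = length j'" for i j i' j'
  proof -
    have 1: "h (uword (i @ i') (j @ j')) = kern (i @ i') (j @ j')"
      and 2: "h (uword (i' @ i) (j' @ j)) = kern (i' @ i) (j' @ j)"
      using len by (intro haar_state_uword[OF h]; simp)+
    have "kern (rotate (length i) (i @ i')) (rotate (length i) (j @ j')) = kern (i @ i') (j @ j')"
      by (rule kern_rotate) (simp add: len)
    moreover have "rotate (length i) (j @ j') = j' @ j"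
      unfolding len(1) by (rule rotate_append)
    ultimately have "kern (i' @ i) (j' @ j) = kern (i @ i') (j @ j')"
      by (simp only: rotate_append)
    with 1 2 show ?thesis
      by (simp only: uword_append[OF len(1)] uword_append[OF len(2)])
  qed
  show ?thesis
  proof (induct x rule: ao_induct)
    case 1: (uword c i j)
    show ?case
    proof (induct y rule: ao_induct)
      case (uword d i' j')
      then show ?case
        using words[OF 1 uword]
        by (simp add: mult_scaleC_left mult_scaleC_right complex_linear_scaleC[OF lin] scaleC_complex_def)
    qed (simp add: distrib_left distrib_right complex_linear_add[OF lin])
  qed (simp add: distrib_left distrib_right complex_linear_add[OF lin])
qed

section \<open>Hilbert space preliminaries\<close>

lemma cinner_zero_right: "cinner x 0 = (0 :: complex)" for x :: "'h::complex_hilbert_space"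
  using cinner_scaleC_right[of x 0 0] by simp

lemma cinner_add_left: "cinner (x + y) z = cinner x z + cinner y (z :: 'h::complex_hilbert_space)"
  by (metis cinner_add_right cinner_commute complex_cnj_add)

lemma cinner_scaleC_left: "cinner (c *\<^sub>C x) y = cnj c * cinner x (y :: 'h::complex_hilbert_space)"
  by (metis cinner_scaleC_right cinner_commute complex_cnj_mult)

lemma cinner_zero_left: "cinner 0 x = (0 :: complex)" for x :: "'h::complex_hilbert_space"
  using cinner_scaleC_left[of 0 0 x] by simp

lemma cinner_minus_left: "cinner (- x) y = - cinner x (y :: 'h::complex_hilbert_space)"
  using cinner_add_left[of x "- x" y] by (simp add: cinner_zero_left eq_neg_iff_add_eq_0 add.commute)

lemma cinner_minus_right: "cinner x (- y) = - cinner x (y :: 'h::complex_hilbert_space)"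
  using cinner_add_right[of x y "- y"] by (simp add: cinner_zero_right eq_neg_iff_add_eq_0 add.commute)

lemma cinner_diff_right: "cinner x (y - z) = cinner x y - cinner x (z :: 'h::complex_hilbert_space)"
  using cinner_add_right[of x y "- z"] by (simp add: cinner_minus_right)

lemma cinner_sum_right: "cinner x (sum f A) = (\<Sum>i\<in>A. cinner x (f i :: 'h::complex_hilbert_space))"
  by (induction A rule: infinite_finite_induct) (simp_all add: cinner_zero_right cinner_add_right)

lemma cinner_sum_left: "cinner (sum f A) x = (\<Sum>i\<in>A. cinner (f i) (x :: 'h::complex_hilbert_space))"
  by (induction A rule: infinite_finite_induct) (simp_all add: cinner_zero_left cinner_add_left)

lemma cinner_Cauchy_Schwarz: "cmod (cinner x y) \<le> norm x * norm (y :: 'h::complex_hilbert_space)"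
proof (cases "y = 0")
  case True
  then show ?thesis by (simp add: cinner_zero_right)
next
  case False
  define a where "a = cinner y x"
  define c where "c = a / complex_of_real ((norm y)\<^sup>2)"
  define z where "z = x - c *\<^sub>C y"
  have yz: "cinner y z = 0"
    using False by (simp add: z_def cinner_diff_right cinner_scaleC_right cinner_self c_def a_def)
  have "cinner z z = cinner x z - cnj c * cinner y z"
    using cinner_add_left[of x "- (c *\<^sub>C y)" z]
    by (simp add: z_def cinner_minus_left cinner_scaleC_left)
  also have "\<dots> = complex_of_real ((norm x)\<^sup>2) - c * cinner x y"
    by (simp add: yz) (simp add: z_def cinner_diff_right cinner_scaleC_right cinner_self)
  also have "c * cinner x y = complex_of_real ((cmod a)\<^sup>2 / (norm y)\<^sup>2)"
    using cinner_commute[of x y] complex_norm_square[of a] by (simp add: c_def a_def cinner_commute[of y x])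
  finally have "(norm z)\<^sup>2 = (norm x)\<^sup>2 - (cmod a)\<^sup>2 / (norm y)\<^sup>2"
    unfolding cinner_self by (metis of_real_diff of_real_eq_iff)
  then have "(cmod a)\<^sup>2 / (norm y)\<^sup>2 \<le> (norm x)\<^sup>2"
    by (metis diff_ge_0_iff_ge zero_le_power2)
  then have "(cmod a)\<^sup>2 \<le> (norm x * norm y)\<^sup>2"
    using False by (simp add: power_mult_distrib divide_simps split: if_splits)
  then have "cmod a \<le> norm x * norm y"
    by (rule power2_le_imp_le) simp
  then show ?thesis by (simp add: a_def cinner_commute[of y x])
qed

text \<open>By log-convexity the ratios of successive terms increase, so a first ratio above
  \<open>b\<close> would force growth faster than any \<open>C * b ^ m\<close>. The bound obtained
  is free of \<open>C\<close>.\<close>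

lemma log_convex_bound:
  fixes a :: "nat \<Rightarrow> real"
  assumes pos: "\<And>m. a m \<ge> 0" and conv: "\<And>m. (a (Suc m))\<^sup>2 \<le> a m * a (Suc (Suc m))"
    and bound: "\<And>m. a m \<le> C * b ^ m" and b: "b > 0"
  shows "a 1 \<le> b * a 0"
proof (rule ccontr)
  assume neg: "\<not> a 1 \<le> b * a 0"
  have a0: "a 0 > 0"
  proof (rule ccontr)
    assume "\<not> a 0 > 0"
    then have "a 0 = 0" using pos[of 0] by simp
    then have "a 1 = 0" using conv[of 0] by simp
    then show False using neg \<open>a 0 = 0\<close> by simp
  qed
  define r where "r = a 1 / a 0"
  have r: "r > b" "r > 0" using neg a0 b by (auto simp: r_def field_simps intro: less_trans[of 0 "b * a 0"])
  have step: "a (Suc m) \<ge> r * a m \<and> a m > 0" for m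
  proof (induction m)
    case 0
    then show ?case using a0 by (simp add: r_def)
  next
    case (Suc m)
    then have p: "a (Suc m) > 0" using r by (meson less_le_trans mult_pos_pos)
    have "r * a (Suc m) * a m \<le> a (Suc m) * a (Suc m)"
      using Suc p by (simp add: mult.commute mult.left_commute)
    also have "\<dots> \<le> a (Suc (Suc m)) * a m" using conv[of m] by (simp add: power2_eq_square mult.commute)
    finally show ?case using Suc p by simp
  qed
  have "a m \<ge> r ^ m * a 0" for m
  proof (induction m)
    case (Suc m)
    have "r ^ Suc m * a 0 = r * (r ^ m * a 0)" by simp
    also have "\<dots> \<le> r * a m" using Suc r by (intro mult_left_mono) auto
    also have "\<dots> \<le> a (Suc m)" using step[of m] by simp
    finally show ?case .
  qed simp
  then have "r ^ m * a 0 \<le> C * b ^ m" for m using bound[of m] by (meson order_trans)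
  then have le: "(r / b) ^ m \<le> C / a 0" for m
    using a0 b by (simp add: power_divide field_simps)
  have "r / b > 1" using r b by simp
  then obtain m where "C / a 0 < (r / b) ^ m" using real_arch_pow by blast
  with le[of m] show False by simp
qed

lemma star_one: "star (1 :: 'a::star_algebra_1) = 1"
  using star_mult[of "star (1 :: 'a)" 1] by (simp add: star_star)

lemma star_zero: "star (0 :: 'a::star_algebra_1) = 0"
  using star_add[of "0 :: 'a" 0] by simp

lemma star_minus: "star (- x) = - star (x :: 'a::star_algebra_1)"
  using star_add[of x "- x"] by (simp add: star_zero eq_neg_iff_add_eq_0 add.commute)

lemma star_diff: "star (x - y) = star x - star (y :: 'a::star_algebra_1)"
  using star_add[of x "- y"] by (simp add: star_minus)

lemma star_sum: "star (sum f A) = (\<Sum>i\<in>A. star (f i :: 'a::star_algebra_1))"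
  by (induction A rule: infinite_finite_induct) (simp_all add: star_zero star_add)

lemma star_power: "star (x ^ m) = star (x :: 'a::star_algebra_1) ^ m"
  by (induction m) (simp_all add: star_one star_mult power_commutes)

section \<open>The character of the fundamental corepresentation\<close>

definition chi :: "'n::finite ao" where
  "chi = (\<Sum>i\<in>UNIV. u i i)"

lemma star_chi: "star chi = chi"
  by (simp add: chi_def star_sum star_u)

lemma chi_power: "chi ^ m = (\<Sum>w\<in>words m. uword w w :: 'n::finite ao)"
proof (induction m)
  case (Suc m)
  have "chi * (\<Sum>w\<in>words m. uword w w) = (\<Sum>w\<in>words (Suc m). uword w w :: 'n ao)"
    by (simp add: chi_def sum_product sum_words_Suc)
  with Suc show ?case by simp
qed (simp add: words_0)

locale haar_gns =
  fixes h :: "'n::finite ao \<Rightarrow> complex"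
    and \<pi> :: "'n ao \<Rightarrow> 'h::complex_hilbert_space \<Rightarrow>\<^sub>L 'h"
    and \<Omega> :: 'h
  assumes card: "CARD('n) \<ge> 3"
    and haar: "haar_state h"
    and gns: "gns_representation h \<pi> \<Omega>"
begin

lemma card2: "CARD('n) \<ge> 2"
  using card by simp

lemmas h_linear = haar_state_linear[OF haar]
lemmas h_trace = haar_state_trace[OF haar]
lemmas h_add = complex_linear_add[OF h_linear]
lemmas h_diff = complex_linear_diff[OF h_linear]
lemmas h_sum = complex_linear_sum[OF h_linear]

lemma h_scaleC: "h (c *\<^sub>C x) = c * h x"
  using complex_linear_scaleC[OF h_linear] by (simp add: scaleC_complex_def)

lemma pi_rep: "star_representation \<pi>"
  using gns by (simp add: gns_representation_def)

lemma pi_mult: "\<pi> (x * y) v = \<pi> x (\<pi> y v)"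
  using pi_rep by (simp add: star_representation_def)

lemma pi_one: "\<pi> 1 v = v"
  using pi_rep by (simp add: star_representation_def)

lemma pi_linear: "complex_linear \<pi>"
  using pi_rep by (simp add: star_representation_def)

lemma pi_add: "\<pi> (x + y) v = \<pi> x v + \<pi> y v"
  using pi_linear by (simp add: complex_linear_def blinfun.add_left)

lemma pi_scaleC: "\<pi> (c *\<^sub>C x) v = c *\<^sub>C \<pi> x v"
  using pi_linear by (simp add: complex_linear_def scaleC_blinfun.rep_eq)

lemma pi_diff: "\<pi> (x - y) v = \<pi> x v - \<pi> y v"
  using complex_linear_diff[OF pi_linear] by (simp add: blinfun.diff_left)

lemma pi_zero: "\<pi> 0 v = 0"
  using complex_linear_0[OF pi_linear] by simp

lemma pi_sum: "\<pi> (sum f A) v = (\<Sum>i\<in>A. \<pi> (f i) v)"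
  by (induction A rule: infinite_finite_induct) (simp_all add: pi_zero pi_add)

lemma pi_star: "cinner (\<pi> (star x) v) w = cinner v (\<pi> x w)"
  using pi_rep by (simp add: star_representation_def)

lemma cinner_pi: "cinner (\<pi> x \<Omega>) (\<pi> y \<Omega>) = h (star x * y)"
  using gns pi_star[of "star x" \<Omega> "\<pi> y \<Omega>"] by (simp add: gns_representation_def star_star flip: pi_mult)

lemma norm_pi: "complex_of_real ((norm (\<pi> x \<Omega>))\<^sup>2) = h (star x * x)"
  using cinner_pi[of x x] by (simp add: cinner_self)

lemma h_star: "h (star x) = cnj (h x)"
  using cinner_pi[of x 1] cinner_pi[of 1 x] cinner_commute[of "\<pi> x \<Omega>" "\<pi> 1 \<Omega>"]
  by (simp add: star_one)

lemma norm_pi_star: "norm (\<pi> (star x) \<Omega>) = norm (\<pi> x \<Omega>)"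
proof -
  have "complex_of_real ((norm (\<pi> (star x) \<Omega>))\<^sup>2) = complex_of_real ((norm (\<pi> x \<Omega>))\<^sup>2)"
    unfolding norm_pi by (simp add: star_star h_trace[of x])
  then show ?thesis by (simp only: of_real_eq_iff power2_eq_iff_nonneg norm_ge_zero)
qed

text \<open>As \<open>h\<close> is a trace, \<open>star\<close> preserves the norms of the vectors
  \<open>\<pi> x \<Omega>\<close>; it turns right multiplication by \<open>x\<close> into left
  multiplication by \<open>star x\<close>, which is bounded.\<close>

lemma norm_pi_mult: "norm (\<pi> d (\<pi> x \<Omega>)) \<le> norm (\<pi> (star x)) * norm (\<pi> d \<Omega>)"
proof -
  have "norm (\<pi> d (\<pi> x \<Omega>)) = norm (\<pi> (star (d * x)) \<Omega>)"
    by (simp add: norm_pi_star pi_mult)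
  also have "\<dots> = norm (\<pi> (star x) (\<pi> (star d) \<Omega>))"
    by (simp add: star_mult pi_mult)
  also have "\<dots> \<le> norm (\<pi> (star x)) * norm (\<pi> (star d) \<Omega>)"
    by (rule norm_blinfun)
  finally show ?thesis by (simp add: norm_pi_star)
qed

lemma dense_zero:
  assumes "\<And>x. cinner v (\<pi> x \<Omega>) = 0"
  shows "v = 0"
proof -
  have "v \<in> closure (range (\<lambda>x. \<pi> x \<Omega>))" using gns by (simp add: gns_representation_def)
  then obtain f where f: "\<And>m. f m \<in> range (\<lambda>x. \<pi> x \<Omega>)" "f \<longlonglongrightarrow> v"
    unfolding closure_sequential by blast
  have "norm v * norm v \<le> norm v * norm (v - f m)" for m
  proof -
    have "cinner v v = cinner v (v - f m)"
      using f(1)[of m] assms by (auto simp: cinner_diff_right)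
    then have "cmod (cinner v v) \<le> norm v * norm (v - f m)"
      using cinner_Cauchy_Schwarz[of v "v - f m"] by simp
    then show ?thesis by (simp add: cinner_self power2_eq_square norm_mult)
  qed
  moreover have "(\<lambda>m. norm v * norm (v - f m)) \<longlonglongrightarrow> norm v * norm (v - v)"
    by (intro tendsto_intros f(2))
  ultimately have "norm v * norm v \<le> norm v * norm (v - v)"
    by (intro LIMSEQ_le_const) auto
  then show ?thesis by (simp add: mult_le_0_iff)
qed

lemma h_chi_power: "\<exists>t\<le>2 ^ m. h (chi ^ m) = complex_of_real t"
proof -
  have "h (chi ^ m) = complex_of_real (\<Sum>w\<in>(words m :: 'n list set). kern w w)"
    by (simp add: chi_power h_sum haar_state_uword[OF haar])
  then show ?thesis using trace_kern[OF card2] by blast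
qed

lemma norm_chi_power: "norm (\<pi> (chi ^ m) \<Omega>) \<le> 2 ^ m"
proof -
  obtain t where t: "t \<le> 2 ^ (m + m)" "h (chi ^ (m + m)) = complex_of_real t"
    using h_chi_power by blast
  have "complex_of_real ((norm (\<pi> (chi ^ m) \<Omega>))\<^sup>2) = complex_of_real t"
    unfolding norm_pi t(2)[symmetric] by (simp add: star_power star_chi power_add)
  then have "(norm (\<pi> (chi ^ m) \<Omega>))\<^sup>2 \<le> (2 ^ m)\<^sup>2"
    using t(1) by (simp only: of_real_eq_iff) (simp add: power2_eq_square power_add)
  then show ?thesis by (rule power2_le_imp_le) simp
qed

text \<open>The moments of \<open>chi\<close> only control the vectors
  \<open>\<pi> (chi ^ m) \<Omega>\<close>. For \<open>\<pi> x \<Omega>\<close> traciality costs a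
  constant depending on \<open>x\<close>, which log-convexity of the norms removes.\<close>

lemma norm_pi_chi: "norm (\<pi> chi v) \<le> 2 * norm v"
proof -
  have "norm (\<pi> chi (\<pi> x \<Omega>)) \<le> 2 * norm (\<pi> x \<Omega>)" for x
  proof -
    define a where "a m = norm (\<pi> (chi ^ m) (\<pi> x \<Omega>))" for m
    have "a 1 \<le> 2 * a 0"
    proof (rule log_convex_bound)
      show "(a (Suc m))\<^sup>2 \<le> a m * a (Suc (Suc m))" for m
      proof -
        define v where "v = \<pi> (chi ^ m) (\<pi> x \<Omega>)"
        have v: "\<pi> (chi ^ Suc m) (\<pi> x \<Omega>) = \<pi> chi v" "\<pi> (chi ^ Suc (Suc m)) (\<pi> x \<Omega>) = \<pi> chi (\<pi> chi v)"
          by (simp_all add: v_def pi_mult)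
        have "cinner (\<pi> chi v) (\<pi> chi v) = cinner v (\<pi> chi (\<pi> chi v))"
          using pi_star[of chi v "\<pi> chi v"] by (simp add: star_chi)
        then have "complex_of_real ((norm (\<pi> chi v))\<^sup>2) = cinner v (\<pi> chi (\<pi> chi v))"
          by (simp add: cinner_self)
        then have "(norm (\<pi> chi v))\<^sup>2 = cmod (cinner v (\<pi> chi (\<pi> chi v)))"
          by (metis abs_of_nonneg norm_of_real zero_le_power2)
        also have "\<dots> \<le> norm v * norm (\<pi> chi (\<pi> chi v))" by (rule cinner_Cauchy_Schwarz)
        finally show ?thesis unfolding a_def v by (simp add: v_def)
      qed
      show "a m \<le> norm (\<pi> (star x)) * 2 ^ m" for m
        unfolding a_def using norm_pi_mult[of "chi ^ m" x] norm_chi_power[of m]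
        by (meson mult_left_mono norm_ge_zero order_trans)
    qed (simp_all add: a_def)
    then show ?thesis by (simp add: a_def pi_one)
  qed
  moreover have "closed {v. norm (\<pi> chi v) \<le> 2 * norm v}"
    by (intro closed_Collect_le continuous_intros)
  ultimately have "closure (range (\<lambda>x. \<pi> x \<Omega>)) \<subseteq> {v. norm (\<pi> chi v) \<le> 2 * norm v}"
    by (intro closure_minimal) auto
  then show ?thesis using gns by (auto simp: gns_representation_def)
qed

end

section \<open>The rotation of edges\<close>

type_synonym 'n arr = "'n \<Rightarrow> 'n \<Rightarrow> 'n ao"

text \<open>Left multiplication by the \<open>u i k\<close> commutes with right multiplication by
  the algebra. Therefore \<open>rot\<close> has a trace, namely \<open>h\<close> of the sum of its
  diagonal entries on the \<open>unit_arr a b\<close>.\<close>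

definition rot :: "'n::finite arr \<Rightarrow> 'n arr" where
  "rot F i j = (\<Sum>k\<in>UNIV. u i k * F j k)"

definition unit_arr :: "'n \<Rightarrow> 'n \<Rightarrow> 'n::finite arr" where
  "unit_arr a b i j = (if i = a \<and> j = b then 1 else 0)"

definition form :: "'n::finite arr \<Rightarrow> 'n arr \<Rightarrow> 'n ao" where
  "form F G = (\<Sum>i\<in>UNIV. \<Sum>j\<in>UNIV. star (F i j) * G i j)"

text \<open>The values on the generators of the inner cocycle given by \<open>z\<close>;
  \<open>inner_adj\<close> is the adjoint map, as \<open>form_inner_arr\<close> shows.\<close>

definition inner_arr :: "'n::finite ao \<Rightarrow> 'n arr" where
  "inner_arr z i j = (u i j - of_bool (i = j) *\<^sub>C 1) * z"

definition inner_adj :: "'n::finite arr \<Rightarrow> 'n ao" where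
  "inner_adj F = (\<Sum>i\<in>UNIV. \<Sum>j\<in>UNIV. (u i j - of_bool (i = j) *\<^sub>C 1) * F i j)"

definition comb :: "('i \<Rightarrow> complex) \<Rightarrow> ('i \<Rightarrow> 'n arr) \<Rightarrow> 'i set \<Rightarrow> 'n::finite arr" where
  "comb c F A i j = (\<Sum>m\<in>A. c m *\<^sub>C F m i j)"

lemma scaleC_mult_scaleC: "(c *\<^sub>C x) * (d *\<^sub>C y) = (c * d) *\<^sub>C (x * (y :: 'a::complex_algebra_1))"
  by (simp add: mult_scaleC_left mult_scaleC_right scaleC_scaleC mult.commute)

lemma sum_swap3: "(\<Sum>i\<in>A. \<Sum>j\<in>B. \<Sum>k\<in>C. f i j k) = (\<Sum>j\<in>B. \<Sum>k\<in>C. \<Sum>i\<in>A. f i j k)"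
  by (rule trans[OF sum.swap], rule sum.cong[OF refl], rule sum.swap)

lemma sum_swap4:
  "(\<Sum>i\<in>A. \<Sum>j\<in>B. \<Sum>k\<in>C. \<Sum>l\<in>D. f i j k l) = (\<Sum>j\<in>B. \<Sum>k\<in>C. \<Sum>l\<in>D. \<Sum>i\<in>A. f i j k l)"
  by (rule trans[OF sum.swap], rule sum.cong[OF refl], rule sum_swap3)

lemma form_comb: "form (comb c F A) (comb d G B) = (\<Sum>m\<in>A. \<Sum>k\<in>B. (cnj (c m) * d k) *\<^sub>C form (F m) (G k))"
proof -
  have "form (comb c F A) (comb d G B) = (\<Sum>i\<in>UNIV. \<Sum>j\<in>UNIV. \<Sum>m\<in>A. \<Sum>k\<in>B.
      (cnj (c m) * d k) *\<^sub>C (star (F m i j) * G k i j))"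
    by (simp add: form_def comb_def star_sum star_scaleC sum_product scaleC_mult_scaleC)
  also have "\<dots> = (\<Sum>m\<in>A. \<Sum>k\<in>B. \<Sum>i\<in>UNIV. \<Sum>j\<in>UNIV. (cnj (c m) * d k) *\<^sub>C (star (F m i j) * G k i j))"
    by (simp only: sum.swap[of _ A UNIV] sum.swap[of _ B UNIV])
  finally show ?thesis by (simp only: form_def scaleC_sum_right)
qed

lemma form_rot: "form (rot F) (rot G) = form F G"
proof -
  have "form (rot F) (rot G) = (\<Sum>i\<in>UNIV. \<Sum>j\<in>UNIV. \<Sum>k\<in>UNIV. \<Sum>l\<in>UNIV. star (F j k) * (u i k * u i l) * G j l)"
    by (simp add: form_def rot_def star_sum star_mult star_u sum_product mult.assoc)
  also have "\<dots> = (\<Sum>j\<in>UNIV. \<Sum>k\<in>UNIV. \<Sum>l\<in>UNIV. \<Sum>i\<in>UNIV. star (F j k) * (u i k * u i l) * G j l)"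
    by (rule sum_swap4)
  also have "\<dots> = (\<Sum>j\<in>UNIV. \<Sum>k\<in>UNIV. \<Sum>l\<in>UNIV. star (F j k) * (if k = l then 1 else 0) * G j l)"
    by (simp only: u_orthogonal flip: sum_distrib_left sum_distrib_right)
  also have "\<dots> = form F G"
    by (simp add: form_def if_distrib[of "\<lambda>x. _ * x"] if_distrib[of "\<lambda>x. x * _"] cong: if_cong)
  finally show ?thesis .
qed

lemma form_rot_power: "form ((rot ^^ m) F) ((rot ^^ m) G) = form F G"
  by (induction m) (simp_all add: form_rot)

lemma form_star: "form G F = star (form F G)"
  by (simp add: form_def star_sum star_mult star_star)

lemma form_unit_arr: "form (unit_arr a b) G = G a b"
proof -
  have "star (unit_arr a b i j) * G i j = (if i = a then if j = b then G a b else 0 else 0)" for i j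
    by (simp add: unit_arr_def star_one star_zero)
  then have "(\<Sum>j\<in>UNIV. star (unit_arr a b i j) * G i j) = (if i = a then G a b else 0)" for i
    by simp
  then show ?thesis by (simp add: form_def)
qed

text \<open>Orthogonality of \<open>u\<close> turns the part of \<open>inner_adj\<close> with
  factors \<open>u i j\<close> into the diagonal part, and conversely. The two carry opposite signs.
  Dually, inner arrays belong to the eigenvalue -1.\<close>

lemma inner_adj_rot: "inner_adj (rot F) = - inner_adj F"
proof -
  have "inner_adj (rot F) = (\<Sum>i\<in>UNIV. \<Sum>j\<in>UNIV. \<Sum>k\<in>UNIV. (u i j * u i k) * F j k) -
      (\<Sum>i\<in>UNIV. \<Sum>j\<in>UNIV. \<Sum>k\<in>UNIV. (of_bool (i = j) *\<^sub>C 1) * u i k * F j k)"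
    by (simp add: inner_adj_def rot_def sum_distrib_left left_diff_distrib sum_subtractf mult.assoc)
  also have "(\<Sum>i\<in>UNIV. \<Sum>j\<in>UNIV. \<Sum>k\<in>UNIV. (u i j * u i k) * F j k) =
      (\<Sum>j\<in>UNIV. \<Sum>k\<in>UNIV. (\<Sum>i\<in>UNIV. u i j * u i k) * F j k)"
    unfolding sum_distrib_right by (rule sum_swap3)
  also have "\<dots> = (\<Sum>j\<in>UNIV. \<Sum>k\<in>UNIV. of_bool (j = k) *\<^sub>C 1 * F j k)"
    by (intro sum.cong refl) (simp add: u_orthogonal scaleC_one)
  also have "(\<Sum>i\<in>UNIV. \<Sum>j\<in>UNIV. \<Sum>k\<in>UNIV. (of_bool (i = j) *\<^sub>C 1) * u i k * F j k) =
      (\<Sum>i\<in>UNIV. \<Sum>j\<in>UNIV. if i = j then \<Sum>k\<in>UNIV. u i k * F i k else 0)"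
    by (intro sum.cong refl) (simp add: scaleC_one)
  also have "\<dots> = (\<Sum>i\<in>UNIV. \<Sum>k\<in>UNIV. u i k * F i k)"
    by simp
  finally show ?thesis
    by (simp add: inner_adj_def left_diff_distrib sum_subtractf)
qed

lemma inner_adj_rot_power: "inner_adj ((rot ^^ m) F) = (-1) ^ m *\<^sub>C inner_adj F"
proof (induction m)
  case (Suc m)
  have "(- c) *\<^sub>C x = - (c *\<^sub>C x)" for c and x :: "'a ao"
    using scaleC_add_left[of c "- c" x] by (simp add: eq_neg_iff_add_eq_0 add.commute)
  then show ?case using Suc by (simp add: inner_adj_rot)
qed (simp add: scaleC_one)

lemma inner_adj_comb: "inner_adj (comb c F A) = (\<Sum>m\<in>A. c m *\<^sub>C inner_adj (F m))"
  by (simp add: inner_adj_def comb_def scaleC_sum_right sum_distrib_left mult_scaleC_right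
      sum.swap[of _ A])

lemma inner_adj_unit_arr: "inner_adj (unit_arr a b) = u a b - of_bool (a = b) *\<^sub>C 1"
proof -
  have eq: "(u i j - of_bool (i = j) *\<^sub>C 1) * unit_arr a b i j =
      (if i = a then if j = b then u a b - of_bool (a = b) *\<^sub>C 1 else 0 else 0)" for i j
    by (simp add: unit_arr_def)
  have "(\<Sum>j\<in>UNIV. (u i j - of_bool (i = j) *\<^sub>C 1) * unit_arr a b i j) =
      (if i = a then u a b - of_bool (a = b) *\<^sub>C 1 else 0)" for i
    unfolding eq by (cases "i = a") simp_all
  then show ?thesis by (simp add: inner_adj_def)
qed

lemma star_bool: "star (of_bool b *\<^sub>C 1) = of_bool b *\<^sub>C (1 :: 'a::star_algebra_1)"
  by (simp add: star_scaleC star_one)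

lemma form_inner_arr: "form G (inner_arr z) = star (inner_adj G) * z"
  by (simp add: form_def inner_arr_def inner_adj_def star_sum star_mult star_diff star_u star_bool
      sum_distrib_right mult.assoc)

text \<open>This is the Gram operator of the inner arrays. When \<open>CARD('n) \<ge> 3\<close> it
  is invertible, since \<open>chi\<close> has norm at most 2; so the inner arrays form a copy of the
  algebra, of dimension 1.\<close>

lemma inner_adj_inner_arr:
  "inner_adj (inner_arr z) = (of_nat (2 * CARD('n)) *\<^sub>C 1 - 2 *\<^sub>C chi) * (z :: 'n::finite ao)"
proof -
  have "inner_adj (inner_arr z) =
      (\<Sum>i\<in>UNIV. \<Sum>j\<in>UNIV. (u i j - of_bool (i = j) *\<^sub>C 1) * (u i j - of_bool (i = j) *\<^sub>C 1)) * z"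
    by (simp add: inner_adj_def inner_arr_def sum_distrib_right mult.assoc)
  also have "(\<Sum>i\<in>UNIV. \<Sum>j\<in>UNIV. (u i j - of_bool (i = j) *\<^sub>C 1) * (u i j - of_bool (i = j) *\<^sub>C 1)) =
     (\<Sum>i\<in>UNIV. \<Sum>j\<in>UNIV. u i j * u i j + (if i = j then (1 - 2 *\<^sub>C u i i) else 0) :: 'n ao)"
    by (intro sum.cong refl)
       (auto simp: scaleC_one algebra_simps scaleC_add_left[of 1 1, simplified])
  also have "\<dots> = (of_nat (2 * CARD('n)) *\<^sub>C 1 - 2 *\<^sub>C chi)"
  proof -
    have n: "(\<Sum>i\<in>(UNIV :: 'n set). 1) = of_nat CARD('n) *\<^sub>C (1 :: 'n ao)"
      using scaleC_sum_left[of "\<lambda>_. 1" "UNIV :: 'n set" "1 :: 'n ao"] by (simp add: scaleC_one)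
    show ?thesis
      by (simp add: sum.distrib u_orthogonal sum_subtractf n chi_def scaleC_sum_right scaleC_add_left algebra_simps)
        (metis mult_2 mult_2_right scaleC_add_left)
  qed
  finally show ?thesis .
qed

text \<open>Each application of \<open>rot\<close> moves a window of two letters one place along the
  word \<open>i # j # w\<close>. Rows run over its first \<open>m\<close> letters and columns over
  its last \<open>m\<close>, so they differ by a shift of two.\<close>

lemma rot_power:
  "(rot ^^ m) F i j = (\<Sum>w\<in>words m. uword (take m (i # j # w)) w *
     F ((i # j # w) ! m) ((i # j # w) ! Suc m))"
proof (induction m arbitrary: i j)
  case 0
  show ?case by (simp add: words_0)
next
  case (Suc m)
  have "(rot ^^ Suc m) F i j = (\<Sum>k\<in>UNIV. u i k * (rot ^^ m) F j k)"
    by (simp add: rot_def)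
  also have "\<dots> = (\<Sum>k\<in>UNIV. \<Sum>w\<in>words m. uword (take (Suc m) (i # j # k # w)) (k # w) *
     F ((i # j # k # w) ! Suc m) ((i # j # k # w) ! Suc (Suc m)))"
    by (simp add: Suc.IH sum_distrib_left mult.assoc)
  finally show ?case by (simp add: sum_words_Suc)
qed

text \<open>Taking the trace closes the word to a circle, where the shift of two in
  \<open>rot_power\<close> becomes \<open>rotate 2\<close>. For \<open>m \<ge> 2\<close> the last
  two letters of \<open>v\<close> repeat the first two without overlapping them.\<close>

lemma rot_power_trace:
  assumes "m \<ge> 2"
  shows "(\<Sum>a\<in>UNIV. \<Sum>b\<in>UNIV. (rot ^^ m) (unit_arr a b) a b) =
    (\<Sum>w\<in>words m. uword w (rotate 2 w) :: 'n::finite ao)"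
proof -
  define g :: "'n list \<Rightarrow> 'n ao" where
    "g v = (if drop m v = take 2 v then uword (take m v) (drop 2 v) else 0)" for v
  have "(rot ^^ m) (unit_arr a b) a b = (\<Sum>w\<in>words m. g (a # b # w))" for a b
    unfolding rot_power
  proof (intro sum.cong refl)
    fix w :: "'n list" assume "w \<in> words m"
    then have "drop m (a # b # w) = [(a # b # w) ! m, (a # b # w) ! Suc m]"
      by (intro nth_equalityI) (auto simp: words_def less_Suc_eq numeral_2_eq_2)
    then show "uword (take m (a # b # w)) w * unit_arr a b ((a # b # w) ! m) ((a # b # w) ! Suc m) =
        g (a # b # w)"
      by (auto simp: g_def unit_arr_def numeral_2_eq_2)
  qed
  then have "(\<Sum>a\<in>UNIV. \<Sum>b\<in>UNIV. (rot ^^ m) (unit_arr a b) a b) = (\<Sum>v\<in>words (m + 2). g v)"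
    by (simp add: numeral_2_eq_2 sum_words_Suc)
  also have "\<dots> = (\<Sum>v\<in>{v \<in> words (m + 2). drop m v = take 2 v}. uword (take m v) (drop 2 v))"
    by (simp add: g_def sum.If_cases Int_def)
  also have "\<dots> = (\<Sum>w\<in>words m. uword w (rotate 2 w))"
  proof (rule sum.reindex_bij_witness[of _ "\<lambda>w. w @ take 2 w" "take m"])
    fix v :: "'n list" assume "v \<in> {v \<in> words (m + 2). drop m v = take 2 v}"
    then have v: "length v = m + 2" "drop m v = take 2 v" by (simp_all add: words_def)
    have tt: "take 2 (take m v) = take 2 v" using assms by (simp add: min_def)
    show "take m v @ take 2 (take m v) = v"
      unfolding tt v(2)[symmetric] by (rule append_take_drop_id)
    show "take m v \<in> words m" using v(1) by (simp add: words_def)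
    have "take 2 v @ drop 2 (take m v) = take m v"
      using append_take_drop_id[of 2 "take m v"] unfolding tt .
    moreover have "rotate (length (take 2 v)) (take 2 v @ drop 2 (take m v)) = drop 2 (take m v) @ take 2 v"
      by (rule rotate_append)
    moreover have "length (take 2 v) = 2" using v(1) by simp
    moreover have "drop 2 (take m v) @ take 2 v = drop 2 (take m v @ drop m v)"
      using v(1) assms unfolding v(2)[symmetric] drop_append by simp
    ultimately have "rotate 2 (take m v) = drop 2 v" by (simp only: append_take_drop_id)
    then show "uword (take m v) (rotate 2 (take m v)) = uword (take m v) (drop 2 v)" by (simp only:)
  next
    fix w :: "'n list" assume w: "w \<in> words m"
    then show "take m (w @ take 2 w) = w" "w @ take 2 w \<in> {v \<in> words (m + 2). drop m v = take 2 v}"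
      using assms by (simp_all add: words_def)
  qed
  finally show ?thesis .
qed

context haar_gns
begin

section \<open>Averages of the rotation and their traces\<close>

definition rot_trace :: "nat \<Rightarrow> real" where
  "rot_trace m = Re (h (\<Sum>a\<in>UNIV. \<Sum>b\<in>UNIV. (rot ^^ m) (unit_arr a b) a b))"

lemma h_u: "h (u i j) = 0"
  using haar_state_uword[OF haar, of "[i]" "[j]"] by (simp add: kern_odd)

lemma rot_trace:
  "h (\<Sum>a\<in>UNIV. \<Sum>b\<in>UNIV. (rot ^^ m) (unit_arr a b) a b) = complex_of_real (rot_trace m)"
  "rot_trace m \<le> (if m = 0 then (real CARD('n))\<^sup>2 else if even m then 2 else 0)"
proof -
  have "\<exists>t \<le> (if m = 0 then (real CARD('n))\<^sup>2 else if even m then 2 else 0).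
      h (\<Sum>a\<in>UNIV. \<Sum>b\<in>UNIV. (rot ^^ m) (unit_arr a b) a b) = complex_of_real t"
  proof -
    consider "m = 0" | "m = 1" | "m \<ge> 2" by linarith
    then show ?thesis
    proof cases
      case 1
      have "(\<Sum>a\<in>UNIV. \<Sum>b\<in>UNIV. (rot ^^ m) (unit_arr a b) a b) = (\<Sum>a\<in>(UNIV :: 'n set). \<Sum>b\<in>(UNIV :: 'n set). (1 :: 'n ao))"
        by (simp add: 1 unit_arr_def)
      then show ?thesis
        using haar_state_1[OF haar] by (intro exI[of _ "(real CARD('n))\<^sup>2"]) (simp add: h_sum 1 power2_eq_square)
    next
      case 2
      have "h (u a k * unit_arr a b b k) = 0" for a b k :: 'n
        using complex_linear_0[OF h_linear] by (simp add: unit_arr_def h_u)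
      then show ?thesis
        by (intro exI[of _ 0]) (simp add: 2 h_sum rot_def)
    next
      case 3
      have "h (\<Sum>a\<in>UNIV. \<Sum>b\<in>UNIV. (rot ^^ m) (unit_arr a b) a b) =
          complex_of_real (\<Sum>w\<in>(words m :: 'n list set). kern w (rotate 2 w))"
        unfolding rot_power_trace[OF 3] by (simp add: h_sum haar_state_uword[OF haar])
      then show ?thesis
        using trace_rotate2[OF card2, of m] 3 by (intro exI conjI) auto
    qed
  qed
  then obtain t where t: "t \<le> (if m = 0 then (real CARD('n))\<^sup>2 else if even m then 2 else 0)"
    "h (\<Sum>a\<in>UNIV. \<Sum>b\<in>UNIV. (rot ^^ m) (unit_arr a b) a b) = complex_of_real t" by blast
  then have "rot_trace m = t" by (simp add: rot_trace_def)
  with t show "h (\<Sum>a\<in>UNIV. \<Sum>b\<in>UNIV. (rot ^^ m) (unit_arr a b) a b) = complex_of_real (rot_trace m)"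
    "rot_trace m \<le> (if m = 0 then (real CARD('n))\<^sup>2 else if even m then 2 else 0)" by simp_all
qed

lemma rot_trace_odd: "odd m \<Longrightarrow> rot_trace m = 0"
proof -
  assume m: "odd m"
  have "h (uword x y * unit_arr a b c d) = 0" if "length x = m" "length y = m" for x y and a b c d :: 'n
    using that m complex_linear_0[OF h_linear]
    by (simp add: unit_arr_def haar_state_uword[OF haar] kern_odd)
  then have "h ((rot ^^ m) (unit_arr a b) a b) = 0" for a b
    unfolding rot_power h_sum by (intro sum.neutral) (simp add: words_def)
  then show ?thesis by (simp add: rot_trace_def h_sum)
qed

text \<open>By unitarity of \<open>rot\<close> only the difference of the exponents matters; a
  negative one is handled by conjugation, the traces being real.\<close>

lemma h_form_rot_power:
  "(\<Sum>a\<in>UNIV. \<Sum>b\<in>UNIV. h (form ((rot ^^ m) (unit_arr a b)) ((rot ^^ k) (unit_arr a b)))) =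
    complex_of_real (rot_trace (if m \<le> k then k - m else m - k))"
proof -
  have *: "(\<Sum>a\<in>UNIV. \<Sum>b\<in>UNIV. h (form ((rot ^^ m) (unit_arr a b)) ((rot ^^ (m + l)) (unit_arr a b)))) =
    complex_of_real (rot_trace l)" for m l
    unfolding funpow_add o_apply form_rot_power form_unit_arr using rot_trace(1)[of l] by (simp add: h_sum)
  show ?thesis
  proof (cases "m \<le> k")
    case True
    then show ?thesis using *[of m "k - m"] by simp
  next
    case False
    then have "(\<Sum>a\<in>UNIV. \<Sum>b\<in>UNIV. h (form ((rot ^^ m) (unit_arr a b)) ((rot ^^ k) (unit_arr a b)))) =
      cnj (\<Sum>a\<in>UNIV. \<Sum>b\<in>UNIV. h (form ((rot ^^ k) (unit_arr a b)) ((rot ^^ (k + (m - k))) (unit_arr a b))))"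
      by (subst form_star) (simp add: h_star)
    then show ?thesis unfolding * using False by simp
  qed
qed

text \<open>As in the mean ergodic theorem for \<open>-rot\<close>, these averages approximate the
  projection of \<open>unit_arr a b\<close> onto the eigenspace for -1.\<close>

definition avg :: "nat \<Rightarrow> 'n \<Rightarrow> 'n \<Rightarrow> 'n arr" where
  "avg L a b = comb (\<lambda>m. complex_of_real ((-1) ^ m / L)) (\<lambda>m. (rot ^^ m) (unit_arr a b)) {..<L}"

text \<open>The term with \<open>L\<close> in the denominator accounts for the \<open>L\<close>
  pairs of equal exponents. The remaining 1, the bound for the dimension of the eigenspace, is the
  mean of 2 and 0; an even \<open>L\<close> makes the signs cancel exactly.\<close>

lemma h_form_avg:
  assumes L: "L = 2 * N" "N > 0"
  shows "\<exists>t \<le> (real CARD('n))\<^sup>2 / L + 1.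
    (\<Sum>a\<in>UNIV. \<Sum>b\<in>UNIV. h (form (avg L a b) (avg L a b))) = complex_of_real t"
proof -
  define s where "s m k = (-1) ^ m / L * ((-1) ^ k / L) * rot_trace (if m \<le> k then k - m else m - k)" for m k :: nat
  have "(\<Sum>a\<in>UNIV. \<Sum>b\<in>UNIV. h (form (avg L a b) (avg L a b))) =
     (\<Sum>a\<in>UNIV. \<Sum>b\<in>UNIV. \<Sum>m<L. \<Sum>k<L. complex_of_real ((-1) ^ m / L * ((-1) ^ k / L)) *
       h (form ((rot ^^ m) (unit_arr a b)) ((rot ^^ k) (unit_arr a b))))"
    by (simp add: avg_def form_comb h_sum h_scaleC)
  also have "\<dots> = (\<Sum>m<L. \<Sum>k<L. \<Sum>a\<in>UNIV. \<Sum>b\<in>UNIV. complex_of_real ((-1) ^ m / L * ((-1) ^ k / L)) *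
       h (form ((rot ^^ m) (unit_arr a b)) ((rot ^^ k) (unit_arr a b))))"
    by (simp only: sum.swap[of _ "{..<L}" UNIV])
  also have "\<dots> = complex_of_real (\<Sum>m<L. \<Sum>k<L. s m k)"
    by (simp only: h_form_rot_power flip: sum_distrib_left) (simp add: s_def)
  finally have eq: "(\<Sum>a\<in>UNIV. \<Sum>b\<in>UNIV. h (form (avg L a b) (avg L a b))) =
     complex_of_real (\<Sum>m<L. \<Sum>k<L. s m k)" .
  define c where "c = (real CARD('n))\<^sup>2"
  \<comment> \<open>\<open>1 + (-1) ^ m * (-1) ^ k\<close> is 2 or 0 according to the parity of the
    difference of exponents, in a form that factors over the double sum.\<close>
  have s: "s m k \<le> ((if m = k then c else 0) + (1 + (-1) ^ m * (-1) ^ k)) / (real L)\<^sup>2" for m k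
  proof -
    define l where "l = (if m \<le> k then k - m else m - k)"
    have "(-1) ^ m * (-1) ^ k = ((-1) ^ l :: real)"
    proof -
      have "m + k = l + 2 * min m k" by (auto simp: l_def)
      then have "((-1) ^ (m + k) :: real) = (-1) ^ l * ((-1)\<^sup>2) ^ min m k"
        by (simp only: power_add power_mult)
      then show ?thesis by (simp add: power_add)
    qed
    moreover have "m = k \<longleftrightarrow> l = 0" by (auto simp: l_def)
    moreover have "(-1) ^ l * rot_trace l \<le> (if l = 0 then c else 0) + (1 + (-1) ^ l)"
      using rot_trace(2)[of l] rot_trace_odd[of l] by (cases "even l") (auto simp: c_def)
    ultimately have "(-1) ^ m * (-1) ^ k * rot_trace l \<le> (if m = k then c else 0) + (1 + (-1) ^ m * (-1) ^ k)"
      by simp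
    then have "(-1) ^ m * (-1) ^ k * rot_trace l / (real L)\<^sup>2 \<le>
        ((if m = k then c else 0) + (1 + (-1) ^ m * (-1) ^ k)) / (real L)\<^sup>2"
      by (rule divide_right_mono) simp
    then show ?thesis by (simp add: s_def l_def power2_eq_square)
  qed
  have "L > 0" using L by simp
  have alt0: "(\<Sum>m<L. (-1) ^ m) = (0 :: real)"
    unfolding L(1) by (induction N) simp_all
  have "(\<Sum>m<L. \<Sum>k<L. s m k) \<le>
      (\<Sum>m<L. \<Sum>k<L. ((if m = k then c else 0) + (1 + (-1) ^ m * (-1) ^ k)) / (real L)\<^sup>2)"
    by (intro sum_mono s)
  also have "\<dots> = ((\<Sum>m<L. \<Sum>k<L. if m = k then c else 0) + (\<Sum>m<L. \<Sum>k<L. 1) +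
      (\<Sum>m<L. (-1) ^ m) * (\<Sum>k<L. (-1) ^ k)) / (real L)\<^sup>2"
    unfolding sum_product sum_divide_distrib[symmetric] by (simp only: sum.distrib add.assoc)
  also have "\<dots> = c / L + 1"
    unfolding alt0 using \<open>L > 0\<close> by (simp add: field_simps power2_eq_square)
  finally show ?thesis using eq by (auto simp: c_def)
qed

definition schi :: "'n ao" where
  "schi = complex_of_real (1 / real CARD('n)) *\<^sub>C chi"

text \<open>A partial sum of the series inverting \<open>edge_gram\<close>, which is
  \<open>2 * n\<close> times \<open>1 - schi\<close>. It stays within the algebra, where
  \<open>h\<close> can be evaluated.\<close>

definition neumann :: "nat \<Rightarrow> 'n ao" where
  "neumann K = complex_of_real (1 / (2 * real CARD('n))) *\<^sub>C (\<Sum>k<K. schi ^ k)"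

definition edge_gram :: "'n ao" where
  "edge_gram = of_nat (2 * CARD('n)) *\<^sub>C 1 - 2 *\<^sub>C chi"

lemma star_schi: "star schi = schi"
  by (simp add: schi_def star_scaleC star_chi)

lemma star_neumann: "star (neumann K) = neumann K"
  by (simp add: neumann_def star_scaleC star_sum star_power star_schi)

lemma neumann_mult: "neumann K * edge_gram = 1 - schi ^ K"
proof -
  have g: "edge_gram = of_nat (2 * CARD('n)) *\<^sub>C (1 - schi)"
    by (simp add: edge_gram_def schi_def scaleC_diff_right scaleC_scaleC)
  have "(\<Sum>k<K. schi ^ k) * (1 - schi) = 1 - schi ^ K"
  proof (induction K)
    case (Suc K)
    have "schi ^ K * (1 - schi) = schi ^ K - schi ^ Suc K"
      by (simp add: right_diff_distrib power_commutes)
    then show ?case using Suc by (simp add: distrib_right del: power_Suc)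
  qed simp
  then show ?thesis
    by (simp add: neumann_def g scaleC_mult_scaleC scaleC_one)
qed

lemma h_schi_power: "\<exists>t \<le> (2 / real CARD('n)) ^ m. h (schi ^ m) = complex_of_real t"
proof -
  obtain t where t: "t \<le> 2 ^ m" "h (chi ^ m) = complex_of_real t" using h_chi_power by blast
  have "(c *\<^sub>C x) ^ m = c ^ m *\<^sub>C x ^ m" for c and x :: "'n ao"
    by (induction m) (simp_all add: scaleC_one scaleC_mult_scaleC)
  then have "h (schi ^ m) = complex_of_real ((1 / real CARD('n)) ^ m * t)"
    using t(2) by (simp add: schi_def h_scaleC)
  moreover have "(1 / real CARD('n)) ^ m * t \<le> (2 / real CARD('n)) ^ m"
    using mult_left_mono[OF t(1), of "(1 / real CARD('n)) ^ m"] by (simp add: power_divide)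
  ultimately show ?thesis by blast
qed

text \<open>\<open>err K L\<close> approximates the difference of the projection onto the eigenspace of \<open>rot\<close> for \<open>-1\<close>
  and the projection \<open>inner_arr \<circ> edge_gram\<^sup>-\<^sup>1 \<circ> inner_adj\<close> onto the inner arrays, applied to
  \<open>unit_arr a b\<close>.\<close>

definition err :: "nat \<Rightarrow> nat \<Rightarrow> 'n \<Rightarrow> 'n \<Rightarrow> 'n arr" where
  "err K L a b i j = avg L a b i j - inner_arr (neumann K * (u a b - of_bool (a = b) *\<^sub>C 1)) i j"

text \<open>\<open>inner_adj\<close> absorbs \<open>-rot\<close>, so it does not see the
  averaging.\<close>

lemma inner_adj_avg: "L > 0 \<Longrightarrow> inner_adj (avg L a b) = u a b - of_bool (a = b) *\<^sub>C 1"
proof -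
  assume L: "L > 0"
  have "inner_adj (avg L a b) = (\<Sum>m<L. complex_of_real ((-1) ^ m / L) *\<^sub>C (-1) ^ m *\<^sub>C (u a b - of_bool (a = b) *\<^sub>C 1))"
    by (simp add: avg_def inner_adj_comb inner_adj_rot_power inner_adj_unit_arr)
  also have "\<dots> = (\<Sum>m<L. complex_of_real (1 / L)) *\<^sub>C (u a b - of_bool (a = b) *\<^sub>C 1)"
    unfolding scaleC_sum_left scaleC_scaleC
    by (intro sum.cong refl arg_cong2[of _ _ _ _ scaleC]) (simp flip: power_add mult_2 add: field_simps)
  finally show ?thesis using L by (simp add: scaleC_one)
qed

text \<open>Write \<open>p\<close> for \<open>neumann K\<close> and \<open>g\<close> for
  \<open>edge_gram\<close>. Expanding the square and using traciality, the terms besides that of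
  \<open>avg\<close> give \<open>-2 h(p g) + h(p g p g)\<close> with
  \<open>p g = 1 - schi ^ K\<close>, that is \<open>-1 + h(schi ^ (2 * K))\<close>. The -1 cancels
  the 1 of \<open>h_form_avg\<close>.\<close>

lemma h_form_err:
  assumes L: "L = 2 * N" "N > 0"
  shows "\<exists>t \<le> (real CARD('n))\<^sup>2 / L + (2 / real CARD('n)) ^ (2 * K).
    (\<Sum>a\<in>UNIV. \<Sum>b\<in>UNIV. h (form (err K L a b) (err K L a b))) = complex_of_real t"
proof -
  define v :: "'n \<Rightarrow> 'n \<Rightarrow> 'n ao" where "v a b = u a b - of_bool (a = b) *\<^sub>C 1" for a b
  define p where "p = neumann K"
  have sv: "star (v a b) = v a b" for a b by (simp add: v_def star_diff star_u star_bool)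
  have sg: "star edge_gram = edge_gram"
    by (simp add: edge_gram_def star_diff star_scaleC star_one star_chi)
  have gram: "inner_adj (inner_arr z) = edge_gram * z" for z :: "'n ao"
    by (simp only: inner_adj_inner_arr edge_gram_def)
  have form: "form (err K L a b) (err K L a b) =
      form (avg L a b) (avg L a b) - v a b * p * v a b - v a b * p * v a b + v a b * (p * edge_gram * p) * v a b" for a b
  proof -
    define A where "A = avg L a b"
    define W where "W = inner_arr (p * v a b)"
    have err: "err K L a b = (\<lambda>i j. A i j - W i j)"
      by (simp add: err_def A_def W_def p_def v_def fun_eq_iff)
    have "form (err K L a b) (err K L a b) = form A A - form A W - form W A + form W W"
      unfolding err form_def by (simp add: star_diff algebra_simps sum.distrib sum_subtractf)
    also have "form A W = v a b * p * v a b"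
      using L by (simp add: A_def W_def form_inner_arr inner_adj_avg mult.assoc sv flip: v_def)
    also have "form W A = star (form A W)" by (rule form_star)
    also have "form A W = v a b * p * v a b"
      using L by (simp add: A_def W_def form_inner_arr inner_adj_avg mult.assoc sv flip: v_def)
    also have "form W W = v a b * (p * edge_gram * p) * v a b"
      by (simp only: W_def form_inner_arr gram star_mult sv p_def star_neumann sg mult.assoc)
    finally show ?thesis by (simp add: A_def star_mult sv p_def star_neumann mult.assoc)
  qed
  have vv: "(\<Sum>a\<in>UNIV. \<Sum>b\<in>UNIV. v a b * v a b) = edge_gram"
    using inner_adj_inner_arr[of 1] by (simp add: inner_adj_def inner_arr_def v_def edge_gram_def)
  \<comment> \<open>Cyclicity of \<open>h\<close> brings the two outer factors together, and their
    products sum up to the Gram operator.\<close>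
  have tr: "(\<Sum>a\<in>UNIV. \<Sum>b\<in>UNIV. h (v a b * y * v a b)) = h (y * edge_gram)" for y
  proof -
    have "h (v a b * y * v a b) = h (y * (v a b * v a b))" for a b
      using h_trace[of "v a b" "y * v a b"] by (simp add: mult.assoc)
    then show ?thesis by (simp add: h_sum sum_distrib_left flip: vv)
  qed
  obtain t where t: "t \<le> (real CARD('n))\<^sup>2 / L + 1"
    "(\<Sum>a\<in>UNIV. \<Sum>b\<in>UNIV. h (form (avg L a b) (avg L a b))) = complex_of_real t"
    using h_form_avg[OF L] by blast
  obtain t' where t': "t' \<le> (2 / real CARD('n)) ^ (2 * K)" "h (schi ^ (2 * K)) = complex_of_real t'"
    using h_schi_power by blast
  have pg: "p * edge_gram = 1 - schi ^ K" by (simp add: p_def neumann_mult)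
  have "p * edge_gram * p * edge_gram = (1 - schi ^ K) * (1 - schi ^ K)"
    unfolding pg by (simp add: mult.assoc pg)
  also have "\<dots> = 1 - schi ^ K - schi ^ K + schi ^ K * schi ^ K"
    by (simp add: algebra_simps)
  also have "schi ^ K * schi ^ K = schi ^ (2 * K)"
    by (simp only: mult_2 power_add)
  finally have pgpg: "p * edge_gram * p * edge_gram = 1 - schi ^ K - schi ^ K + schi ^ (2 * K)" .
  have "(\<Sum>a\<in>UNIV. \<Sum>b\<in>UNIV. h (form (err K L a b) (err K L a b))) =
      complex_of_real t - h (p * edge_gram) - h (p * edge_gram) + h (p * edge_gram * p * edge_gram)"
    by (simp only: form h_add h_diff sum.distrib sum_subtractf t(2) tr)
  also have "\<dots> = complex_of_real (t - 1 + t')"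
  proof -
    have "h (p * edge_gram) = 1 - h (schi ^ K)"
      unfolding pg by (simp add: h_diff haar_state_1[OF haar])
    moreover have "h (p * edge_gram * p * edge_gram) = 1 - h (schi ^ K) - h (schi ^ K) + complex_of_real t'"
      unfolding pgpg by (simp add: h_add h_diff t'(2) haar_state_1[OF haar])
    ultimately show ?thesis by simp
  qed
  finally show ?thesis using t(1) t'(1) by (intro exI[of _ "t - 1 + t'"]) auto
qed

lemma norm_err:
  assumes L: "L = 2 * N" "N > 0"
  shows "(norm (\<pi> (err K L a b i j) \<Omega>))\<^sup>2 \<le> (real CARD('n))\<^sup>2 / L + (2 / real CARD('n)) ^ (2 * K)"
proof -
  obtain t where t: "t \<le> (real CARD('n))\<^sup>2 / L + (2 / real CARD('n)) ^ (2 * K)"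
    "(\<Sum>a\<in>UNIV. \<Sum>b\<in>UNIV. h (form (err K L a b) (err K L a b))) = complex_of_real t"
    using h_form_err[OF L] by blast
  define f where "f a b i j = (norm (\<pi> (err K L a b i j) \<Omega>))\<^sup>2" for a b i j
  have "complex_of_real (\<Sum>a\<in>UNIV. \<Sum>b\<in>UNIV. \<Sum>i\<in>UNIV. \<Sum>j\<in>UNIV. f a b i j) =
      (\<Sum>a\<in>UNIV. \<Sum>b\<in>UNIV. h (form (err K L a b) (err K L a b)))"
    unfolding f_def of_real_sum norm_pi by (simp add: form_def h_sum)
  then have sum: "(\<Sum>a\<in>UNIV. \<Sum>b\<in>UNIV. \<Sum>i\<in>UNIV. \<Sum>j\<in>UNIV. f a b i j) = t"
    unfolding t(2) by (simp only: of_real_eq_iff)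
  have f0: "f a b i j \<ge> 0" for a b i j by (simp add: f_def)
  have "f a b i j \<le> (\<Sum>j\<in>UNIV. f a b i j)" by (rule member_le_sum) (auto simp: f0)
  also have "\<dots> \<le> (\<Sum>i\<in>UNIV. \<Sum>j\<in>UNIV. f a b i j)"
    by (rule member_le_sum[of _ _ "\<lambda>i. \<Sum>j\<in>UNIV. f a b i j"]) (auto intro: sum_nonneg simp: f0)
  also have "\<dots> \<le> (\<Sum>b\<in>UNIV. \<Sum>i\<in>UNIV. \<Sum>j\<in>UNIV. f a b i j)"
    by (rule member_le_sum[of _ _ "\<lambda>b. \<Sum>i\<in>UNIV. \<Sum>j\<in>UNIV. f a b i j"]) (auto intro!: sum_nonneg simp: f0)
  also have "\<dots> \<le> (\<Sum>a\<in>UNIV. \<Sum>b\<in>UNIV. \<Sum>i\<in>UNIV. \<Sum>j\<in>UNIV. f a b i j)"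
    by (rule member_le_sum[of _ _ "\<lambda>a. \<Sum>b\<in>UNIV. \<Sum>i\<in>UNIV. \<Sum>j\<in>UNIV. f a b i j"]) (auto intro!: sum_nonneg simp: f0)
  finally show ?thesis using sum t(1) by (simp add: f_def)
qed

section \<open>Vanishing of edge vectors\<close>

text \<open>The inner product of an array of vectors with an array of algebra elements acting on one
  vector. It lets arrays in the algebra, such as \<open>err\<close>, be tested against arrays that
  exist only in the Hilbert space.\<close>

definition pair :: "('n \<Rightarrow> 'n \<Rightarrow> 'h) \<Rightarrow> 'n arr \<Rightarrow> 'h \<Rightarrow> complex" where
  "pair X F v = (\<Sum>i\<in>UNIV. \<Sum>j\<in>UNIV. cinner (X i j) (\<pi> (F i j) v))"

lemma pair_comb: "pair X (comb c F A) v = (\<Sum>m\<in>A. c m * pair X (F m) v)"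
  by (simp add: pair_def comb_def pi_sum pi_scaleC cinner_sum_right cinner_scaleC_right sum_distrib_left
      sum.swap[of _ A])

lemma pair_unit_arr: "pair X (unit_arr a b) v = cinner (X a b) v"
proof -
  have "cinner (X i j) (\<pi> (unit_arr a b i j) v) = (if i = a then if j = b then cinner (X a b) v else 0 else 0)" for i j
    by (simp add: unit_arr_def pi_zero pi_one cinner_zero_right)
  then have "(\<Sum>j\<in>UNIV. cinner (X i j) (\<pi> (unit_arr a b i j) v)) = (if i = a then cinner (X a b) v else 0)" for i
    by (cases "i = a") simp_all
  then show ?thesis by (simp add: pair_def)
qed

text \<open>The hypothesis says that the adjoint of \<open>rot\<close> acts on \<open>X\<close> as
  -1, which is the eigenvalue equation since \<open>rot\<close> is unitary.\<close>

lemma pair_rot: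
  assumes X: "\<And>i j. (\<Sum>k\<in>UNIV. \<pi> (u k i) (X k j)) = - X j i"
  shows "pair X (rot F) v = - pair X F v"
proof -
  have "pair X (rot F) v = (\<Sum>i\<in>UNIV. \<Sum>j\<in>UNIV. \<Sum>k\<in>UNIV. cinner (X i j) (\<pi> (u i k) (\<pi> (F j k) v)))"
    by (simp add: pair_def rot_def pi_sum pi_mult cinner_sum_right)
  also have "\<dots> = (\<Sum>i\<in>UNIV. \<Sum>j\<in>UNIV. \<Sum>k\<in>UNIV. cinner (\<pi> (u i k) (X i j)) (\<pi> (F j k) v))"
    using pi_star[of "u _ _"] by (simp add: star_u)
  also have "\<dots> = (\<Sum>j\<in>UNIV. \<Sum>k\<in>UNIV. \<Sum>i\<in>UNIV. cinner (\<pi> (u i k) (X i j)) (\<pi> (F j k) v))"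
    by (rule sum_swap3)
  also have "\<dots> = (\<Sum>j\<in>UNIV. \<Sum>k\<in>UNIV. cinner (- X j k) (\<pi> (F j k) v))"
    by (simp only: X flip: cinner_sum_left)
  also have "\<dots> = - pair X F v"
    by (simp add: pair_def cinner_minus_left sum_negf)
  finally show ?thesis .
qed

text \<open>The adjoint of \<open>inner_arr\<close> sends \<open>X\<close> to the sum of the
  \<open>\<pi> (u i j) (X i j)\<close> minus the trace of \<open>X\<close>. By the eigenvalue
  equation the first sum is minus the trace as well, so both vanish.\<close>

lemma pair_inner_arr:
  assumes X: "\<And>i j. (\<Sum>k\<in>UNIV. \<pi> (u k i) (X k j)) = - X j i" and tr: "(\<Sum>i\<in>UNIV. X i i) = 0"
  shows "pair X (inner_arr z) v = 0"
proof -
  have "pair X (inner_arr z) v = (\<Sum>i\<in>UNIV. \<Sum>j\<in>UNIV. cinner (X i j) (\<pi> (u i j) (\<pi> z v)) -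
      (if i = j then cinner (X i j) (\<pi> z v) else 0))"
    unfolding pair_def inner_arr_def
    by (intro sum.cong refl) (auto simp: cinner_zero_right pi_mult pi_diff pi_scaleC pi_one scaleC_one cinner_diff_right)
  also have "\<dots> = (\<Sum>i\<in>UNIV. \<Sum>j\<in>UNIV. cinner (\<pi> (u i j) (X i j)) (\<pi> z v)) - cinner (\<Sum>i\<in>UNIV. X i i) (\<pi> z v)"
    using pi_star[of "u _ _"] by (simp add: star_u sum_subtractf cinner_sum_left)
  also have "(\<Sum>i\<in>UNIV. \<Sum>j\<in>UNIV. cinner (\<pi> (u i j) (X i j)) (\<pi> z v)) =
      cinner (\<Sum>j\<in>UNIV. \<Sum>i\<in>UNIV. \<pi> (u i j) (X i j)) (\<pi> z v)"
    by (subst sum.swap) (simp add: cinner_sum_left)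
  also have "(\<Sum>j\<in>UNIV. \<Sum>i\<in>UNIV. \<pi> (u i j) (X i j)) = 0"
    using tr by (simp add: X sum_negf)
  finally show ?thesis by (simp add: tr cinner_zero_left)
qed

text \<open>Against \<open>X\<close> the average reproduces \<open>unit_arr a b\<close> and the
  inner part gives 0, so \<open>cinner (X a b) (\<pi> x \<Omega>)\<close> is the pairing of
  \<open>X\<close> with \<open>err\<close>. For fixed \<open>x\<close>, \<open>norm_pi_mult\<close>
  reduces this to the small norms in \<open>norm_err\<close>.\<close>

lemma edge_vector_zero:
  assumes X: "\<And>i j. (\<Sum>k\<in>UNIV. \<pi> (u k i) (X k j)) = - X j i" and tr: "(\<Sum>i\<in>UNIV. X i i) = 0"
  shows "X a b = 0"
proof (rule dense_zero)
  fix x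
  define C where "C = (\<Sum>i\<in>UNIV. \<Sum>j\<in>UNIV. norm (X i j)) * norm (\<pi> (star x))"
  have C: "C \<ge> 0" by (auto simp: C_def intro!: mult_nonneg_nonneg sum_nonneg)
  \<comment> \<open>One index drives both parameters of \<open>err\<close>: the average has
    \<open>2 * Suc N\<close> terms, an even positive number, and the Neumann sum has
    \<open>N\<close>.\<close>
  have bound: "cmod (cinner (X a b) (\<pi> x \<Omega>)) \<le> C * sqrt ((real CARD('n))\<^sup>2 / (2 * Suc N) + (2 / real CARD('n)) ^ (2 * N))" for N
  proof -
    define L where "L = 2 * Suc N"
    then have "L \<noteq> 0" by simp
    define F where "F = err N L a b"
    define e where "e = sqrt ((real CARD('n))\<^sup>2 / L + (2 / real CARD('n)) ^ (2 * N))"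
    have e: "norm (\<pi> (F i j) \<Omega>) \<le> e" for i j
      unfolding e_def F_def by (rule real_le_rsqrt, rule norm_err[of L "Suc N"]) (simp_all add: L_def)
    have pw: "pair X ((rot ^^ m) G) v = (-1) ^ m * pair X G v" for m G v
      by (induction m) (simp_all add: pair_rot[OF X])
    have "pair X (avg L a b) v = (\<Sum>m<L. complex_of_real ((-1) ^ m / L) * ((-1) ^ m * cinner (X a b) v))" for v
      by (simp add: avg_def pair_comb pw pair_unit_arr)
    also have "(\<Sum>m<L. complex_of_real ((-1) ^ m / L) * ((-1) ^ m * cinner (X a b) v)) =
        (\<Sum>m<L. complex_of_real (1 / L) * cinner (X a b) v)" for v
      by (intro sum.cong refl) (simp flip: power_add mult_2 add: field_simps)
    finally have avg: "pair X (avg L a b) v = cinner (X a b) v" for v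
      using \<open>L \<noteq> 0\<close> by simp
    have "pair X F (\<pi> x \<Omega>) = pair X (avg L a b) (\<pi> x \<Omega>) -
        pair X (inner_arr (neumann N * (u a b - of_bool (a = b) *\<^sub>C 1))) (\<pi> x \<Omega>)"
      by (simp add: pair_def F_def err_def pi_diff cinner_diff_right sum_subtractf)
    then have "cinner (X a b) (\<pi> x \<Omega>) = pair X F (\<pi> x \<Omega>)"
      by (simp add: avg pair_inner_arr[OF X tr])
    also have "cmod \<dots> \<le> (\<Sum>i\<in>UNIV. \<Sum>j\<in>UNIV. norm (X i j) * (norm (\<pi> (star x)) * e))"
      unfolding pair_def
    proof (intro sum_norm_le)
      fix i j
      have "cmod (cinner (X i j) (\<pi> (F i j) (\<pi> x \<Omega>))) \<le> norm (X i j) * norm (\<pi> (F i j) (\<pi> x \<Omega>))"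
        by (rule cinner_Cauchy_Schwarz)
      also have "\<dots> \<le> norm (X i j) * (norm (\<pi> (star x)) * e)"
        using norm_pi_mult[of "F i j" x] e[of i j]
        by (intro mult_left_mono) (meson mult_left_mono norm_ge_zero order_trans, simp)
      finally show "cmod (cinner (X i j) (\<pi> (F i j) (\<pi> x \<Omega>))) \<le> norm (X i j) * (norm (\<pi> (star x)) * e)" .
    qed
    also have "\<dots> = C * e"
      by (simp add: C_def sum_distrib_right mult.assoc)
    finally show ?thesis by (simp add: e_def L_def)
  qed
  have "(\<lambda>N. C * sqrt ((real CARD('n))\<^sup>2 / real (2 * Suc N) + (2 / real CARD('n)) ^ (2 * N))) \<longlonglongrightarrow> C * sqrt (0 + 0)"
  proof (intro tendsto_intros)
    have "(\<lambda>N. (real CARD('n))\<^sup>2 / 2 * inverse (real (Suc N))) \<longlonglongrightarrow> (real CARD('n))\<^sup>2 / 2 * 0"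
      by (intro tendsto_intros LIMSEQ_inverse_real_of_nat)
    then show "(\<lambda>N. (real CARD('n))\<^sup>2 / real (2 * Suc N)) \<longlonglongrightarrow> 0"
      by (simp add: field_simps)
    have "(\<lambda>N. ((2 / real CARD('n))\<^sup>2) ^ N) \<longlonglongrightarrow> 0"
      using card by (intro LIMSEQ_realpow_zero) (auto simp: power_less_one_iff)
    then show "(\<lambda>N. (2 / real CARD('n)) ^ (2 * N)) \<longlonglongrightarrow> 0"
      by (simp add: power_mult)
  qed
  then have "cmod (cinner (X a b) (\<pi> x \<Omega>)) \<le> C * sqrt (0 + 0)"
    using bound by (intro LIMSEQ_le_const) auto
  then show "cinner (X a b) (\<pi> x \<Omega>) = 0" by simp
qed

end

section \<open>Derivations\<close>

lemma blinfun_eq_iff: "f = g \<longleftrightarrow> (\<forall>v. blinfun_apply f v = blinfun_apply g v)"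
  by (auto intro: blinfun_eqI)

context haar_gns
begin

lemma suminf_blinfun_commute:
  fixes S :: "'h \<Rightarrow>\<^sub>L 'h"
  assumes "summable (\<lambda>k. a k :: 'h \<Rightarrow>\<^sub>L 'h)" "\<And>k. S o\<^sub>L a k = a k o\<^sub>L S"
  shows "S o\<^sub>L suminf a = suminf a o\<^sub>L S"
proof -
  have "S o\<^sub>L suminf a = suminf (\<lambda>k. S o\<^sub>L a k)"
    by (rule bounded_linear.suminf[OF bounded_bilinear.bounded_linear_right[OF bounded_bilinear_blinfun_compose] assms(1)])
  also have "\<dots> = suminf (\<lambda>k. a k o\<^sub>L S)" using assms(2) by simp
  also have "\<dots> = suminf a o\<^sub>L S"
    by (rule bounded_linear.suminf[OF bounded_bilinear.bounded_linear_left[OF bounded_bilinear_blinfun_compose] assms(1), symmetric])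
  finally show ?thesis .
qed

text \<open>Complex linearity is commutation with the scalars, so the commutation argument in
  \<open>solve_chi\<close> covers it too.\<close>

lemma bounded_operators_commute:
  fixes T :: "'h \<Rightarrow>\<^sub>L 'h"
  shows "T \<in> bounded_operators \<longleftrightarrow> (\<forall>c. (c *\<^sub>C id_blinfun) o\<^sub>L T = T o\<^sub>L (c *\<^sub>C id_blinfun))"
  by (auto simp: bounded_operators_def complex_linear_def blinfun_eq_iff scaleC_blinfun.rep_eq
      blinfun.add_right)

text \<open>The Neumann series with terms \<open>- \<pi> (chi ^ k) y / n ^ (k + 1)\<close> converges
  since \<open>norm (\<pi> chi) \<le> 2 < n\<close>. Whatever commutes with \<open>y\<close> and
  \<open>\<pi> chi\<close> commutes with each term, hence with the sum; this puts the sum into the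
  bicommutant.\<close>

lemma solve_chi:
  assumes y: "y \<in> commutant (commutant (range \<pi>))"
  shows "\<exists>m\<in>commutant (commutant (range \<pi>)). (\<pi> chi o\<^sub>L m) - of_nat CARD('n) *\<^sub>C m = y"
proof -
  define n where "n = real CARD('n)"
  have n: "n \<ge> 3" using card by (simp add: n_def)
  define a :: "nat \<Rightarrow> 'h \<Rightarrow>\<^sub>L 'h" where
    "a k = rec_nat (- ((1 / n) *\<^sub>R y)) (\<lambda>_ b. (1 / n) *\<^sub>R (\<pi> chi o\<^sub>L b)) k" for k
  have a0: "a 0 = - ((1 / n) *\<^sub>R y)" and aS: "a (Suc k) = (1 / n) *\<^sub>R (\<pi> chi o\<^sub>L a k)" for k
    by (simp_all add: a_def)
  have "norm (\<pi> chi) \<le> 2" by (rule norm_blinfun_bound) (simp_all add: norm_pi_chi)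
  have norm_a: "norm (a k) \<le> norm (a 0) * (2 / n) ^ k" for k
  proof (induction k)
    case (Suc k)
    have "norm (a (Suc k)) \<le> (1 / n) * (norm (\<pi> chi) * norm (a k))"
      using n norm_blinfun_compose[of "\<pi> chi" "a k"] by (simp add: aS divide_right_mono)
    also have "\<dots> \<le> (1 / n) * (2 * (norm (a 0) * (2 / n) ^ k))"
      using n Suc \<open>norm (\<pi> chi) \<le> 2\<close> by (intro mult_left_mono mult_mono) auto
    finally show ?case by (simp add: mult_ac)
  qed simp
  have "summable (\<lambda>k. norm (a 0) * (2 / n) ^ k)"
    using n by (intro summable_mult summable_geometric) simp
  then have sum: "summable a"
    by (rule summable_comparison_test'[of _ 0]) (use norm_a in simp)
  define m where "m = suminf a"
  have "\<pi> chi o\<^sub>L m = suminf (\<lambda>k. \<pi> chi o\<^sub>L a k)"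
    unfolding m_def
    by (rule bounded_linear.suminf[OF bounded_bilinear.bounded_linear_right[OF bounded_bilinear_blinfun_compose] sum])
  also have "\<dots> = suminf (\<lambda>k. n *\<^sub>R a (Suc k))" using n by (simp add: aS)
  also have "\<dots> = n *\<^sub>R suminf (\<lambda>k. a (Suc k))"
    by (rule suminf_scaleR_right[symmetric]) (simp add: sum summable_Suc_iff)
  also have "suminf (\<lambda>k. a (Suc k)) = m - a 0"
    using suminf_split_head[OF sum] by (simp add: m_def)
  finally have "\<pi> chi o\<^sub>L m = n *\<^sub>R m + y" using n by (simp add: a0 scaleR_add_right)
  moreover have "n *\<^sub>R m = of_nat CARD('n) *\<^sub>C m"
    by (rule blinfun_eqI) (simp add: n_def scaleR_scaleC scaleC_blinfun.rep_eq blinfun.scaleR_left)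
  ultimately have eq: "(\<pi> chi o\<^sub>L m) - of_nat CARD('n) *\<^sub>C m = y" by simp
  have comm: "S o\<^sub>L m = m o\<^sub>L S" if S: "S o\<^sub>L y = y o\<^sub>L S" "S o\<^sub>L \<pi> chi = \<pi> chi o\<^sub>L S" for S
  proof -
    have "S o\<^sub>L a k = a k o\<^sub>L S" for k
    proof (induction k)
      case 0
      show ?case using S(1) by (simp add: a0 blinfun_eq_iff blinfun.minus_left blinfun.minus_right
            blinfun.scaleR_left blinfun.scaleR_right)
    next
      case (Suc k)
      then show ?case using S(2) by (simp add: aS blinfun_eq_iff blinfun.scaleR_left blinfun.scaleR_right)
    qed
    then show ?thesis unfolding m_def by (rule suminf_blinfun_commute[OF sum])
  qed
  have y': "y \<in> bounded_operators" "\<And>S. S \<in> commutant (range \<pi>) \<Longrightarrow> y o\<^sub>L S = S o\<^sub>L y"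
    using y by (auto simp: commutant_def)
  have "\<pi> chi \<in> bounded_operators" using pi_rep by (auto simp: star_representation_def)
  then have "m \<in> bounded_operators"
    using comm y'(1) unfolding bounded_operators_commute by blast
  moreover have "m o\<^sub>L S = S o\<^sub>L m" if "S \<in> commutant (range \<pi>)" for S
    using comm[of S] y'(2)[OF that] that by (simp add: commutant_def)
  ultimately have "m \<in> commutant (commutant (range \<pi>))" by (simp add: commutant_def)
  with eq show ?thesis by blast
qed

lemma counit_simps:
  "counit (x + y) = counit x + counit y" "counit (c *\<^sub>C x) = c * counit x"
  "counit (x * y) = counit x * counit y" "counit (1 :: 'n ao) = 1" for x y :: "'n ao"
  using unital_algebra_hom_counit[where 'a = 'n]
  by (simp_all add: unital_algebra_hom_def complex_linear_def scaleC_complex_def)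

lemma counit_chi: "counit (chi :: 'n ao) = of_nat CARD('n)"
  using complex_linear_sum[of counit "\<lambda>i. u i i" "UNIV :: 'n set"] unital_algebra_hom_counit[where 'a = 'n]
  by (simp add: chi_def counit_u unital_algebra_hom_def)

definition derivation :: "('n ao \<Rightarrow> 'h \<Rightarrow>\<^sub>L 'h) \<Rightarrow> bool" where
  "derivation c \<longleftrightarrow> complex_linear c \<and> (\<forall>x y. c (x * y) = (\<pi> x o\<^sub>L c y) + counit y *\<^sub>C c x)"

lemma pi_commute_scaleC: "\<pi> x (a *\<^sub>C v) = a *\<^sub>C \<pi> x v"
proof -
  have "\<pi> x \<in> bounded_operators"
    using pi_rep by (auto simp: star_representation_def)
  then show ?thesis by (simp add: bounded_operators_def complex_linear_def)
qed

lemma derivation_add: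
  assumes "derivation c" "derivation d"
  shows "derivation (\<lambda>x. c x + d x)"
  using assms unfolding derivation_def complex_linear_def
  by (simp add: scaleC_add_right bounded_bilinear.add_right[OF bounded_bilinear_blinfun_compose] ac_simps)

lemma derivation_scaleC:
  assumes "derivation c"
  shows "derivation (\<lambda>x. a *\<^sub>C c x)"
proof -
  have "\<pi> x o\<^sub>L (a *\<^sub>C T) = a *\<^sub>C (\<pi> x o\<^sub>L T)" for x and T :: "'h \<Rightarrow>\<^sub>L 'h"
    by (rule blinfun_eqI) (simp add: scaleC_blinfun.rep_eq pi_commute_scaleC)
  then show ?thesis
    using assms unfolding derivation_def complex_linear_def
    by (simp add: scaleC_add_right scaleC_scaleC mult.commute)
qed

text \<open>Applying \<open>c\<close> to the orthogonality relations of the columns of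
  \<open>u\<close> gives the hypothesis of \<open>edge_vector_zero\<close> at each vector
  \<open>v\<close>, and \<open>c chi = 0\<close> is its trace condition. A cocycle that vanishes on
  the generators vanishes on all words.\<close>

lemma derivation_zero:
  assumes c: "derivation c" and chi: "c chi = 0"
  shows "c x = 0"
proof -
  have lin: "complex_linear c" and mult: "c (x * y) = (\<pi> x o\<^sub>L c y) + counit y *\<^sub>C c x" for x y
    using c by (auto simp: derivation_def)
  have c1: "c 1 = 0"
  proof -
    have "\<pi> 1 o\<^sub>L c 1 = c 1"
      by (rule blinfun_eqI) (simp add: pi_one)
    then show ?thesis
      using mult[of 1 1] by (simp add: counit_simps scaleC_one)
  qed
  have u: "c (u a b) = 0" for a b
  proof (rule blinfun_eqI)
    fix v
    define X where "X i j = c (u i j) v" for i j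
    have "X a b = 0"
    proof (rule edge_vector_zero)
      fix i j
      have "c (\<Sum>k\<in>UNIV. u k i * u k j) = 0"
        using c1 complex_linear_0[OF lin] by (simp add: u_orthogonal)
      then have "(\<Sum>k\<in>UNIV. (\<pi> (u k i) o\<^sub>L c (u k j)) + of_bool (k = j) *\<^sub>C c (u k i)) = 0"
        by (simp add: complex_linear_sum[OF lin] mult counit_u)
      then have "blinfun_apply (\<Sum>k\<in>UNIV. (\<pi> (u k i) o\<^sub>L c (u k j)) + of_bool (k = j) *\<^sub>C c (u k i)) v = 0"
        by simp
      moreover have "blinfun_apply (\<Sum>k\<in>UNIV. (\<pi> (u k i) o\<^sub>L c (u k j)) + of_bool (k = j) *\<^sub>C c (u k i)) v =
          (\<Sum>k\<in>UNIV. \<pi> (u k i) (X k j) + (if k = j then X k i else 0))"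
        unfolding blinfun.sum_left
        by (intro sum.cong refl) (auto simp: X_def blinfun.add_left scaleC_blinfun.rep_eq scaleC_one)
      ultimately show "(\<Sum>k\<in>UNIV. \<pi> (u k i) (X k j)) = - X j i"
        by (simp add: sum.distrib eq_neg_iff_add_eq_0)
    next
      have "(\<Sum>i\<in>UNIV. c (u i i)) = 0"
        using chi by (simp add: chi_def complex_linear_sum[OF lin])
      then show "(\<Sum>i\<in>UNIV. X i i) = 0"
        by (simp add: X_def flip: blinfun.sum_left)
    qed
    then show "c (u a b) v = blinfun_apply 0 v" by (simp add: X_def)
  qed
  have word: "c (uword i j) = 0" if "length i = length j" for i j
    using that by (induction i j rule: list_induct2) (simp_all add: c1 mult u)
  show ?thesis
    by (induction x rule: ao_induct) (simp_all add: word complex_linear_add[OF lin] complex_linear_scaleC[OF lin])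
qed

lemma derivation_inner:
  "derivation (\<lambda>x. (\<pi> x o\<^sub>L m) - counit x *\<^sub>C m)" if m: "m \<in> bounded_operators" for m
proof -
  have "complex_linear (\<lambda>x. (\<pi> x o\<^sub>L m) - counit x *\<^sub>C m)"
    by (simp add: complex_linear_def blinfun_eq_iff blinfun.diff_left blinfun.add_left scaleC_blinfun.rep_eq
        pi_add pi_scaleC counit_simps scaleC_add_left scaleC_diff_right scaleC_scaleC)
  moreover have "(\<pi> (x * y) o\<^sub>L m) - counit (x * y) *\<^sub>C m =
      (\<pi> x o\<^sub>L ((\<pi> y o\<^sub>L m) - counit y *\<^sub>C m)) + counit y *\<^sub>C ((\<pi> x o\<^sub>L m) - counit x *\<^sub>C m)" for x y
  proof (rule blinfun_eqI)
    fix v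
    show "((\<pi> (x * y) o\<^sub>L m) - counit (x * y) *\<^sub>C m) v =
      ((\<pi> x o\<^sub>L ((\<pi> y o\<^sub>L m) - counit y *\<^sub>C m)) + counit y *\<^sub>C ((\<pi> x o\<^sub>L m) - counit x *\<^sub>C m)) v"
      by (simp add: blinfun.diff_left blinfun.add_left scaleC_blinfun.rep_eq pi_mult counit_simps
          blinfun.diff_right pi_commute_scaleC scaleC_diff_right scaleC_scaleC mult.commute)
  qed
  ultimately show ?thesis by (simp add: derivation_def)
qed

lemma derivation_is_inner:
  assumes c: "derivation c" and M: "c chi \<in> commutant (commutant (range \<pi>))"
  shows "\<exists>m\<in>commutant (commutant (range \<pi>)). c = (\<lambda>x. (\<pi> x o\<^sub>L m) - counit x *\<^sub>C m)"
proof -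
  obtain m where m: "m \<in> commutant (commutant (range \<pi>))"
    "(\<pi> chi o\<^sub>L m) - of_nat CARD('n) *\<^sub>C m = c chi" using solve_chi[OF M] by blast
  define d where "d x = c x + (- 1) *\<^sub>C ((\<pi> x o\<^sub>L m) - counit x *\<^sub>C m)" for x
  have neg: "(- 1) *\<^sub>C T = - T" for T :: "'h \<Rightarrow>\<^sub>L 'h"
    using scaleC_add_left[of "-1" 1 T] by (simp add: scaleC_one eq_neg_iff_add_eq_0)
  have "m \<in> bounded_operators" using m(1) by (simp add: commutant_def)
  then have "derivation d"
    unfolding d_def by (intro derivation_add derivation_scaleC derivation_inner c)
  moreover have "d chi = 0" using m(2) by (simp add: d_def counit_chi neg)
  ultimately have "d x = 0" for x by (rule derivation_zero)
  then have "c = (\<lambda>x. (\<pi> x o\<^sub>L m) - counit x *\<^sub>C m)"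
    by (intro ext) (metis d_def neg eq_neg_iff_add_eq_0 minus_minus)
  with m(1) show ?thesis by blast
qed

end

text \<open>With a commutant in place of \<open>A\<close>, this makes \<open>M\<close> a complex
  subspace closed under composition, so that coboundaries take values in \<open>M\<close>.\<close>

lemma commutant_closed:
  fixes A :: "('h::complex_hilbert_space \<Rightarrow>\<^sub>L 'h) set"
  assumes A: "A \<subseteq> bounded_operators"
  shows "0 \<in> commutant A"
    and "S \<in> commutant A \<Longrightarrow> T \<in> commutant A \<Longrightarrow> S + T \<in> commutant A"
    and "S \<in> commutant A \<Longrightarrow> c *\<^sub>C S \<in> commutant A"
    and "S \<in> commutant A \<Longrightarrow> T \<in> commutant A \<Longrightarrow> S o\<^sub>L T \<in> commutant A"
proof -
  have lin: "a (c *\<^sub>C v) = c *\<^sub>C a v" if "a \<in> A" for a c v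
    using A that by (auto simp: bounded_operators_def complex_linear_def)
  show "0 \<in> commutant A"
    by (simp add: commutant_def bounded_operators_def complex_linear_def blinfun_eq_iff blinfun.zero_right)
  show "S \<in> commutant A \<Longrightarrow> T \<in> commutant A \<Longrightarrow> S + T \<in> commutant A"
    by (simp add: commutant_def bounded_operators_def complex_linear_def blinfun_eq_iff blinfun.add_left
        blinfun.add_right scaleC_add_right)
  show "S \<in> commutant A \<Longrightarrow> c *\<^sub>C S \<in> commutant A"
    by (simp add: commutant_def bounded_operators_def complex_linear_def blinfun_eq_iff scaleC_blinfun.rep_eq
        scaleC_add_right scaleC_scaleC lin mult.commute)
  show "S \<in> commutant A \<Longrightarrow> T \<in> commutant A \<Longrightarrow> S o\<^sub>L T \<in> commutant A"
    by (simp add: commutant_def bounded_operators_def complex_linear_def blinfun_eq_iff)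
qed

lemma commutant_bounded: "commutant A \<subseteq> bounded_operators"
  by (auto simp: commutant_def)

lemma bicommutant_superset: "A \<subseteq> bounded_operators \<Longrightarrow> A \<subseteq> commutant (commutant A)"
  by (auto simp: commutant_def)

lemma (in group) trivial_group_Mod_carrier: "trivial_group (G Mod carrier G)"
proof -
  have "carrier G \<lhd> G"
    by (rule normal_invI) (simp_all add: subgroup_self)
  moreover from this have "carrier (G Mod carrier G) = {\<one>\<^bsub>G Mod carrier G\<^esub>}"
    by (auto simp: FactGroup_def RCOSETS_def coset_join2 subgroup_self)
  ultimately show ?thesis
    by (simp add: trivial_group_def normal.factorgroup_is_group)
qed

theorem corollary5p2:
  fixes h :: "'n::finite ao \<Rightarrow> complex"
    and \<pi> :: "'n ao \<Rightarrow> ('h::complex_hilbert_space \<Rightarrow>\<^sub>L 'h)"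
    and \<Omega> :: 'h
    and M :: "('h \<Rightarrow>\<^sub>L 'h) set"
  assumes "CARD('n) \<ge> 3"
    and "haar_state h"
    and "gns_representation h \<pi> \<Omega>"
    and "M = commutant (commutant (range \<pi>))"
  shows "trivial_group (hochschild_H1 (\<lambda>x m. \<pi> x o\<^sub>L m) (\<lambda>m x. counit x *\<^sub>C m) M)"
proof -
  interpret haar_gns h \<pi> \<Omega>
    using assms by unfold_locales
  define G where "G = hochschild_Z1 (\<lambda>x m. \<pi> x o\<^sub>L m) (\<lambda>m x. counit x *\<^sub>C m) M"
  note M_closed = commutant_closed[OF commutant_bounded[of "range \<pi>"], folded assms(4)]
  have "range \<pi> \<subseteq> M"
    using bicommutant_superset[of "range \<pi>"] pi_rep by (simp add: assms(4) star_representation_def)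
  then have pi_M: "\<pi> x \<in> M" for x by blast
  have M_bounded: "M \<subseteq> bounded_operators" by (simp add: assms(4) commutant_bounded)
  have carrier: "c \<in> carrier G \<longleftrightarrow> range c \<subseteq> M \<and> derivation c" for c
    by (auto simp: G_def hochschild_Z1_def derivation_def)
  have add: "(\<lambda>x. c x + d x) \<in> carrier G" if "c \<in> carrier G" "d \<in> carrier G" for c d
    using that M_closed(2) derivation_add by (simp add: carrier image_subset_iff)
  have scale: "(\<lambda>x. a *\<^sub>C c x) \<in> carrier G" if "c \<in> carrier G" for a c
    using that M_closed(3) derivation_scaleC by (simp add: carrier image_subset_iff)
  have zero: "(\<lambda>x. 0) \<in> carrier G"
    using M_closed(1) by (auto simp: carrier derivation_def complex_linear_def blinfun_eq_iff blinfun.zero_right)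
  have ops: "c \<otimes>\<^bsub>G\<^esub> d = (\<lambda>x. c x + d x)" "\<one>\<^bsub>G\<^esub> = (\<lambda>x. 0)" for c d
    by (simp_all add: G_def hochschild_Z1_def)
  interpret G: group G
  proof (rule groupI)
    fix c assume "c \<in> carrier G"
    moreover have "(- 1) *\<^sub>C c x + c x = 0" for x
      using scaleC_add_left[of "-1" 1 "c x"] by (simp add: scaleC_one)
    ultimately show "\<exists>d\<in>carrier G. d \<otimes>\<^bsub>G\<^esub> c = \<one>\<^bsub>G\<^esub>"
      using scale[of c "-1"] by (intro bexI[of _ "\<lambda>x. (- 1) *\<^sub>C c x"]) (simp_all add: ops)
  qed (auto simp: ops add zero add.assoc)
  have "hochschild_B1 (\<lambda>x m. \<pi> x o\<^sub>L m) (\<lambda>m x. counit x *\<^sub>C m) M = carrier G"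
  proof (intro equalityI subsetI)
    fix c assume "c \<in> carrier G"
    then show "c \<in> hochschild_B1 (\<lambda>x m. \<pi> x o\<^sub>L m) (\<lambda>m x. counit x *\<^sub>C m) M"
      using derivation_is_inner[of c] unfolding hochschild_B1_def carrier assms(4) by blast
  next
    fix c assume "c \<in> hochschild_B1 (\<lambda>x m. \<pi> x o\<^sub>L m) (\<lambda>m x. counit x *\<^sub>C m) M"
    then obtain m where m: "m \<in> M" "c = (\<lambda>x. (\<pi> x o\<^sub>L m) - counit x *\<^sub>C m)"
      unfolding hochschild_B1_def by blast
    have "c x \<in> M" for x
    proof -
      have "c x = (\<pi> x o\<^sub>L m) + (- counit x) *\<^sub>C m"
        using scaleC_add_left[of "counit x" "- counit x" m] by (simp add: m(2) diff_eq_eq add.assoc add.commute)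
      then show ?thesis using M_closed(2-4) m(1) pi_M by simp
    qed
    moreover have "derivation c"
      unfolding m(2) using m(1) M_bounded by (intro derivation_inner) blast
    ultimately show "c \<in> carrier G" unfolding carrier by blast
  qed
  then show ?thesis
    using G.trivial_group_Mod_carrier by (simp add: hochschild_H1_def G_def)
qed

end
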